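(* Let $\{Z(t)\}_{t\ge0}$ be an $\mathcal F_t$-adapted $H$-valued process with $|Z(t)|=1$ for all $t\geq 0$, let $\Gamma_Z(t)=Z(t)\otimes Y(t)$, and let $X(t)=\mathcal S(t)X_0+\int_0^t\mathcal S(t-s)\Gamma_Z(s)\,dB(s)$. For each $t\ge0$ the covariance operator $Q_{X(t)}$ of $X(t)$, defined by $$\langle Q_{X(t)}f,g\rangle=\mathbb E\left[\langle X(t)-\mathbb E[X(t)],f\rangle\,\langle X(t)-\mathbb E[X(t)],g\rangle\right],\qquad f,g\in H,$$ is given by $$Q_{X(t)}=\int_0^t\mathcal S(t-s)\,\mathbb E\left[|Q_B^{1/2}Z(s)|^2\,\mathcal V(s)\right]\mathcal S^*(t-s)\,ds .$$
   Context: $(\Omega,\mathcal F,\{\mathcal F_t\}_{t\ge0},\mathbb P)$ is a filtered probability space. $H$ is a real separable Hilbert space with inner product $\langle\cdot,\cdot\rangle$ and norm $|\cdot|$; $L(H)$ is the space of bounded linear operators on $H$. For $f,g\in H$ the tensor product is the operator $f\otimes g:=\langle f,\cdot\rangle g$, and $f^{\otimes2}:=f\otimes f$. $\{W(t)\}_{t\ge0}$ and $\{B(t)\}_{t\ge0}$ are independent $H$-valued $\mathcal F_t$-Wiener processes with covariance operators $Q_W$ and $Q_B$ respectively (both symmetric, positive definite, trace class). $\mathcal A$ is a densely defined operator on $H$ generating a $C_0$-semigroup $\{\mathcal U(t)\}_{t\ge0}$, $\eta\in L(H)$, $Y_0\in H$, and $\{Y(t)\}_{t\ge0}$ is the mild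 solution of $dY(t)=\mathcal AY(t)\,dt+\eta\,dW(t)$, $Y(0)=Y_0$, i.e. $Y(t)=\mathcal U(t)Y_0+\int_0^t\mathcal U(t-s)\eta\,dW(s)$. The tensor Heston stochastic variance process is $\mathcal V(t):=Y(t)^{\otimes2}$. The processes $Y$ and $Z$ are understood to be measurable in time (predictable), so that stochastic and time integrals involving them make sense. $\mathcal C$ is a densely defined operator on $H$ generating a $C_0$-semigroup $\{\mathcal S(t)\}_{t\ge0}$ and $X_0\in H$; $\{X(t)\}_{t\ge 0}$ is the mild solution of $dX(t)=\mathcal CX(t)\,dt+\Gamma_Z(t)\,dB(t)$, $X(0)=X_0$. *)

theory Defs
  imports "HOL-Probability.Probability"
begin

section \<open>Operators on a real separable Hilbert space\<close>

text \<open>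
  A real separable Hilbert space is a type of sort
  \<open>{real_inner, banach, second_countable_topology}\<close>: for metric spaces, second countability
  is separability.  \<open>L(H)\<close> is the type of bounded linear functions.
\<close>

lift_definition tensor :: "'h::real_inner \<Rightarrow> 'h \<Rightarrow> 'h \<Rightarrow>\<^sub>L 'h"  (infixr \<open>\<otimes>\<^sub>H\<close> 75)
  is "\<lambda>f g x. (f \<bullet> x) *\<^sub>R g"
  by (intro bounded_linear_scaleR_const bounded_linear_inner_right)

definition blinfun_adjoint :: "('h::real_inner \<Rightarrow>\<^sub>L 'h) \<Rightarrow> 'h \<Rightarrow>\<^sub>L 'h"
  where "blinfun_adjoint T = Blinfun (adjoint (blinfun_apply T))"

definition symmetric_op :: "('h::real_inner \<Rightarrow>\<^sub>L 'h) \<Rightarrow> bool"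
  where "symmetric_op Q \<longleftrightarrow> (\<forall>x y. Q x \<bullet> y = x \<bullet> Q y)"

definition positive_op :: "('h::real_inner \<Rightarrow>\<^sub>L 'h) \<Rightarrow> bool"
  where "positive_op Q \<longleftrightarrow> (\<forall>x. Q x \<bullet> x \<ge> 0)"

definition orthonormal_basis :: "'h::real_inner set \<Rightarrow> bool"
  where "orthonormal_basis E \<longleftrightarrow>
    pairwise orthogonal E \<and> (\<forall>e\<in>E. norm e = 1) \<and> closure (span E) = UNIV"

text \<open>
  For a symmetric positive operator, being trace class means that its trace along an
  orthonormal basis is finite; the sum does not depend on the basis.
\<close>

definition covariance_class :: "('h::real_inner \<Rightarrow>\<^sub>L 'h) \<Rightarrow> bool"
  where "covariance_class Q \<longleftrightarrow> symmetric_op Q \<and> positive_op Q \<and>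
    (\<exists>E. orthonormal_basis E \<and> (\<integral>\<^sup>+e. ennreal (Q e \<bullet> e) \<partial>count_space E) < \<infinity>)"

text \<open>The symmetric positive square root of a symmetric positive operator exists and is unique.\<close>

definition op_sqrt :: "('h::real_inner \<Rightarrow>\<^sub>L 'h) \<Rightarrow> 'h \<Rightarrow>\<^sub>L 'h"
  where "op_sqrt Q = (SOME R. symmetric_op R \<and> positive_op R \<and> R o\<^sub>L R = Q)"

text \<open>Squared Hilbert--Schmidt norm; it does not depend on the basis that is chosen.\<close>

definition hs_norm_sq :: "('h::real_inner \<Rightarrow>\<^sub>L 'h) \<Rightarrow> ennreal"
  where "hs_norm_sq T =
    (\<integral>\<^sup>+e. ennreal ((norm (T e))\<^sup>2) \<partial>count_space (SOME E. orthonormal_basis E))"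


section \<open>Strongly continuous semigroups and their generators\<close>

definition C0_semigroup :: "(real \<Rightarrow> 'h::real_normed_vector \<Rightarrow>\<^sub>L 'h) \<Rightarrow> bool"
  where "C0_semigroup S \<longleftrightarrow> S 0 = id_blinfun \<and>
    (\<forall>s\<ge>0. \<forall>t\<ge>0. S (s + t) = S s o\<^sub>L S t) \<and>
    (\<forall>x. ((\<lambda>t. S t x) \<longlongrightarrow> x) (at_right 0))"

text \<open>An unbounded operator is given by its domain \<open>D\<close> and its action \<open>A\<close> on \<open>D\<close>.\<close>

definition is_generator ::
    "'h::real_normed_vector set \<Rightarrow> ('h \<Rightarrow> 'h) \<Rightarrow> (real \<Rightarrow> 'h \<Rightarrow>\<^sub>L 'h) \<Rightarrow> bool"
  where "is_generator D A S \<longleftrightarrow>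
    D = {x. \<exists>y. ((\<lambda>h. (S h x - x) /\<^sub>R h) \<longlongrightarrow> y) (at_right 0)} \<and>
    (\<forall>x\<in>D. ((\<lambda>h. (S h x - x) /\<^sub>R h) \<longlongrightarrow> A x) (at_right 0))"


section \<open>Bochner integral in a not necessarily separable space\<close>

text \<open>
  The library's Bochner integral needs a second countable target, which \<open>L(H)\<close> with the
  operator norm is not.  This is the same construction without that restriction:
  integrals of simple functions converging to \<open>f\<close> in \<open>L\<^sup>1\<close>.
\<close>

definition has_Bochner ::
    "'a measure \<Rightarrow> ('a \<Rightarrow> 'b::real_normed_vector) \<Rightarrow> 'b \<Rightarrow> bool"
  where "has_Bochner M f x \<longleftrightarrow> (\<exists>s.
    (\<forall>i. Bochner_Integration.simple_bochner_integrable M (s i)) \<and>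
    (\<forall>i. (\<lambda>w. norm (f w - s i w)) \<in> borel_measurable M) \<and>
    (\<lambda>i. \<integral>\<^sup>+w. ennreal (norm (f w - s i w)) \<partial>M) \<longlonglongrightarrow> 0 \<and>
    (\<lambda>i. Bochner_Integration.simple_bochner_integral M (s i)) \<longlonglongrightarrow> x)"

definition Bochner_integrable :: "'a measure \<Rightarrow> ('a \<Rightarrow> 'b::real_normed_vector) \<Rightarrow> bool"
  where "Bochner_integrable M f \<longleftrightarrow> (\<exists>x. has_Bochner M f x)"

definition Bochner_integral :: "'a measure \<Rightarrow> ('a \<Rightarrow> 'b::real_normed_vector) \<Rightarrow> 'b"
  where "Bochner_integral M f = (THE x. has_Bochner M f x)"


section \<open>Filtrations and processes on \<open>[0,\<infinity>)\<close>\<close>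

text \<open>
  Time is of type \<^typ>\<open>real\<close>; values of filtrations, semigroups and processes at negative
  times play no role.
\<close>

definition filtered_prob_space :: "'a measure \<Rightarrow> (real \<Rightarrow> 'a measure) \<Rightarrow> bool"
  where "filtered_prob_space M F \<longleftrightarrow> prob_space M \<and>
    (\<forall>t\<ge>0. subalgebra M (F t)) \<and>
    (\<forall>s t. 0 \<le> s \<and> s \<le> t \<longrightarrow> sets (F s) \<subseteq> sets (F t))"

definition adapted_process ::
    "(real \<Rightarrow> 'a measure) \<Rightarrow> (real \<Rightarrow> 'a \<Rightarrow> 'h::topological_space) \<Rightarrow> bool"
  where "adapted_process F Y \<longleftrightarrow> (\<forall>t\<ge>0. Y t \<in> borel_measurable (F t))"

definition predictable_algebra ::
    "'a measure \<Rightarrow> (real \<Rightarrow> 'a measure) \<Rightarrow> (real \<times> 'a) measure"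
  where "predictable_algebra M F = sigma ({0..} \<times> space M)
    ({{0} \<times> A | A. A \<in> sets (F 0)} \<union>
     {{s<..t} \<times> A | s t A. 0 \<le> s \<and> s < t \<and> A \<in> sets (F s)})"

definition predictable_process ::
    "'a measure \<Rightarrow> (real \<Rightarrow> 'a measure) \<Rightarrow> (real \<Rightarrow> 'a \<Rightarrow> 'h::topological_space) \<Rightarrow> bool"
  where "predictable_process M F Y \<longleftrightarrow>
    (\<lambda>(t, w). Y t w) \<in> borel_measurable (predictable_algebra M F)"

definition normal_variable :: "'a measure \<Rightarrow> ('a \<Rightarrow> real) \<Rightarrow> real \<Rightarrow> real \<Rightarrow> bool"
  where "normal_variable M X \<mu> v \<longleftrightarrow> X \<in> borel_measurable M \<and>
    (if v = 0 then (AE w in M. X w = \<mu>)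
     else v > 0 \<and> distributed M lborel X (normal_density \<mu> (sqrt v)))"

text \<open>
  An \<open>H\<close>-valued increment is centred Gaussian with covariance operator \<open>(t - s) Q\<close> if each of
  its scalar projections is centred Gaussian with the corresponding variance.
\<close>

definition Wiener_process ::
    "'a measure \<Rightarrow> (real \<Rightarrow> 'a measure) \<Rightarrow> (real \<Rightarrow> 'a \<Rightarrow> 'h::real_inner) \<Rightarrow> ('h \<Rightarrow>\<^sub>L 'h) \<Rightarrow> bool"
  where "Wiener_process M F W Q \<longleftrightarrow>
    covariance_class Q \<and> adapted_process F W \<and>
    (AE w in M. W 0 w = 0) \<and>
    (AE w in M. continuous_on {0..} (\<lambda>t. W t w)) \<and>
    (\<forall>s t. 0 \<le> s \<and> s \<le> t \<longrightarrow>
       prob_space.indep_set M (sets (F s))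
         {(\<lambda>w. W t w - W s w) -` A \<inter> space M | A. A \<in> sets borel}) \<and>
    (\<forall>s t f. 0 \<le> s \<and> s \<le> t \<longrightarrow>
       normal_variable M (\<lambda>w. (W t w - W s w) \<bullet> f) 0 ((t - s) * (Q f \<bullet> f)))"

definition independent_processes ::
    "'a measure \<Rightarrow> (real \<Rightarrow> 'a \<Rightarrow> 'h::topological_space) \<Rightarrow> (real \<Rightarrow> 'a \<Rightarrow> 'h) \<Rightarrow> bool"
  where "independent_processes M W B \<longleftrightarrow>
    prob_space.indep_var M
      (\<Pi>\<^sub>M t\<in>{0..}. borel) (\<lambda>w. \<lambda>t\<in>{0..}. W t w)
      (\<Pi>\<^sub>M t\<in>{0..}. borel) (\<lambda>w. \<lambda>t\<in>{0..}. B t w)"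


section \<open>Stochastic integral with respect to a Wiener process\<close>

text \<open>
  An elementary integrand on \<open>[0,T]\<close> consists of a partition \<open>0 = \<tau> 0 \<le> \<dots> \<le> \<tau> n = T\<close> and
  \<open>L(H)\<close>-valued random variables \<open>\<phi> j\<close> with finitely many values, where \<open>\<phi> j\<close> is measurable
  with respect to \<open>F (\<tau> j)\<close>.
\<close>

definition elementary_integrand ::
    "(real \<Rightarrow> 'a measure) \<Rightarrow> real \<Rightarrow> nat \<Rightarrow> (nat \<Rightarrow> real) \<Rightarrow>
     (nat \<Rightarrow> 'a \<Rightarrow> 'h::real_normed_vector \<Rightarrow>\<^sub>L 'h) \<Rightarrow> bool"
  where "elementary_integrand F T n \<tau> \<phi> \<longleftrightarrow> \<tau> 0 = 0 \<and> \<tau> n = T \<and>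
    (\<forall>j<n. \<tau> j \<le> \<tau> (Suc j)) \<and> (\<forall>j<n. simple_function (F (\<tau> j)) (\<phi> j))"

definition elementary_process ::
    "nat \<Rightarrow> (nat \<Rightarrow> real) \<Rightarrow> (nat \<Rightarrow> 'a \<Rightarrow> 'h::real_normed_vector \<Rightarrow>\<^sub>L 'h) \<Rightarrow>
     real \<Rightarrow> 'a \<Rightarrow> 'h \<Rightarrow>\<^sub>L 'h"
  where "elementary_process n \<tau> \<phi> s w =
    (\<Sum>j<n. indicator {\<tau> j<..\<tau> (Suc j)} s *\<^sub>R \<phi> j w)"

definition elementary_integral ::
    "(real \<Rightarrow> 'a \<Rightarrow> 'h::real_normed_vector) \<Rightarrow> nat \<Rightarrow> (nat \<Rightarrow> real) \<Rightarrow>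
     (nat \<Rightarrow> 'a \<Rightarrow> 'h \<Rightarrow>\<^sub>L 'h) \<Rightarrow> 'a \<Rightarrow> 'h"
  where "elementary_integral W n \<tau> \<phi> w =
    (\<Sum>j<n. \<phi> j w (W (\<tau> (Suc j)) w - W (\<tau> j) w))"

text \<open>
  \<open>I\<close> is (a version of) the Ito integral of \<open>\<Phi>\<close> over \<open>[0,T]\<close>: the integrand is predictable, and
  \<open>I\<close> is the \<open>L\<^sup>2\<close> limit of the integrals of elementary processes that converge to \<open>\<Phi>\<close> in the
  norm \<open>(E \<integral>\<^sub>0\<^sup>T \<parallel>\<Phi>(s) Q\<^bsup>1/2\<^esup>\<parallel>\<^sup>2 ds)\<^bsup>1/2\<^esup>\<close> (Hilbert--Schmidt norm).  The integral is determined
  up to almost sure equality, whence a relation instead of a function.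
\<close>

definition has_stochastic_integral ::
    "'a measure \<Rightarrow> (real \<Rightarrow> 'a measure) \<Rightarrow> (real \<Rightarrow> 'a \<Rightarrow> 'h::real_inner) \<Rightarrow> ('h \<Rightarrow>\<^sub>L 'h) \<Rightarrow>
     real \<Rightarrow> (real \<Rightarrow> 'a \<Rightarrow> 'h \<Rightarrow>\<^sub>L 'h) \<Rightarrow> ('a \<Rightarrow> 'h) \<Rightarrow> bool"
  where "has_stochastic_integral M F W Q T \<Phi> I \<longleftrightarrow>
    (\<forall>x. (\<lambda>(s, w). \<Phi> s w x) \<in>
       borel_measurable (restrict_space (predictable_algebra M F) ({0..T} \<times> space M))) \<and>
    I \<in> borel_measurable M \<and>
    (\<exists>n \<tau> \<phi>. (\<forall>k. elementary_integrand F T (n k) (\<tau> k) (\<phi> k)) \<and>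
       (\<lambda>k. \<integral>\<^sup>+s\<in>{0..T}. (\<integral>\<^sup>+w.
           hs_norm_sq ((\<Phi> s w - elementary_process (n k) (\<tau> k) (\<phi> k) s w) o\<^sub>L op_sqrt Q) \<partial>M) \<partial>lborel)
         \<longlonglongrightarrow> 0 \<and>
       (\<lambda>k. \<integral>\<^sup>+w. ennreal ((norm (I w - elementary_integral W (n k) (\<tau> k) (\<phi> k) w))\<^sup>2) \<partial>M)
         \<longlonglongrightarrow> 0)"

text \<open>
  Mild solution of \<open>dX(t) = A X(t) dt + \<Phi>(t) dW(t)\<close>, \<open>X(0) = x0\<close>, where \<open>S\<close> is the semigroup
  generated by \<open>A\<close>: for every \<open>t\<close>, almost surely,
  \<open>X(t) = S(t) x0 + \<integral>\<^sub>0\<^sup>t S(t - s) \<Phi>(s) dW(s)\<close>.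
\<close>

definition mild_solution ::
    "'a measure \<Rightarrow> (real \<Rightarrow> 'a measure) \<Rightarrow> (real \<Rightarrow> 'a \<Rightarrow> 'h::real_inner) \<Rightarrow> ('h \<Rightarrow>\<^sub>L 'h) \<Rightarrow>
     (real \<Rightarrow> 'h \<Rightarrow>\<^sub>L 'h) \<Rightarrow> (real \<Rightarrow> 'a \<Rightarrow> 'h \<Rightarrow>\<^sub>L 'h) \<Rightarrow> 'h \<Rightarrow> (real \<Rightarrow> 'a \<Rightarrow> 'h) \<Rightarrow> bool"
  where "mild_solution M F W Q S \<Phi> x0 X \<longleftrightarrow> (\<forall>t\<ge>0. X t \<in> borel_measurable M \<and>
    (\<exists>I. has_stochastic_integral M F W Q t (\<lambda>s w. S (t - s) o\<^sub>L \<Phi> s w) I \<and>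
         (AE w in M. X t w = S t x0 + I w)))"


section \<open>Covariance operators\<close>

definition has_covariance_operator ::
    "'a measure \<Rightarrow> ('a \<Rightarrow> 'h::{real_inner, banach, second_countable_topology}) \<Rightarrow> ('h \<Rightarrow>\<^sub>L 'h) \<Rightarrow> bool"
  where "has_covariance_operator M X Q \<longleftrightarrow>
    X \<in> borel_measurable M \<and> integrable M (\<lambda>w. (norm (X w))\<^sup>2) \<and>
    (\<forall>f g. Q f \<bullet> g =
      (\<integral>w. ((X w - integral\<^sup>L M X) \<bullet> f) * ((X w - integral\<^sup>L M X) \<bullet> g) \<partial>M))"

definition covariance_operator ::
    "'a measure \<Rightarrow> ('a \<Rightarrow> 'h::{real_inner, banach, second_countable_topology}) \<Rightarrow> 'h \<Rightarrow>\<^sub>L 'h"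
  where "covariance_operator M X = (THE Q. has_covariance_operator M X Q)"

end

theory Submission
  imports Defs
begin

text \<open>
  Write \<open>R = Q\<^sub>B\<^bsup>1/2\<^esup>\<close>. By the Ito isometry, the second moment \<open>E[\<langle>I, f\<rangle> \<langle>I, g\<rangle>]\<close> of the stochastic
  integral \<open>I\<close> of \<open>\<Phi>(s) = S(t - s) \<Gamma>(s)\<close> is the integral over \<open>[0,t] \<times> \<Omega>\<close> of
  \<open>\<langle>R \<Phi>(s)\<^sup>* f, R \<Phi>(s)\<^sup>* g\<rangle>\<close>. Since \<open>\<Gamma>\<close> has rank one, \<open>R \<Phi>(s)\<^sup>* f = \<langle>S(t - s) Y(s), f\<rangle> R Z(s)\<close>, so the
  integrand is \<open>\<langle>G, f\<rangle> \<langle>G, g\<rangle>\<close> with \<open>G(s) = |R Z(s)| S(t - s) Y(s)\<close>. Summing over an orthonormal basis shows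
  that \<open>G\<close> is square integrable, hence its second moment operators
  \<open>E[G(s) \<otimes> G(s)] = S(t - s) E[|R Z(s)|\<^sup>2 V(s)] S(t - s)\<^sup>*\<close> are Bochner integrable in operator norm.
\<close>

subsection \<open>Adjoints and square roots\<close>

text \<open>Three obstacles shape the proof. First, L(H) is in general not separable in operator
  norm, so an operator-valued function is handled through its scalar pairings
  \<open>f w a \<bullet> b\<close>: these determine the operator, make its norm measurable and turn
  operator identities into real ones. Second, no hypothesis states that \<open>G\<close> is square
  integrable in time and chance; finiteness comes from the isometry read backwards, starting from
  E|I|^2 < \<infinity>. Third, joint measurability of S(t - s) Y(s) is extracted from the
  measurability clause of the stochastic integral, which speaks of the rank-one product with Z only;
  |Z| = 1 allows Z to be divided out. The isometry carries two test vectors because an identity for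
  E|I|^2 alone would give only the trace of the covariance. Adjoint, square root and integrals are
  fixed by \<open>SOME\<close> or \<open>THE\<close>, which is why existence (by Riesz and by a
  fixed point iteration) and uniqueness have to be settled.\<close>

lemma riesz_representation:
  fixes f :: "'h::{real_inner, banach} \<Rightarrow> real"
  assumes f: "bounded_linear f"
  shows "\<exists>y. \<forall>x. f x = y \<bullet> x"
proof -
  interpret f: bounded_linear f by (rule f)
  obtain K where K: "\<And>x. norm (f x) \<le> norm x * K" using f.bounded by blast
  \<comment> \<open>If f were the pairing with y, then J(x) would be |x - y|^2 - |y|^2. The Riesz
    vector is therefore sought as the minimizer of J.\<close>
  define J where "J x = x \<bullet> x - 2 * f x" for x
  have lb: "- K\<^sup>2 \<le> J x" for x
  proof -
    have "0 \<le> (norm x - K)\<^sup>2" by simp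
    also have "\<dots> = x \<bullet> x - 2 * (norm x * K) + K\<^sup>2"
      by (simp add: power2_diff power2_norm_eq_inner)
    finally show ?thesis using K[of x] by (simp add: J_def)
  qed
  define m where "m = Inf (range J)"
  have bdd: "bdd_below (range J)" by (rule bdd_belowI[of _ "- K\<^sup>2"]) (use lb in auto)
  have m_le: "m \<le> J x" for x unfolding m_def by (rule cInf_lower) (use bdd in auto)
  have "\<exists>x. J x < m + inverse (real (Suc n))" for n
    using cInf_less_iff[OF _ bdd, of "m + inverse (real (Suc n))"] by (auto simp: m_def)
  then obtain x where x: "\<And>n. J (x n) < m + inverse (real (Suc n))" by metis
  \<comment> \<open>Parallelogram law: the linear terms cancel at the midpoint. Two points that
    nearly minimize J are thus close to each other, which makes a minimizing sequence
    Cauchy.\<close>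
  have par: "(norm (a - b))\<^sup>2 = 2 * (J a + J b - 2 * J ((1/2) *\<^sub>R (a + b)))" for a b
    by (simp add: J_def power2_norm_eq_inner inner_add_left inner_add_right inner_diff_left
        inner_diff_right inner_commute f.scaleR f.add algebra_simps)
  have d: "(norm (x i - x j))\<^sup>2 \<le> 4 * inverse (real (Suc k))" if "i \<ge> k" "j \<ge> k" for i j k
  proof -
    define e where "e n = inverse (real (Suc n))" for n
    have "e i \<le> e k" "e j \<le> e k"
      using that by (auto simp: e_def intro!: le_imp_inverse_le)
    moreover have "J (x i) < m + e i" "J (x j) < m + e j" using x by (auto simp: e_def)
    moreover obtain z where "(norm (x i - x j))\<^sup>2 = 2 * (J (x i) + J (x j) - 2 * J z)"
      using par by blast
    ultimately have "(norm (x i - x j))\<^sup>2 \<le> 4 * e k" using m_le[of z] by argo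
    then show ?thesis by (simp add: e_def)
  qed
  have "Cauchy x"
  proof (rule metric_CauchyI)
    fix e :: real assume "e > 0"
    then have "0 < e\<^sup>2 / 4" by simp
    then obtain k where k: "inverse (real (Suc k)) < e\<^sup>2 / 4" using reals_Archimedean by blast
    have "dist (x i) (x j) < e" if "i \<ge> k" "j \<ge> k" for i j
    proof -
      have "(norm (x i - x j))\<^sup>2 < e\<^sup>2" using d[OF that] k by linarith
      then show ?thesis using \<open>e > 0\<close> by (auto simp: dist_norm intro: power_less_imp_less_base)
    qed
    then show "\<exists>M. \<forall>m\<ge>M. \<forall>n\<ge>M. dist (x m) (x n) < e" by blast
  qed
  then obtain y where y: "x \<longlonglongrightarrow> y" by (auto simp: Cauchy_convergent_iff convergent_def)
  have "(\<lambda>n. J (x n)) \<longlonglongrightarrow> J y"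
    unfolding J_def by (intro tendsto_intros y f.tendsto)
  moreover have "(\<lambda>n. m + inverse (real (Suc n))) \<longlonglongrightarrow> m + 0"
    by (intro tendsto_intros LIMSEQ_inverse_real_of_nat)
  ultimately have "J y \<le> m + 0"
    by (rule LIMSEQ_le) (intro exI[of _ 0] allI impI less_imp_le x)
  then have min: "J y \<le> J z" for z using m_le[of z] by simp
  have "f z = y \<bullet> z" for z
  proof (cases "z = 0")
    case False
    define c where "c = (y \<bullet> z - f z)"
    \<comment> \<open>The minimizer of r \<mapsto> J(y + r z), where J would drop by c^2 / <z, z>;
      minimality of y forces c = 0.\<close>
    define r where "r = - c / (z \<bullet> z)"
    have zz: "z \<bullet> z > 0" using False by simp
    have "0 \<le> J (y + r *\<^sub>R z) - J y" using min by simp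
    also have "\<dots> = r * r * (z \<bullet> z) + 2 * r * c"
      by (simp add: J_def c_def inner_add_left inner_add_right inner_commute f.scaleR f.add algebra_simps)
    also have "\<dots> = - (c * c) / (z \<bullet> z)" using zz by (simp add: r_def field_simps)
    finally have "c * c \<le> 0" using zz by (simp add: field_simps)
    then show ?thesis by (auto simp: c_def mult_le_0_iff)
  qed (simp add: f.zero)
  then show ?thesis by blast
qed

text \<open>\<open>adjoint\<close> is a choice and \<open>Blinfun\<close> is meaningful only on
  bounded linear maps. Riesz supplies a witness for the choice, testing against all vectors gives
  linearity, and writing |a'|^2 = <T a', a> for the adjoint image a' of a gives the bound.\<close>

lemma blinfun_adjoint_inner:
  fixes T :: "'h::{real_inner, banach} \<Rightarrow>\<^sub>L 'h"
  shows "blinfun_adjoint T x \<bullet> y = x \<bullet> T y"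
proof -
  have "\<exists>z. \<forall>y. x \<bullet> T y = z \<bullet> y" for x
    by (rule riesz_representation)
       (intro bounded_linear_compose[OF bounded_linear_inner_right blinfun.bounded_linear_right])
  then obtain g where "\<And>x y. x \<bullet> T y = g x \<bullet> y" by metis
  then have "\<forall>x y. T x \<bullet> y = x \<bullet> g y" by (metis inner_commute)
  then have *: "\<forall>x y. T x \<bullet> y = x \<bullet> adjoint T y" unfolding adjoint_def by (rule someI[of "\<lambda>f'. \<forall>x y. T x \<bullet> y = x \<bullet> f' y"])
  have "bounded_linear (adjoint T)"
  proof (rule bounded_linear_intro[where K = "norm T"])
    fix a b :: 'h and r :: real
    have "z \<bullet> adjoint T (a + b) = z \<bullet> (adjoint T a + adjoint T b)" for z
      using * by (simp add: inner_add_right flip: *)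
    then show "adjoint T (a + b) = adjoint T a + adjoint T b" by (metis vector_eq_rdot inner_commute)
    have "z \<bullet> adjoint T (r *\<^sub>R a) = z \<bullet> (r *\<^sub>R adjoint T a)" for z
      using * by (simp flip: *)
    then show "adjoint T (r *\<^sub>R a) = r *\<^sub>R adjoint T a" by (metis vector_eq_rdot inner_commute)
    have "norm (adjoint T a) * norm (adjoint T a) = adjoint T a \<bullet> adjoint T a"
      by (simp flip: power2_norm_eq_inner power2_eq_square)
    also have "\<dots> = T (adjoint T a) \<bullet> a" using * by simp
    also have "\<dots> \<le> norm (T (adjoint T a)) * norm a" by (rule norm_cauchy_schwarz)
    also have "\<dots> \<le> (norm T * norm (adjoint T a)) * norm a"
      by (intro mult_right_mono norm_blinfun norm_ge_zero)
    finally show "norm (adjoint T a) \<le> norm a * norm T"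
      by (cases "norm (adjoint T a) = 0") (auto simp: mult.assoc mult.commute mult.left_commute)
  qed
  then have "blinfun_adjoint T x = adjoint T x"
    by (simp add: blinfun_adjoint_def bounded_linear_Blinfun_apply)
  then show ?thesis using * by (metis inner_commute)
qed

text \<open>The quadratic polynomial r \<mapsto> <Q (x + r y), x + r y> is nonnegative, so its
  discriminant is not positive. In \<open>op_sqrt\<close> this turns a bound on a quadratic form
  into a bound on the operator norm.\<close>

lemma symmetric_positive_cauchy_schwarz:
  assumes "symmetric_op Q" "positive_op Q"
  shows "(Q x \<bullet> y)\<^sup>2 \<le> (Q x \<bullet> x) * (Q y \<bullet> y)"
proof -
  have q: "0 \<le> (Q x \<bullet> x) + 2 * r * (Q x \<bullet> y) + r\<^sup>2 * (Q y \<bullet> y)" for r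
  proof -
    have "0 \<le> Q (x + r *\<^sub>R y) \<bullet> (x + r *\<^sub>R y)" using assms by (auto simp: positive_op_def)
    moreover have "Q y \<bullet> x = Q x \<bullet> y" using assms by (metis symmetric_op_def inner_commute)
    ultimately show ?thesis
      by (simp add: blinfun.bilinear_simps inner_add_left inner_add_right power2_eq_square algebra_simps)
  qed
  have nn: "Q x \<bullet> x \<ge> 0" "Q y \<bullet> y \<ge> 0" using assms by (auto simp: positive_op_def)
  show ?thesis
  proof (cases "Q y \<bullet> y = 0")
    case True
    have "Q x \<bullet> y = 0"
    proof (rule ccontr)
      assume ne: "Q x \<bullet> y \<noteq> 0"
      \<comment> \<open>With vanishing leading coefficient the polynomial is affine, and at this r
        it takes the value -1.\<close>
      then show False using q[of "- (Q x \<bullet> x + 1) / (2 * (Q x \<bullet> y))"] True by (simp add: field_simps)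
    qed
    then show ?thesis using nn by simp
  next
    case False
    then have "Q y \<bullet> y > 0" using nn by simp
    then show ?thesis using q[of "- (Q x \<bullet> y) / (Q y \<bullet> y)"]
      by (simp add: power2_eq_square field_simps)
  qed
qed

text \<open>
  The iteration \<open>Y \<mapsto> (T + Y\<^sup>2) / 2\<close> is dominated by the scalar iteration \<open>c \<mapsto> (1 + c\<^sup>2) / 2\<close>,
  which increases to \<open>1\<close>; its fixed point satisfies \<open>(1 - Y)\<^sup>2 = 1 - T\<close>.
\<close>

lemma contraction_sqrt_iteration:
  fixes T :: "'h::{real_inner, banach} \<Rightarrow>\<^sub>L 'h"
  assumes T: "norm T \<le> 1" "symmetric_op T"
  shows "\<exists>Y. symmetric_op Y \<and> norm Y \<le> 1 \<and> T + (Y o\<^sub>L Y) = 2 *\<^sub>R Y"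
proof -
  define Y where "Y = rec_nat 0 (\<lambda>_ Z. (1/2) *\<^sub>R (T + (Z o\<^sub>L Z)))"
  define c where "c = rec_nat 0 (\<lambda>_ r. (1/2) * (1 + r * r :: real))"
  have Y0: "Y 0 = 0" and YS: "Y (Suc n) = (1/2) *\<^sub>R (T + (Y n o\<^sub>L Y n))" for n by (simp_all add: Y_def)
  have c0: "c 0 = 0" and cS: "c (Suc n) = (1/2) * (1 + c n * c n)" for n by (simp_all add: c_def)
  have c01: "0 \<le> c n \<and> c n \<le> 1" for n
    by (induction n) (auto simp: c0 cS mult_le_one)
  have Yc: "norm (Y n) \<le> c n" for n
  proof (induction n)
    case (Suc n)
    have "norm (Y (Suc n)) \<le> (1/2) * (norm T + norm (Y n o\<^sub>L Y n))"
      unfolding YS using norm_triangle_ineq[of T "Y n o\<^sub>L Y n"] by simp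
    also have "norm (Y n o\<^sub>L Y n) \<le> c n * c n"
      by (rule order_trans[OF norm_blinfun_compose]) (intro mult_mono Suc; use c01 in auto)
    finally show ?case using T(1) by (simp add: cS)
  qed (simp add: Y0 c0)
  have inc: "norm (Y (Suc n) - Y n) \<le> c (Suc n) - c n" for n
  proof (induction n)
    case 0
    show ?case using T(1) by (simp add: Y0 c0 YS cS)
  next
    case (Suc n)
    let ?D = "Y (Suc n) - Y n"
    \<comment> \<open>Noncommutative difference of squares, P^2 - N^2 = (P - N) P + N (P - N); in
      this form the iterates need not be shown to commute.\<close>
    have "Y (Suc (Suc n)) - Y (Suc n) = (1/2) *\<^sub>R ((?D o\<^sub>L Y (Suc n)) + (Y n o\<^sub>L ?D))"
      unfolding YS[of "Suc n"]
      by (subst (3) YS) (simp add: blinfun_eqI blinfun.bilinear_simps algebra_simps)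
    also have "norm \<dots> \<le> (1/2) * (norm (?D o\<^sub>L Y (Suc n)) + norm (Y n o\<^sub>L ?D))"
      by (simp add: norm_triangle_ineq)
    also have "\<dots> \<le> (1/2) * ((c (Suc n) - c n) * c (Suc n) + c n * (c (Suc n) - c n))"
      by (intro mult_left_mono add_mono order_trans[OF norm_blinfun_compose] mult_mono Suc Yc)
         (use c01 order_trans[OF norm_ge_zero Suc] in auto)
    also have "\<dots> = c (Suc (Suc n)) - c (Suc n)"
      unfolding cS[of "Suc n"] using cS[of n] by (simp only: algebra_simps)
    finally show ?case .
  qed
  have inc2: "norm (Y (n + k) - Y n) \<le> c (n + k) - c n" for n k
  proof (induction k)
    case (Suc k)
    have "norm (Y (n + Suc k) - Y n) \<le> norm (Y (Suc (n + k)) - Y (n + k)) + norm (Y (n + k) - Y n)"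
      using norm_triangle_ineq[of "Y (Suc (n + k)) - Y (n + k)" "Y (n + k) - Y n"] by simp
    then show ?case using inc[of "n + k"] Suc by simp
  qed simp
  \<comment> \<open>By \<open>inc\<close> the increments of c dominate norms, hence are nonnegative.
    Monotone and bounded, c is Cauchy, and \<open>inc2\<close> passes this on to Y.\<close>
  have "incseq c" using inc by (intro incseq_SucI) (meson diff_ge_0_iff_ge norm_ge_zero order_trans)
  then have "convergent c" using c01 by (metis Bseq_monoseq_convergent BseqI' incseq_imp_monoseq abs_of_nonneg real_norm_def)
  then have Cc: "Cauchy c" by (simp add: Cauchy_convergent_iff)
  have "Cauchy Y"
  proof (rule CauchyI')
    fix e :: real assume "e > 0"
    then obtain M where M: "\<forall>m\<ge>M. \<forall>n\<ge>M. dist (c m) (c n) < e" using Cc by (metis metric_CauchyD)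
    have "dist (Y m) (Y n) < e" if "m \<ge> M" "n > m" for m n
    proof -
      have "dist (Y m) (Y n) \<le> c n - c m"
        using inc2[of m "n - m"] that by (simp add: dist_norm norm_minus_commute)
      also have "\<dots> \<le> dist (c m) (c n)" by (simp add: dist_norm)
      also have "\<dots> < e" using M that by simp
      finally show ?thesis .
    qed
    then show "\<exists>M. \<forall>m\<ge>M. \<forall>n>m. dist (Y m) (Y n) < e" by blast
  qed
  then obtain L where L: "Y \<longlonglongrightarrow> L" by (auto simp: Cauchy_convergent_iff convergent_def)
  have "(\<lambda>n. (1/2) *\<^sub>R (T + (Y n o\<^sub>L Y n))) \<longlonglongrightarrow> (1/2) *\<^sub>R (T + (L o\<^sub>L L))"
    by (intro tendsto_intros bounded_bilinear.tendsto[OF bounded_bilinear_blinfun_compose] L)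
  moreover have "(\<lambda>n. Y (Suc n)) \<longlonglongrightarrow> L" using L by (rule LIMSEQ_Suc)
  ultimately have "(1/2) *\<^sub>R (T + (L o\<^sub>L L)) = L" unfolding YS by (rule LIMSEQ_unique)
  then have eq: "T + (L o\<^sub>L L) = 2 *\<^sub>R L"
  proof -
    assume "(1/2) *\<^sub>R (T + (L o\<^sub>L L)) = L"
    from arg_cong[OF this, of "\<lambda>Z. 2 *\<^sub>R Z"] show ?thesis by simp
  qed
  have "(\<lambda>n. norm (Y n)) \<longlonglongrightarrow> norm L" by (intro tendsto_intros L)
  then have nL: "norm L \<le> 1" by (rule LIMSEQ_le_const2) (use Yc c01 order_trans in blast)
  have sY: "Y n x \<bullet> y = x \<bullet> Y n y" for n x y
    by (induction n arbitrary: x y)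
       (use T(2) in \<open>auto simp: Y0 YS blinfun.bilinear_simps inner_add_left inner_add_right symmetric_op_def\<close>)
  have "L x \<bullet> y = x \<bullet> L y" for x y
  proof (rule LIMSEQ_unique)
    show "(\<lambda>n. Y n x \<bullet> y) \<longlonglongrightarrow> L x \<bullet> y" by (intro tendsto_intros L)
    show "(\<lambda>n. Y n x \<bullet> y) \<longlonglongrightarrow> x \<bullet> L y" unfolding sY by (intro tendsto_intros L)
  qed
  then show ?thesis using eq nL unfolding symmetric_op_def by blast
qed

text \<open>With c = |Q|, the operator T = 1 - Q / c lies between 0 and 1 and is a contraction, so
  the iteration applies. Its fixed point Y satisfies (1 - Y)^2 = 1 - T = Q / c, whence the root sqrt
  c (1 - Y); it is positive because |Y| \<le> 1.\<close>

lemma op_sqrt: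
  fixes Q :: "'h::{real_inner, banach} \<Rightarrow>\<^sub>L 'h"
  assumes Q: "symmetric_op Q" "positive_op Q"
  shows "symmetric_op (op_sqrt Q)" "op_sqrt Q o\<^sub>L op_sqrt Q = Q"
proof -
  have "\<exists>R. symmetric_op R \<and> positive_op R \<and> R o\<^sub>L R = Q"
  proof (cases "Q = 0")
    case True
    then show ?thesis by (intro exI[of _ 0]) (auto simp: symmetric_op_def positive_op_def blinfun_eqI)
  next
    case False
    define c where "c = norm Q"
    have c: "c > 0" using False by (simp add: c_def)
    define T where "T = id_blinfun - (1/c) *\<^sub>R Q"
    have Tx: "T x = x - (1/c) *\<^sub>R Q x" for x by (simp add: T_def blinfun.bilinear_simps)
    have sT: "symmetric_op T" using Q by (simp add: symmetric_op_def Tx inner_diff_left inner_diff_right)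
    have Qc: "Q x \<bullet> x \<le> c * (x \<bullet> x)" for x
    proof -
      have "Q x \<bullet> x \<le> norm (Q x) * norm x" by (rule norm_cauchy_schwarz)
      also have "\<dots> \<le> (c * norm x) * norm x" unfolding c_def by (intro mult_right_mono norm_blinfun) auto
      finally show ?thesis by (simp add: power2_norm_eq_inner mult.assoc flip: power2_eq_square)
    qed
    have T0: "T x \<bullet> x \<ge> 0" for x using Qc[of x] c by (simp add: Tx inner_diff_left field_simps)
    have T1: "T x \<bullet> x \<le> x \<bullet> x" for x using Q c by (simp add: Tx inner_diff_left positive_op_def)
    \<comment> \<open>Cauchy-Schwarz for the form of T, taken at x and T x, gives |T x|^4 \<le> <T
      x, x> <T T x, T x> \<le> |x|^2 |T x|^2. This bounds the norm without any spectral
      theory.\<close>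
    have "norm (T x) \<le> 1 * norm x" for x
    proof -
      have "((norm (T x))\<^sup>2)\<^sup>2 = (T x \<bullet> T x)\<^sup>2" by (simp add: power2_norm_eq_inner)
      also have "\<dots> \<le> (T x \<bullet> x) * (T (T x) \<bullet> T x)"
        by (rule symmetric_positive_cauchy_schwarz[OF sT]) (auto simp: positive_op_def T0)
      also have "\<dots> \<le> (x \<bullet> x) * (T x \<bullet> T x)" by (intro mult_mono T1 T0) auto
      finally have "(norm (T x))\<^sup>2 * (norm (T x))\<^sup>2 \<le> (norm x)\<^sup>2 * (norm (T x))\<^sup>2"
        by (simp add: dot_square_norm power2_eq_square)
      then have "T x = 0 \<or> (norm (T x))\<^sup>2 \<le> (norm x)\<^sup>2"
        using mult_right_le_imp_le[of "(norm (T x))\<^sup>2" "(norm (T x))\<^sup>2" "(norm x)\<^sup>2"]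
        by (cases "T x = 0") auto
      then show ?thesis by (auto dest: power2_le_imp_le)
    qed
    then have "norm T \<le> 1" by (intro norm_blinfun_bound) auto
    from contraction_sqrt_iteration[OF this sT] obtain Y where
      Y: "symmetric_op Y" "norm Y \<le> 1" "T + (Y o\<^sub>L Y) = 2 *\<^sub>R Y" by blast
    define R where "R = sqrt c *\<^sub>R (id_blinfun - Y)"
    have Rx: "R x = sqrt c *\<^sub>R (x - Y x)" for x by (simp add: R_def blinfun.bilinear_simps)
    have "symmetric_op R" using Y(1) by (simp add: symmetric_op_def Rx inner_diff_left inner_diff_right)
    moreover have "positive_op R"
    proof -
      have "Y x \<bullet> x \<le> x \<bullet> x" for x
      proof -
        have "Y x \<bullet> x \<le> norm (Y x) * norm x" by (rule norm_cauchy_schwarz)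
        also have "\<dots> \<le> (1 * norm x) * norm x"
          by (intro mult_right_mono order_trans[OF norm_blinfun] Y(2)) auto
        finally show ?thesis by (simp add: power2_norm_eq_inner flip: power2_eq_square)
      qed
      then show ?thesis using c by (simp add: positive_op_def Rx inner_diff_left)
    qed
    moreover have "R o\<^sub>L R = Q"
    proof (rule blinfun_eqI)
      fix x
      have "T x + Y (Y x) = 2 *\<^sub>R Y x" using arg_cong[OF Y(3), of "\<lambda>U. U x"]
        by (simp add: blinfun.bilinear_simps)
      then have "Y (Y x) = 2 *\<^sub>R Y x - T x" by (simp add: eq_diff_eq add.commute)
      then have "(x - Y x) - (Y x - Y (Y x)) = (1/c) *\<^sub>R Q x"
        by (simp add: Tx scaleR_2)
      then have "c *\<^sub>R ((x - Y x) - (Y x - Y (Y x))) = Q x" using c by simp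
      then show "(R o\<^sub>L R) x = Q x" using c
        by (simp add: Rx blinfun.bilinear_simps flip: scaleR_diff_right)
    qed
    ultimately show ?thesis by blast
  qed
  then have "symmetric_op (op_sqrt Q) \<and> positive_op (op_sqrt Q) \<and> op_sqrt Q o\<^sub>L op_sqrt Q = Q"
    unfolding op_sqrt_def by (rule someI_ex)
  then show "symmetric_op (op_sqrt Q)" "op_sqrt Q o\<^sub>L op_sqrt Q = Q" by auto
qed

subsection \<open>Orthonormal bases\<close>

text \<open>Distinct basis vectors are at distance sqrt 2, so assigning to each a point of a
  countable dense set within distance 1/2 is injective.\<close>

lemma orthonormal_basis_countable:
  fixes E :: "'h::{real_inner, second_countable_topology} set"
  assumes "orthonormal_basis E"
  shows "countable E"
proof -
  obtain D :: "'h set" where D: "countable D" "\<And>X. open X \<Longrightarrow> X \<noteq> {} \<Longrightarrow> \<exists>d\<in>D. d \<in> X"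
    by (erule countable_dense_setE)
  have "\<exists>d\<in>D. dist e d < 1/2" for e using D(2)[of "ball e (1/2)"] by auto
  then obtain d where d: "\<And>e. d e \<in> D" "\<And>e. dist e (d e) < 1/2" by metis
  have "inj_on d E"
  proof (rule inj_onI, rule ccontr)
    fix e e' assume e: "e \<in> E" "e' \<in> E" "d e = d e'" "e \<noteq> e'"
    then have "orthogonal e e'" "norm e = 1" "norm e' = 1"
      using assms by (auto simp: orthonormal_basis_def pairwise_def)
    then have "(dist e e')\<^sup>2 = 2"
      by (simp add: dist_norm power2_norm_eq_inner inner_diff_left inner_diff_right orthogonal_def
          inner_commute norm_eq_1)
    moreover have "dist e e' < 1"
      using dist_triangle_half_r[of "d e" e 1 e'] d(2)[of e] d(2)[of e'] e(3) by (simp add: dist_commute)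
    then have "(dist e e')\<^sup>2 \<le> 1" by (simp add: power_le_one)
    ultimately show False by simp
  qed
  moreover have "countable (d ` E)" using d(1) D(1) by (auto intro: countable_subset)
  ultimately show ?thesis by (rule countable_image_inj_on[rotated])
qed

text \<open>One identity for both halves of Parseval: c e = <x, e> yields Bessel's inequality, and
  general c shows that the Fourier sum is the best approximation from the span of F.\<close>

lemma orthonormal_norm_diff_sum:
  fixes x :: "'h::real_inner"
  assumes "orthonormal_basis E" "finite F" "F \<subseteq> E"
  shows "(norm (x - (\<Sum>e\<in>F. c e *\<^sub>R e)))\<^sup>2 =
    (norm x)\<^sup>2 - (\<Sum>e\<in>F. (x \<bullet> e)\<^sup>2) + (\<Sum>e\<in>F. (c e - x \<bullet> e)\<^sup>2)"
proof -
  have o: "e \<bullet> e' = (if e = e' then 1 else 0)" if "e \<in> F" "e' \<in> F" for e e'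
  proof -
    have "e \<in> E" "e' \<in> E" using assms that by auto
    then show ?thesis
      using assms(1) by (auto simp: orthonormal_basis_def pairwise_def orthogonal_def norm_eq_1)
  qed
  have "(\<Sum>e\<in>F. c e *\<^sub>R e) \<bullet> (\<Sum>e\<in>F. c e *\<^sub>R e) = (\<Sum>e\<in>F. \<Sum>e'\<in>F. c e * c e' * (if e = e' then 1 else 0))"
    unfolding inner_sum_left unfolding inner_sum_right
    by (rule sum.cong[OF refl], rule sum.cong[OF refl]) (simp add: o)
  also have "\<dots> = (\<Sum>e\<in>F. (c e)\<^sup>2)"
    using assms(2) by (intro sum.cong refl) (simp add: power2_eq_square mult_delta_right)
  finally have s: "(\<Sum>e\<in>F. c e *\<^sub>R e) \<bullet> (\<Sum>e\<in>F. c e *\<^sub>R e) = (\<Sum>e\<in>F. (c e)\<^sup>2)" .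
  have "(norm (x - (\<Sum>e\<in>F. c e *\<^sub>R e)))\<^sup>2 = x \<bullet> x - 2 * (\<Sum>e\<in>F. c e * (x \<bullet> e)) + (\<Sum>e\<in>F. (c e)\<^sup>2)"
    using inner_commute[of "\<Sum>e\<in>F. c e *\<^sub>R e" x]
    by (simp add: power2_norm_eq_inner inner_diff_left inner_diff_right s) (simp add: inner_sum_right)
  then show ?thesis
    by (simp add: power2_diff sum.distrib sum_subtractf sum_distrib_left power2_norm_eq_inner algebra_simps)
qed

text \<open>Bessel's inequality along finite sets exhausting E gives one bound; density of the span
  with best approximation gives the other. The sum is stated as an integral over
  \<open>count_space E\<close> so that it can later be exchanged with integrals over M by
  Tonelli.\<close>

lemma parseval:
  fixes x :: "'h::{real_inner, second_countable_topology}"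
  assumes E: "orthonormal_basis E"
  shows "(\<integral>\<^sup>+e. ennreal ((x \<bullet> e)\<^sup>2) \<partial>count_space E) = ennreal ((norm x)\<^sup>2)"
proof (rule antisym)
  have sum: "(\<integral>\<^sup>+e. ennreal ((x \<bullet> e)\<^sup>2) * indicator F e \<partial>count_space E) = ennreal (\<Sum>e\<in>F. (x \<bullet> e)\<^sup>2)"
    if "finite F" "F \<subseteq> E" for F
    using that by (subst nn_integral_count_space'[of F]) (auto simp: sum_ennreal)
  define F where "F n = {e\<in>E. to_nat_on E e \<le> n}" for n
  have F: "finite (F n)" "F n \<subseteq> E" for n
  proof -
    show "finite (F n)"
      by (rule inj_on_finite[of "to_nat_on E" _ "{..n}"])
         (use inj_on_to_nat_on[OF orthonormal_basis_countable[OF E]] in \<open>auto simp: F_def inj_on_def\<close>)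
  qed (auto simp: F_def)
  have "(\<integral>\<^sup>+e. ennreal ((x \<bullet> e)\<^sup>2) \<partial>count_space E) =
      (\<integral>\<^sup>+e. (SUP n. ennreal ((x \<bullet> e)\<^sup>2) * indicator (F n) e) \<partial>count_space E)"
  proof (rule nn_integral_cong)
    fix e assume e: "e \<in> space (count_space E)"
    show "ennreal ((x \<bullet> e)\<^sup>2) = (SUP n. ennreal ((x \<bullet> e)\<^sup>2) * indicator (F n) e)"
    proof (rule antisym)
      have "ennreal ((x \<bullet> e)\<^sup>2) = ennreal ((x \<bullet> e)\<^sup>2) * indicator (F (to_nat_on E e)) e"
        using e by (simp add: F_def)
      also have "\<dots> \<le> (SUP n. ennreal ((x \<bullet> e)\<^sup>2) * indicator (F n) e)" by (rule SUP_upper) simp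
      finally show "ennreal ((x \<bullet> e)\<^sup>2) \<le> (SUP n. ennreal ((x \<bullet> e)\<^sup>2) * indicator (F n) e)" .
    qed (auto intro!: SUP_least simp: indicator_def)
  qed
  also have "\<dots> = (SUP n. \<integral>\<^sup>+e. ennreal ((x \<bullet> e)\<^sup>2) * indicator (F n) e \<partial>count_space E)"
    by (rule nn_integral_monotone_convergence_SUP)
       (auto simp: incseq_def le_fun_def F_def indicator_def)
  also have "\<dots> \<le> ennreal ((norm x)\<^sup>2)"
  proof (rule SUP_least)
    fix n
    have "(\<Sum>e\<in>F n. (x \<bullet> e)\<^sup>2) \<le> (norm x)\<^sup>2"
      using orthonormal_norm_diff_sum[OF E F, of x "\<lambda>e. x \<bullet> e" n]
        zero_le_power2[of "norm (x - (\<Sum>e\<in>F n. (x \<bullet> e) *\<^sub>R e))"] by simp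
    then show "(\<integral>\<^sup>+e. ennreal ((x \<bullet> e)\<^sup>2) * indicator (F n) e \<partial>count_space E) \<le> ennreal ((norm x)\<^sup>2)"
      by (simp add: sum[OF F] ennreal_leI)
  qed
  finally show "(\<integral>\<^sup>+e. ennreal ((x \<bullet> e)\<^sup>2) \<partial>count_space E) \<le> ennreal ((norm x)\<^sup>2)" .
  show "ennreal ((norm x)\<^sup>2) \<le> (\<integral>\<^sup>+e. ennreal ((x \<bullet> e)\<^sup>2) \<partial>count_space E)"
  proof (rule ennreal_le_epsilon)
    fix d :: real assume "d > 0"
    have "x \<in> closure (span E)" using E by (simp add: orthonormal_basis_def)
    then obtain y where y: "y \<in> span E" "dist y x < sqrt d"
      using \<open>d > 0\<close> unfolding closure_approachable by (meson real_sqrt_gt_zero)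
    then obtain A c where A: "finite A" "A \<subseteq> E" "y = (\<Sum>a\<in>A. c a *\<^sub>R a)"
      unfolding span_explicit by blast
    have "(norm x)\<^sup>2 - (\<Sum>e\<in>A. (x \<bullet> e)\<^sup>2) \<le> (norm (x - y))\<^sup>2"
      unfolding A(3) orthonormal_norm_diff_sum[OF E A(1,2)] by (simp add: sum_nonneg)
    also have "\<dots> \<le> (sqrt d)\<^sup>2"
      using y(2) by (intro power_mono) (auto simp: dist_norm norm_minus_commute)
    finally have "(norm x)\<^sup>2 \<le> (\<Sum>e\<in>A. (x \<bullet> e)\<^sup>2) + d" using \<open>d > 0\<close> by simp
    then have "ennreal ((norm x)\<^sup>2) \<le> ennreal (\<Sum>e\<in>A. (x \<bullet> e)\<^sup>2) + ennreal d"
      using \<open>d > 0\<close> by (simp add: sum_nonneg flip: ennreal_plus)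
    also have "ennreal (\<Sum>e\<in>A. (x \<bullet> e)\<^sup>2) \<le> (\<integral>\<^sup>+e. ennreal ((x \<bullet> e)\<^sup>2) \<partial>count_space E)"
      unfolding sum[OF A(1,2), symmetric] by (intro nn_integral_mono) (auto simp: indicator_def)
    finally show "ennreal ((norm x)\<^sup>2) \<le> (\<integral>\<^sup>+e. ennreal ((x \<bullet> e)\<^sup>2) \<partial>count_space E) + ennreal d"
      by (simp add: add_mono)
  qed
qed

subsection \<open>Square integrable functions\<close>

definition square_integrable :: "'a measure \<Rightarrow> ('a \<Rightarrow> 'b::{real_inner, second_countable_topology}) \<Rightarrow> bool"
  where "square_integrable M f \<longleftrightarrow> f \<in> borel_measurable M \<and> integrable M (\<lambda>w. (norm (f w))\<^sup>2)"

lemma square_integrable_iff: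
  "square_integrable M f \<longleftrightarrow> f \<in> borel_measurable M \<and> (\<integral>\<^sup>+w. ennreal ((norm (f w))\<^sup>2) \<partial>M) < \<infinity>"
  by (auto simp: square_integrable_def integrable_iff_bounded)

lemma norm_add_power2_le: "(norm (x + y))\<^sup>2 \<le> 2 * (norm x)\<^sup>2 + 2 * (norm (y::'a::real_normed_vector))\<^sup>2"
proof -
  have "(norm (x + y))\<^sup>2 \<le> (norm x + norm y)\<^sup>2" by (intro power_mono norm_triangle_ineq) auto
  also have "\<dots> \<le> 2 * (norm x)\<^sup>2 + 2 * (norm y)\<^sup>2"
    using zero_le_power2[of "norm x - norm y"] by (simp add: power2_sum power2_diff)
  finally show ?thesis .
qed

lemma square_integrable_add:
  assumes "square_integrable M f" "square_integrable M g"
  shows "square_integrable M (\<lambda>w. f w + g w)"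
proof -
  have [measurable]: "f \<in> borel_measurable M" "g \<in> borel_measurable M"
    using assms by (auto simp: square_integrable_def)
  have "integrable M (\<lambda>w. (norm (f w + g w))\<^sup>2)"
    by (rule Bochner_Integration.integrable_bound[of _ "\<lambda>w. 2 * (norm (f w))\<^sup>2 + 2 * (norm (g w))\<^sup>2"])
       (use assms norm_add_power2_le in \<open>auto simp: square_integrable_def\<close>)
  then show ?thesis by (simp add: square_integrable_def)
qed

lemma square_integrable_minus:
  "square_integrable M f \<Longrightarrow> square_integrable M (\<lambda>w. - f w)"
  by (auto simp: square_integrable_def)

lemma square_integrable_diff:
  assumes "square_integrable M f" "square_integrable M g"
  shows "square_integrable M (\<lambda>w. f w - g w)"
  using square_integrable_add[OF assms(1) square_integrable_minus[OF assms(2)]] by simp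

lemma square_integrable_sum:
  assumes "\<And>i. i \<in> I \<Longrightarrow> square_integrable M (f i)"
  shows "square_integrable M (\<lambda>w. \<Sum>i\<in>I. f i w)"
proof (cases "finite I")
  case True
  then show ?thesis using assms
  proof (induction I rule: finite_induct)
    case (insert i I)
    then show ?case using square_integrable_add[of M "f i" "\<lambda>w. \<Sum>i\<in>I. f i w"] by simp
  qed (simp add: square_integrable_def)
qed (simp add: square_integrable_def)

lemma square_integrable_bound:
  assumes "square_integrable M f" and [measurable]: "g \<in> borel_measurable M"
    and "\<And>w. w \<in> space M \<Longrightarrow> norm (g w) \<le> C * norm (f w)"
  shows "square_integrable M g"
proof -
  have "integrable M (\<lambda>w. (norm (g w))\<^sup>2)"
  proof (rule Bochner_Integration.integrable_bound[of _ "\<lambda>w. C\<^sup>2 * (norm (f w))\<^sup>2"])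
    show "AE w in M. norm ((norm (g w))\<^sup>2) \<le> norm (C\<^sup>2 * (norm (f w))\<^sup>2)"
      using power_mono[OF assms(3), of _ 2] by (auto simp: power_mult_distrib)
  qed (use assms in \<open>auto simp: square_integrable_def\<close>)
  then show ?thesis by (simp add: square_integrable_def)
qed

lemma square_integrable_inner_const:
  assumes "square_integrable M f"
  shows "square_integrable M (\<lambda>w. f w \<bullet> c)"
  using assms
proof (rule square_integrable_bound[where C = "norm c"])
  show "norm (f w \<bullet> c) \<le> norm c * norm (f w)" for w
    using Cauchy_Schwarz_ineq2[of "f w" c] by (simp add: mult.commute)
qed (use assms in \<open>auto simp: square_integrable_def\<close>)

lemma square_integrable_blinfun:
  fixes T :: "'a::{real_inner, second_countable_topology} \<Rightarrow>\<^sub>L 'b::{real_inner, second_countable_topology}"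
  assumes "square_integrable M f"
  shows "square_integrable M (\<lambda>w. T (f w))"
proof -
  have [measurable]: "blinfun_apply T \<in> borel_measurable borel"
    by (intro borel_measurable_continuous_onI linear_continuous_on blinfun.bounded_linear_right)
  have [measurable]: "f \<in> borel_measurable M" using assms by (simp add: square_integrable_def)
  show ?thesis
    using assms by (rule square_integrable_bound[where C = "norm T"]) (auto simp: norm_blinfun)
qed

text \<open>A single k at distance less than 1 suffices: b is the sum of \<open>a k\<close> and a
  square integrable difference.\<close>

lemma square_integrable_limit:
  assumes a: "\<And>k. square_integrable M (a k)" and [measurable]: "b \<in> borel_measurable M"
    and lim: "(\<lambda>k. \<integral>\<^sup>+w. ennreal ((norm (b w - a k w))\<^sup>2) \<partial>M) \<longlonglongrightarrow> 0"
  shows "square_integrable M b"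
proof -
  from order_tendstoD(2)[OF lim, of 1] obtain k where
    "(\<integral>\<^sup>+w. ennreal ((norm (b w - a k w))\<^sup>2) \<partial>M) < 1" by (auto simp: eventually_sequentially)
  moreover have [measurable]: "a k \<in> borel_measurable M" using a by (auto simp: square_integrable_def)
  ultimately have "square_integrable M (\<lambda>w. b w - a k w)"
    by (auto simp: square_integrable_iff intro: less_trans)
  from square_integrable_add[OF this a[of k]] show ?thesis by simp
qed

lemma integrable_inner:
  assumes "square_integrable M f" "square_integrable M g"
  shows "integrable M (\<lambda>w. f w \<bullet> g w)"
proof (rule Bochner_Integration.integrable_bound[of _ "\<lambda>w. (norm (f w))\<^sup>2 + (norm (g w))\<^sup>2"])
  show "AE w in M. norm (f w \<bullet> g w) \<le> norm ((norm (f w))\<^sup>2 + (norm (g w))\<^sup>2)"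
  proof (intro AE_I2)
    fix w
    have "\<bar>f w \<bullet> g w\<bar> \<le> norm (f w) * norm (g w)" by (rule Cauchy_Schwarz_ineq2)
    also have "\<dots> \<le> (norm (f w))\<^sup>2 + (norm (g w))\<^sup>2"
      using sum_squares_bound[of "norm (f w)" "norm (g w)"]
        mult_nonneg_nonneg[OF norm_ge_zero norm_ge_zero, of "f w" "g w"] by linarith
    finally show "norm (f w \<bullet> g w) \<le> norm ((norm (f w))\<^sup>2 + (norm (g w))\<^sup>2)" by simp
  qed
qed (use assms in \<open>auto simp: square_integrable_def\<close>)

text \<open>With u and v the errors of the approximations, the difference of the inner products is
  <u, v> - <u, b> - <a, v>. The mixed terms are split by the weighted inequality x y \<le> x^2 / e +
  e y^2, the small weight e falling on the fixed functions a and b. The error terms then vanish in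
  the limit and the rest is uniformly small.\<close>

lemma L2_tendsto_inner:
  fixes a b :: "'a \<Rightarrow> 'h::{real_inner, second_countable_topology}"
  assumes ak: "\<And>k. square_integrable M (a\<^sub>k k)" and bk: "\<And>k. square_integrable M (b\<^sub>k k)"
    and a: "square_integrable M a" and b: "square_integrable M b"
    and la: "(\<lambda>k. \<integral>\<^sup>+w. ennreal ((norm (a w - a\<^sub>k k w))\<^sup>2) \<partial>M) \<longlonglongrightarrow> 0"
    and lb: "(\<lambda>k. \<integral>\<^sup>+w. ennreal ((norm (b w - b\<^sub>k k w))\<^sup>2) \<partial>M) \<longlonglongrightarrow> 0"
  shows "(\<lambda>k. \<integral>w. a\<^sub>k k w \<bullet> b\<^sub>k k w \<partial>M) \<longlonglongrightarrow> (\<integral>w. a w \<bullet> b w \<partial>M)"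
proof -
  define N where "N f = (\<integral>w. (norm (f w))\<^sup>2 \<partial>M)" for f :: "'a \<Rightarrow> 'h"
  have lim: "(\<lambda>k. N (\<lambda>w. c w - ck k w)) \<longlonglongrightarrow> 0"
    if "\<And>k. square_integrable M (ck k)" "square_integrable M c"
      "(\<lambda>k. \<integral>\<^sup>+w. ennreal ((norm (c w - ck k w))\<^sup>2) \<partial>M) \<longlonglongrightarrow> 0" for c :: "'a \<Rightarrow> 'h" and ck
  proof -
    have "(\<lambda>k. ennreal (N (\<lambda>w. c w - ck k w))) \<longlonglongrightarrow> ennreal 0"
      using that(3) square_integrable_diff[OF that(2) that(1)]
      by (simp add: N_def nn_integral_eq_integral square_integrable_def)
    then show ?thesis by (subst (asm) tendsto_ennreal_iff) (auto simp: N_def)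
  qed
  have diff: "\<bar>(\<integral>w. a\<^sub>k k w \<bullet> b\<^sub>k k w \<partial>M) - (\<integral>w. a w \<bullet> b w \<partial>M)\<bar> \<le>
      (1 + 1 / e) * (N (\<lambda>w. a w - a\<^sub>k k w) + N (\<lambda>w. b w - b\<^sub>k k w)) + e * (N a + N b)"
    if e: "e > 0" for e k
  proof -
    define u where "u = (\<lambda>w. a w - a\<^sub>k k w)"
    define v where "v = (\<lambda>w. b w - b\<^sub>k k w)"
    have u: "square_integrable M u" and v: "square_integrable M v"
      unfolding u_def v_def using ak bk a b by (auto intro: square_integrable_diff)
    have "\<bar>(\<integral>w. a\<^sub>k k w \<bullet> b\<^sub>k k w \<partial>M) - (\<integral>w. a w \<bullet> b w \<partial>M)\<bar> = \<bar>\<integral>w. a\<^sub>k k w \<bullet> b\<^sub>k k w - a w \<bullet> b w \<partial>M\<bar>"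
      using ak bk a b by (subst Bochner_Integration.integral_diff) (auto intro: integrable_inner)
    also have "\<dots> \<le> (\<integral>w. \<bar>a\<^sub>k k w \<bullet> b\<^sub>k k w - a w \<bullet> b w\<bar> \<partial>M)" by (rule integral_abs_bound)
    also have "\<dots> \<le> (\<integral>w. (1 + 1/e) * ((norm (u w))\<^sup>2 + (norm (v w))\<^sup>2) +
        e * ((norm (a w))\<^sup>2 + (norm (b w))\<^sup>2) \<partial>M)"
    proof (rule integral_mono)
      fix w
      have am: "x * y \<le> (1/e) * x\<^sup>2 + e * y\<^sup>2" if "x \<ge> 0" "y \<ge> 0" for x y :: real
      proof -
        have "0 \<le> (x - e * y)\<^sup>2" by simp
        then have "2 * e * (x * y) \<le> x\<^sup>2 + e\<^sup>2 * y\<^sup>2" by (simp add: power2_diff power_mult_distrib algebra_simps)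
        then have "2 * (x * y) \<le> (1/e) * x\<^sup>2 + e * y\<^sup>2" using e by (simp add: field_simps power2_eq_square)
        moreover have "x * y \<ge> 0" using that by simp
        ultimately show ?thesis by linarith
      qed
      have am1: "x * y \<le> x\<^sup>2 + y\<^sup>2" if "x \<ge> 0" "y \<ge> 0" for x y :: real
        using sum_squares_bound[of x y] mult_nonneg_nonneg[OF that] by linarith
      have "a\<^sub>k k w \<bullet> b\<^sub>k k w - a w \<bullet> b w = u w \<bullet> v w - u w \<bullet> b w - a w \<bullet> v w"
        by (simp add: u_def v_def inner_diff_left inner_diff_right)
      then have "\<bar>a\<^sub>k k w \<bullet> b\<^sub>k k w - a w \<bullet> b w\<bar> \<le> \<bar>u w \<bullet> v w\<bar> + \<bar>u w \<bullet> b w\<bar> + \<bar>a w \<bullet> v w\<bar>" by linarith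
      also have "\<dots> \<le> norm (u w) * norm (v w) + norm (u w) * norm (b w) + norm (v w) * norm (a w)"
        by (intro add_mono Cauchy_Schwarz_ineq2) (simp add: Cauchy_Schwarz_ineq2 mult.commute)
      also have "\<dots> \<le> ((norm (u w))\<^sup>2 + (norm (v w))\<^sup>2) + ((1/e) * (norm (u w))\<^sup>2 + e * (norm (b w))\<^sup>2)
          + ((1/e) * (norm (v w))\<^sup>2 + e * (norm (a w))\<^sup>2)"
        by (intro add_mono am am1) auto
      finally show "\<bar>a\<^sub>k k w \<bullet> b\<^sub>k k w - a w \<bullet> b w\<bar> \<le> (1 + 1/e) * ((norm (u w))\<^sup>2 + (norm (v w))\<^sup>2) +
          e * ((norm (a w))\<^sup>2 + (norm (b w))\<^sup>2)" by (simp add: algebra_simps)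
    next
      show "integrable M (\<lambda>w. \<bar>a\<^sub>k k w \<bullet> b\<^sub>k k w - a w \<bullet> b w\<bar>)"
        using integrable_inner[OF ak bk] integrable_inner[OF a b]
        by (intro integrable_abs Bochner_Integration.integrable_diff)
    next
      show "integrable M (\<lambda>w. (1 + 1/e) * ((norm (u w))\<^sup>2 + (norm (v w))\<^sup>2) +
        e * ((norm (a w))\<^sup>2 + (norm (b w))\<^sup>2))"
        using a b u v unfolding square_integrable_def
        by (intro Bochner_Integration.integrable_add integrable_mult_right) auto
    qed
    also have "\<dots> = (1 + 1 / e) * (N u + N v) + e * (N a + N b)"
      using a b u v by (simp add: N_def square_integrable_def)
    finally show ?thesis by (simp add: u_def v_def)
  qed
  have N0: "N f \<ge> 0" for f by (simp add: N_def)
  show ?thesis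
  proof (rule tendstoI)
    fix d :: real assume d: "d > 0"
    \<comment> \<open>Chosen so that e times the fixed part stays below d / 2; the added 1 keeps the
      denominator positive when a and b vanish almost everywhere.\<close>
    define e where "e = d / (2 * (N a + N b + 1))"
    have e: "e > 0" using d N0[of a] N0[of b] by (simp add: e_def)
    have "d / (2 * x) * x = d / 2" if "x > 0" for x using that by simp
    then have "e * (N a + N b + 1) = d / 2" unfolding e_def using N0[of a] N0[of b] by (smt (verit))
    then have half: "e * (N a + N b) < d / 2" using e by (simp add: algebra_simps)
    have "(\<lambda>k. (1 + 1 / e) * (N (\<lambda>w. a w - a\<^sub>k k w) + N (\<lambda>w. b w - b\<^sub>k k w))) \<longlonglongrightarrow> (1 + 1 / e) * (0 + 0)"
      by (intro tendsto_intros lim ak bk a b la lb)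
    then have "eventually (\<lambda>k. (1 + 1 / e) * (N (\<lambda>w. a w - a\<^sub>k k w) + N (\<lambda>w. b w - b\<^sub>k k w)) < d / 2) sequentially"
      by (rule order_tendstoD) (use d in simp)
    then show "eventually (\<lambda>k. dist (\<integral>w. a\<^sub>k k w \<bullet> b\<^sub>k k w \<partial>M) (\<integral>w. a w \<bullet> b w \<partial>M) < d) sequentially"
    proof eventually_elim
      case (elim k)
      then show ?case using diff[OF e, of k] half unfolding dist_real_def by argo
    qed
  qed
qed

subsection \<open>Bochner integrals of operator-valued functions\<close>

lemma norm_blinfun_le_inner:
  fixes T :: "'a::real_normed_vector \<Rightarrow>\<^sub>L 'b::real_inner"
  assumes "\<And>a b. \<bar>T a \<bullet> b\<bar> \<le> c * norm a * norm b" "0 \<le> c"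
  shows "norm T \<le> c"
proof (rule norm_blinfun_bound[OF assms(2)])
  fix a
  have "norm (T a) * norm (T a) \<le> (c * norm a) * norm (T a)"
    using assms(1)[of a "T a"] by (simp add: dot_square_norm power2_eq_square)
  then show "norm (T a) \<le> c * norm a"
    using assms(2) by (cases "T a = 0") auto
qed

lemma abs_inner_blinfun_le:
  fixes T :: "'a::real_normed_vector \<Rightarrow>\<^sub>L 'b::real_inner"
  shows "\<bar>T a \<bullet> b\<bar> \<le> norm T * norm a * norm b"
  by (rule order_trans[OF Cauchy_Schwarz_ineq2]) (intro mult_right_mono norm_blinfun norm_ge_zero)

text \<open>Although the operator space may be nonseparable, its norm is controlled by countably
  many pairings: the bound |<T a, b>| \<le> c |a| |b| extends by continuity from dense sets, first
  in b and then in a. Weak measurability of f therefore makes the norm measurable.\<close>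

lemma borel_measurable_norm_blinfun:
  fixes f :: "'a \<Rightarrow> 'b::{real_normed_vector, second_countable_topology} \<Rightarrow>\<^sub>L 'c::{real_inner, second_countable_topology}"
  assumes [measurable]: "\<And>a b. (\<lambda>w. f w a \<bullet> b) \<in> borel_measurable M"
  shows "(\<lambda>w. norm (f w)) \<in> borel_measurable M"
  unfolding borel_measurable_iff_le
proof
  fix c :: real
  obtain D :: "'b set" where D: "countable D" "\<And>X. open X \<Longrightarrow> X \<noteq> {} \<Longrightarrow> \<exists>d\<in>D. d \<in> X"
    by (erule countable_dense_setE)
  obtain E :: "'c set" where E: "countable E" "\<And>X. open X \<Longrightarrow> X \<noteq> {} \<Longrightarrow> \<exists>d\<in>E. d \<in> X"
    by (erule countable_dense_setE)
  have clD: "closure D = UNIV" and clE: "closure E = UNIV"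
    using D(2) E(2) by (auto simp: closure_iff_nhds_not_empty) blast+
  have *: "norm T \<le> c \<longleftrightarrow> (\<forall>a\<in>D. \<forall>b\<in>E. \<bar>T a \<bullet> b\<bar> \<le> c * norm a * norm b)"
    if c: "c \<ge> 0" for T :: "'b \<Rightarrow>\<^sub>L 'c"
  proof safe
    fix a b assume "norm T \<le> c"
    then show "\<bar>T a \<bullet> b\<bar> \<le> c * norm a * norm b"
      by (intro order_trans[OF abs_inner_blinfun_le] mult_right_mono) auto
  next
    assume A: "\<forall>a\<in>D. \<forall>b\<in>E. \<bar>T a \<bullet> b\<bar> \<le> c * norm a * norm b"
    have 1: "\<bar>T a \<bullet> b\<bar> \<le> c * norm a * norm b" if "a \<in> D" for a b
    proof -
      have "closed {b. \<bar>T a \<bullet> b\<bar> \<le> c * norm a * norm b}"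
        by (intro closed_Collect_le continuous_intros)
      from closure_minimal[OF _ this, of E] A that clE show ?thesis by auto
    qed
    have "\<bar>T a \<bullet> b\<bar> \<le> c * norm a * norm b" for a b
    proof -
      have "closed {a. \<bar>T a \<bullet> b\<bar> \<le> c * norm a * norm b}"
        by (intro closed_Collect_le continuous_intros)
      from closure_minimal[OF _ this, of D] 1 clD show ?thesis by auto
    qed
    then show "norm T \<le> c" using c by (rule norm_blinfun_le_inner)
  qed
  show "{w \<in> space M. norm (f w) \<le> c} \<in> sets M"
  proof (cases "c \<ge> 0")
    case True
    have [measurable]: "countable D" "countable E" by fact+
    show ?thesis unfolding *[OF True] by measurable
  next
    case False
    then have "{w \<in> space M. norm (f w) \<le> c} = {}"
      by (auto simp: not_le intro: less_le_trans)
    then show ?thesis by (simp only: sets.empty_sets)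
  qed
qed

lemma simple_bochner_integrable_inner:
  fixes s :: "'a \<Rightarrow> 'b::real_normed_vector \<Rightarrow>\<^sub>L 'c::{real_inner, second_countable_topology}"
  assumes "Bochner_Integration.simple_bochner_integrable M s"
  shows "Bochner_Integration.simple_bochner_integrable M (\<lambda>w. s w a \<bullet> b)"
    and "Bochner_Integration.simple_bochner_integral M (\<lambda>w. s w a \<bullet> b) =
      Bochner_Integration.simple_bochner_integral M s a \<bullet> b"
    and "(\<lambda>w. s w a \<bullet> b) \<in> borel_measurable M"
proof -
  show 1: "Bochner_Integration.simple_bochner_integrable M (\<lambda>w. s w a \<bullet> b)"
    using simple_bochner_integrable_compose2[where p = "\<lambda>x y. blinfun_apply x a \<bullet> b", OF _ assms assms] by simp
  show "Bochner_Integration.simple_bochner_integral M (\<lambda>w. s w a \<bullet> b) =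
      Bochner_Integration.simple_bochner_integral M s a \<bullet> b"
    by (rule simple_bochner_integral_linear[where f = "\<lambda>T. blinfun_apply T a \<bullet> b", OF _ assms])
       (auto intro!: linearI simp: blinfun.bilinear_simps inner_add_left)
  show "(\<lambda>w. s w a \<bullet> b) \<in> borel_measurable M"
    using 1 by (auto elim!: Bochner_Integration.simple_bochner_integrable.cases
        intro: borel_measurable_simple_function)
qed

text \<open>Pairing with a and b is a bounded linear functional of norm at most |a| |b|, so it
  carries the simple approximations of f to simple real approximations. This ties
  \<open>has_Bochner\<close> to the real Bochner integral.\<close>

lemma has_Bochner_inner:
  fixes f :: "'a \<Rightarrow> 'b::real_normed_vector \<Rightarrow>\<^sub>L 'c::{real_inner, second_countable_topology}"
  assumes f: "\<And>a b. (\<lambda>w. f w a \<bullet> b) \<in> borel_measurable M"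
    and T: "has_Bochner M f T"
  shows "has_bochner_integral M (\<lambda>w. f w a \<bullet> b) (T a \<bullet> b)"
proof -
  from T obtain s where s: "\<And>i. Bochner_Integration.simple_bochner_integrable M (s i)"
    and m[measurable]: "\<And>i. (\<lambda>w. norm (f w - s i w)) \<in> borel_measurable M"
    and l1: "(\<lambda>i. \<integral>\<^sup>+w. ennreal (norm (f w - s i w)) \<partial>M) \<longlonglongrightarrow> 0"
    and l2: "(\<lambda>i. Bochner_Integration.simple_bochner_integral M (s i)) \<longlonglongrightarrow> T"
    unfolding has_Bochner_def by blast
  show ?thesis
  proof (rule has_bochner_integral.intros[where s = "\<lambda>i w. s i w a \<bullet> b"])
    show "(\<lambda>w. f w a \<bullet> b) \<in> borel_measurable M" by (rule f)
    show "Bochner_Integration.simple_bochner_integrable M (\<lambda>w. s i w a \<bullet> b)" for i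
      using s by (rule simple_bochner_integrable_inner)
    show "(\<lambda>i. Bochner_Integration.simple_bochner_integral M (\<lambda>w. s i w a \<bullet> b)) \<longlonglongrightarrow> T a \<bullet> b"
      unfolding simple_bochner_integrable_inner(2)[OF s] by (intro tendsto_intros l2)
    show "(\<lambda>i. \<integral>\<^sup>+w. ennreal (norm (f w a \<bullet> b - s i w a \<bullet> b)) \<partial>M) \<longlonglongrightarrow> 0"
    proof (rule tendsto_sandwich[OF _ _ tendsto_const])
      have "(\<integral>\<^sup>+w. ennreal (norm (f w a \<bullet> b - s i w a \<bullet> b)) \<partial>M) \<le>
          ennreal (norm a * norm b) * (\<integral>\<^sup>+w. ennreal (norm (f w - s i w)) \<partial>M)" for i
      proof (subst nn_integral_cmult[symmetric])
        show "(\<integral>\<^sup>+w. ennreal (norm (f w a \<bullet> b - s i w a \<bullet> b)) \<partial>M) \<le>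
            (\<integral>\<^sup>+w. ennreal (norm a * norm b) * ennreal (norm (f w - s i w)) \<partial>M)"
        proof (intro nn_integral_mono)
          fix w
          show "ennreal (norm (f w a \<bullet> b - s i w a \<bullet> b)) \<le> ennreal (norm a * norm b) * ennreal (norm (f w - s i w))"
            using abs_inner_blinfun_le[of "f w - s i w" a b]
            by (auto simp: blinfun.bilinear_simps inner_diff_left mult_ac intro!: ennreal_leI simp flip: ennreal_mult)
        qed
      qed measurable
      then show "eventually (\<lambda>i. (\<integral>\<^sup>+w. ennreal (norm (f w a \<bullet> b - s i w a \<bullet> b)) \<partial>M) \<le>
          ennreal (norm a * norm b) * (\<integral>\<^sup>+w. ennreal (norm (f w - s i w)) \<partial>M)) sequentially" by simp
      have "(\<lambda>i. ennreal (norm a * norm b) * (\<integral>\<^sup>+w. ennreal (norm (f w - s i w)) \<partial>M)) \<longlonglongrightarrow> ennreal (norm a * norm b) * 0"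
        by (intro ennreal_tendsto_cmult l1) simp
      then show "(\<lambda>i. ennreal (norm a * norm b) * (\<integral>\<^sup>+w. ennreal (norm (f w - s i w)) \<partial>M)) \<longlonglongrightarrow> 0" by simp
    qed simp
  qed
qed

text \<open>Pairings separate operators and real integrals are unique, so \<open>has_Bochner\<close>
  has at most one value here; this is what gives the \<open>THE\<close> in
  \<open>Bochner_integral\<close> its meaning.\<close>

lemma Bochner_integral_inner:
  fixes f :: "'a \<Rightarrow> 'b::real_normed_vector \<Rightarrow>\<^sub>L 'c::{real_inner, second_countable_topology}"
  assumes f: "\<And>a b. (\<lambda>w. f w a \<bullet> b) \<in> borel_measurable M" and int: "Bochner_integrable M f"
  shows "Bochner_integral M f a \<bullet> b = (\<integral>w. f w a \<bullet> b \<partial>M)"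
proof -
  from int obtain T where T: "has_Bochner M f T" by (auto simp: Bochner_integrable_def)
  have "T' = T" if "has_Bochner M f T'" for T'
  proof (rule blinfun_eqI)
    fix x
    have "T' x \<bullet> y = T x \<bullet> y" for y
      using has_bochner_integral_eq[OF has_Bochner_inner[OF f that] has_Bochner_inner[OF f T]] .
    then show "T' x = T x" by (metis vector_eq_rdot)
  qed
  with T have "Bochner_integral M f = T" unfolding Bochner_integral_def by (rule the_equality)
  then show ?thesis using has_bochner_integral_integral_eq[OF has_Bochner_inner[OF f T]] by simp
qed

text \<open>The closure of simple functions in L^1, with no mention of a value of the integral. This
  makes it stable under sums and L^1 limits; the value is produced once, by completeness, in
  \<open>L1_approximable_Bochner_integrable\<close>.\<close>

definition L1_approximable ::
    "'a measure \<Rightarrow> ('a \<Rightarrow> 'b::real_normed_vector \<Rightarrow>\<^sub>L 'c::real_inner) \<Rightarrow> bool"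
  where "L1_approximable M f \<longleftrightarrow> (\<forall>a b. (\<lambda>w. f w a \<bullet> b) \<in> borel_measurable M) \<and>
    (\<forall>e>0. \<exists>s. Bochner_Integration.simple_bochner_integrable M s \<and>
      (\<integral>\<^sup>+w. ennreal (norm (f w - s w)) \<partial>M) < ennreal e)"

lemma nn_integral_norm_triangle:
  fixes f g h :: "'a \<Rightarrow> 'b::{real_normed_vector, second_countable_topology} \<Rightarrow>\<^sub>L 'c::{real_inner, second_countable_topology}"
  assumes [measurable]: "\<And>a b. (\<lambda>w. f w a \<bullet> b) \<in> borel_measurable M"
    "\<And>a b. (\<lambda>w. g w a \<bullet> b) \<in> borel_measurable M" "\<And>a b. (\<lambda>w. h w a \<bullet> b) \<in> borel_measurable M"
  shows "(\<integral>\<^sup>+w. ennreal (norm (f w - h w)) \<partial>M) \<le>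
    (\<integral>\<^sup>+w. ennreal (norm (f w - g w)) \<partial>M) + (\<integral>\<^sup>+w. ennreal (norm (g w - h w)) \<partial>M)"
proof -
  have [measurable]: "(\<lambda>w. norm (f w - g w)) \<in> borel_measurable M" "(\<lambda>w. norm (g w - h w)) \<in> borel_measurable M"
    by (intro borel_measurable_norm_blinfun; simp add: blinfun.bilinear_simps inner_diff_left)+
  have "(\<integral>\<^sup>+w. ennreal (norm (f w - h w)) \<partial>M) \<le>
      (\<integral>\<^sup>+w. ennreal (norm (f w - g w)) + ennreal (norm (g w - h w)) \<partial>M)"
  proof (intro nn_integral_mono)
    fix w
    show "ennreal (norm (f w - h w)) \<le> ennreal (norm (f w - g w)) + ennreal (norm (g w - h w))"
      using norm_triangle_ineq[of "f w - g w" "g w - h w"] by (simp flip: ennreal_plus)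
  qed
  also have "\<dots> = (\<integral>\<^sup>+w. ennreal (norm (f w - g w)) \<partial>M) + (\<integral>\<^sup>+w. ennreal (norm (g w - h w)) \<partial>M)"
    by (rule nn_integral_add) measurable
  finally show ?thesis .
qed

lemma L1_approximable_limit:
  fixes f :: "'a \<Rightarrow> 'b::{real_normed_vector, second_countable_topology} \<Rightarrow>\<^sub>L 'c::{real_inner, second_countable_topology}"
  assumes f: "\<And>a b. (\<lambda>w. f w a \<bullet> b) \<in> borel_measurable M"
    and lim: "\<And>e. e > 0 \<Longrightarrow> \<exists>g. L1_approximable M g \<and> (\<integral>\<^sup>+w. ennreal (norm (f w - g w)) \<partial>M) < ennreal e"
  shows "L1_approximable M f"
  unfolding L1_approximable_def
proof (intro conjI allI impI f)
  fix e :: real assume "e > 0"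
  then have e: "e / 2 > 0" by simp
  obtain g where g: "L1_approximable M g" "(\<integral>\<^sup>+w. ennreal (norm (f w - g w)) \<partial>M) < ennreal (e / 2)"
    using lim[OF e] by blast
  obtain s where s: "Bochner_Integration.simple_bochner_integrable M s"
    "(\<integral>\<^sup>+w. ennreal (norm (g w - s w)) \<partial>M) < ennreal (e / 2)"
    using g(1) e unfolding L1_approximable_def by blast
  have "(\<integral>\<^sup>+w. ennreal (norm (f w - s w)) \<partial>M) \<le>
      (\<integral>\<^sup>+w. ennreal (norm (f w - g w)) \<partial>M) + (\<integral>\<^sup>+w. ennreal (norm (g w - s w)) \<partial>M)"
    using g(1) by (intro nn_integral_norm_triangle f simple_bochner_integrable_inner(3)[OF s(1)])
      (auto simp: L1_approximable_def)
  also have "\<dots> < ennreal (e / 2) + ennreal (e / 2)" using g(2) s(2) by (rule add_strict_mono)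
  also have "\<dots> = ennreal e" using \<open>e > 0\<close> by (simp flip: ennreal_plus)
  finally show "\<exists>s. Bochner_Integration.simple_bochner_integrable M s \<and>
      (\<integral>\<^sup>+w. ennreal (norm (f w - s w)) \<partial>M) < ennreal e" using s(1) by blast
qed

lemma L1_approximable_add:
  fixes f g :: "'a \<Rightarrow> 'b::{real_normed_vector, second_countable_topology} \<Rightarrow>\<^sub>L 'c::{real_inner, second_countable_topology}"
  assumes f: "L1_approximable M f" and g: "L1_approximable M g"
  shows "L1_approximable M (\<lambda>w. f w + g w)"
  unfolding L1_approximable_def
proof (intro conjI allI impI)
  have mf[measurable]: "(\<lambda>w. f w a \<bullet> b) \<in> borel_measurable M"
    and mg[measurable]: "(\<lambda>w. g w a \<bullet> b) \<in> borel_measurable M" for a b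
    using f g by (auto simp: L1_approximable_def)
  show m: "(\<lambda>w. (f w + g w) a \<bullet> b) \<in> borel_measurable M" for a b
    by (simp add: blinfun.bilinear_simps inner_add_left)
  fix e :: real assume "e > 0"
  then have e: "e / 2 > 0" by simp
  obtain s where s: "Bochner_Integration.simple_bochner_integrable M s"
    "(\<integral>\<^sup>+w. ennreal (norm (f w - s w)) \<partial>M) < ennreal (e / 2)"
    using f e unfolding L1_approximable_def by blast
  obtain t where t: "Bochner_Integration.simple_bochner_integrable M t"
    "(\<integral>\<^sup>+w. ennreal (norm (g w - t w)) \<partial>M) < ennreal (e / 2)"
    using g e unfolding L1_approximable_def by blast
  note ms[measurable] = simple_bochner_integrable_inner(3)[OF s(1)]
  note mt[measurable] = simple_bochner_integrable_inner(3)[OF t(1)]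
  have "(\<integral>\<^sup>+w. ennreal (norm ((f w + g w) - (s w + t w))) \<partial>M) \<le>
      (\<integral>\<^sup>+w. ennreal (norm ((f w + g w) - (s w + g w))) \<partial>M) + (\<integral>\<^sup>+w. ennreal (norm ((s w + g w) - (s w + t w))) \<partial>M)"
    by (rule nn_integral_norm_triangle) (auto simp: blinfun.bilinear_simps inner_add_left)
  also have "\<dots> < ennreal (e / 2) + ennreal (e / 2)" using s(2) t(2) by (auto intro: add_strict_mono)
  also have "\<dots> = ennreal e" using \<open>e > 0\<close> by (simp flip: ennreal_plus)
  finally have "(\<integral>\<^sup>+w. ennreal (norm ((f w + g w) - (s w + t w))) \<partial>M) < ennreal e" .
  moreover have "Bochner_Integration.simple_bochner_integrable M (\<lambda>w. s w + t w)"
    by (rule simple_bochner_integrable_compose2[OF _ s(1) t(1)]) simp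
  ultimately show "\<exists>s. Bochner_Integration.simple_bochner_integrable M s \<and>
      (\<integral>\<^sup>+w. ennreal (norm ((f w + g w) - s w)) \<partial>M) < ennreal e" by blast
qed

lemma L1_approximable_zero: "L1_approximable M (\<lambda>_. 0)"
  unfolding L1_approximable_def
  by (auto intro!: exI[of _ "\<lambda>_. 0"] Bochner_Integration.simple_bochner_integrable.intros)

lemma L1_approximable_sum:
  fixes f :: "'i \<Rightarrow> 'a \<Rightarrow> 'b::{real_normed_vector, second_countable_topology} \<Rightarrow>\<^sub>L 'c::{real_inner, second_countable_topology}"
  assumes "\<And>i. i \<in> I \<Longrightarrow> L1_approximable M (f i)"
  shows "L1_approximable M (\<lambda>w. \<Sum>i\<in>I. f i w)"
proof (cases "finite I")
  case True
  then show ?thesis using assms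
  proof (induction I rule: finite_induct)
    case (insert i I)
    then show ?case using L1_approximable_add[of M "f i" "\<lambda>w. \<Sum>i\<in>I. f i w"] by simp
  qed (simp add: L1_approximable_zero)
qed (simp add: L1_approximable_zero)

text \<open>Only the real coefficient varies, so its approximation by real simple functions,
  multiplied by the fixed operator T, is enough.\<close>

lemma L1_approximable_scaleR:
  fixes T :: "'b::real_normed_vector \<Rightarrow>\<^sub>L 'c::real_inner"
  assumes c: "integrable M c"
  shows "L1_approximable M (\<lambda>w. c w *\<^sub>R T)"
  unfolding L1_approximable_def
proof (intro conjI allI impI)
  have [measurable]: "c \<in> borel_measurable M" using c by simp
  show "(\<lambda>w. (c w *\<^sub>R T) a \<bullet> b) \<in> borel_measurable M" for a b by (simp add: blinfun.bilinear_simps)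
  fix e :: real assume e: "e > 0"
  from c obtain x where "has_bochner_integral M c x" by (auto simp: integrable.simps)
  then obtain s where s: "\<And>i. Bochner_Integration.simple_bochner_integrable M (s i)"
    and l: "(\<lambda>i. \<integral>\<^sup>+w. ennreal (norm (c w - s i w)) \<partial>M) \<longlonglongrightarrow> 0"
    unfolding has_bochner_integral.simps by blast
  have [measurable]: "s i \<in> borel_measurable M" for i
    using s[of i] by (auto elim!: Bochner_Integration.simple_bochner_integrable.cases
        intro: borel_measurable_simple_function)
  have "(\<lambda>i. ennreal (norm T) * (\<integral>\<^sup>+w. ennreal (norm (c w - s i w)) \<partial>M)) \<longlonglongrightarrow> ennreal (norm T) * 0"
    by (intro ennreal_tendsto_cmult l) simp
  from order_tendstoD(2)[OF this, of "ennreal e"] e obtain i where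
    i: "ennreal (norm T) * (\<integral>\<^sup>+w. ennreal (norm (c w - s i w)) \<partial>M) < ennreal e"
    by (auto simp: eventually_sequentially)
  have "(\<integral>\<^sup>+w. ennreal (norm (c w *\<^sub>R T - s i w *\<^sub>R T)) \<partial>M) =
      (\<integral>\<^sup>+w. ennreal (norm T) * ennreal (norm (c w - s i w)) \<partial>M)"
    by (simp add: mult.commute flip: scaleR_diff_left ennreal_mult)
  also have "\<dots> = ennreal (norm T) * (\<integral>\<^sup>+w. ennreal (norm (c w - s i w)) \<partial>M)"
    by (rule nn_integral_cmult) measurable
  also note i
  finally show "\<exists>s. Bochner_Integration.simple_bochner_integrable M s \<and>
      (\<integral>\<^sup>+w. ennreal (norm (c w *\<^sub>R T - s w)) \<partial>M) < ennreal e"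
    using simple_bochner_integrable_compose2[where p = "\<lambda>x y. x *\<^sub>R T", OF _ s[of i] s[of i]] by auto
qed

text \<open>The integrals of two simple functions differ in norm by at most their L^1 distance. The
  integrals of an approximating sequence are therefore Cauchy, and they converge because operators
  into a Banach space form a complete space.\<close>

lemma L1_approximable_Bochner_integrable:
  fixes f :: "'a \<Rightarrow> 'b::{real_normed_vector, second_countable_topology} \<Rightarrow>\<^sub>L
    'c::{real_inner, banach, second_countable_topology}"
  assumes f: "L1_approximable M f"
  shows "Bochner_integrable M f"
proof -
  have mf: "(\<lambda>w. f w a \<bullet> b) \<in> borel_measurable M" for a b
    using f by (auto simp: L1_approximable_def)
  have "\<exists>s. Bochner_Integration.simple_bochner_integrable M s \<and>
      (\<integral>\<^sup>+w. ennreal (norm (f w - s w)) \<partial>M) < ennreal (inverse (real (Suc n)))" for n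
    using f by (auto simp: L1_approximable_def simp del: of_nat_Suc)
  then obtain s where s: "\<And>n. Bochner_Integration.simple_bochner_integrable M (s n)"
    and sl: "\<And>n. (\<integral>\<^sup>+w. ennreal (norm (f w - s n w)) \<partial>M) < ennreal (inverse (real (Suc n)))" by metis
  let ?I = "\<lambda>n. Bochner_Integration.simple_bochner_integral M (s n)"
  have ms: "(\<lambda>w. s n w a \<bullet> b) \<in> borel_measurable M" for n a b
    using simple_bochner_integrable_inner(3)[OF s] .
  have lim: "(\<lambda>n. \<integral>\<^sup>+w. ennreal (norm (f w - s n w)) \<partial>M) \<longlonglongrightarrow> 0"
  proof (rule tendsto_sandwich[OF _ _ tendsto_const])
    show "(\<lambda>n. ennreal (inverse (real (Suc n)))) \<longlonglongrightarrow> 0"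
      using tendsto_ennrealI[OF LIMSEQ_inverse_real_of_nat] by simp
    show "eventually (\<lambda>n. (\<integral>\<^sup>+w. ennreal (norm (f w - s n w)) \<partial>M) \<le> ennreal (inverse (real (Suc n)))) sequentially"
      by (intro always_eventually allI less_imp_le sl)
  qed simp
  have d: "dist (?I i) (?I j) < e" if "inverse (real (Suc i)) \<le> e / 2" "inverse (real (Suc j)) \<le> e / 2" "e > 0" for i j e
  proof -
    have sd: "Bochner_Integration.simple_bochner_integrable M (\<lambda>w. s i w - s j w)"
      by (rule simple_bochner_integrable_compose2[OF _ s s]) simp
    have "ennreal (dist (?I i) (?I j)) = ennreal (norm (Bochner_Integration.simple_bochner_integral M (\<lambda>w. s i w - s j w)))"
      by (simp add: dist_norm simple_bochner_integral_diff[OF s s])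
    also have "\<dots> \<le> ennreal (Bochner_Integration.simple_bochner_integral M (\<lambda>w. norm (s i w - s j w)))"
      by (intro ennreal_leI simple_bochner_integral_norm_bound sd)
    also have "\<dots> = (\<integral>\<^sup>+w. ennreal (norm (s i w - s j w)) \<partial>M)"
      using simple_bochner_integrable_compose2[where p = "\<lambda>x y. norm x", OF _ sd sd]
      by (intro simple_bochner_integral_eq_nn_integral) auto
    also have "\<dots> \<le> (\<integral>\<^sup>+w. ennreal (norm (s i w - f w)) \<partial>M) + (\<integral>\<^sup>+w. ennreal (norm (f w - s j w)) \<partial>M)"
      by (rule nn_integral_norm_triangle[OF ms mf ms])
    also have "\<dots> < ennreal (inverse (real (Suc i))) + ennreal (inverse (real (Suc j)))"
      using sl by (intro add_strict_mono) (simp add: norm_minus_commute del: of_nat_Suc, blast)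
    also have "\<dots> \<le> ennreal (e / 2) + ennreal (e / 2)" using that by (intro add_mono ennreal_leI)
    also have "\<dots> = ennreal e" using that by (simp flip: ennreal_plus)
    finally show ?thesis using that by (simp add: ennreal_less_iff)
  qed
  have "Cauchy ?I"
  proof (rule metric_CauchyI)
    fix e :: real assume e: "e > 0"
    then obtain k where k: "inverse (real (Suc k)) < e / 2" using reals_Archimedean[of "e / 2"] by auto
    have "inverse (real (Suc i)) \<le> e / 2" if "i \<ge> k" for i
    proof -
      have "inverse (real (Suc i)) \<le> inverse (real (Suc k))" using that by (intro le_imp_inverse_le) auto
      then show ?thesis using k by linarith
    qed
    then show "\<exists>N. \<forall>m\<ge>N. \<forall>n\<ge>N. dist (?I m) (?I n) < e" using d e by blast
  qed
  then obtain T where T: "?I \<longlonglongrightarrow> T" by (auto simp: Cauchy_convergent_iff convergent_def)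
  have "(\<lambda>w. norm (f w - s i w)) \<in> borel_measurable M" for i
    using mf ms by (intro borel_measurable_norm_blinfun) (simp add: blinfun.bilinear_simps inner_diff_left)
  then show ?thesis using s lim T unfolding Bochner_integrable_def has_Bochner_def by blast
qed

text \<open>
  The second moment operators \<open>K(s) = E[G(s) \<otimes> G(s)]\<close> are approximated in \<open>L\<^sup>1\<close> by those of
  simple functions \<open>G\<^sub>i\<close>, for which \<open>K\<^sub>i\<close> is a finite sum of scalar functions times \<open>h \<otimes> h\<close>.
\<close>

lemma Bochner_second_moment:
  fixes G :: "'s \<times> 'a \<Rightarrow> 'h::{real_inner, banach, second_countable_topology}"
    and K :: "'s \<Rightarrow> 'h \<Rightarrow>\<^sub>L 'h"
  assumes N: "finite_measure N" and M: "finite_measure M"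
    and G: "square_integrable (N \<Otimes>\<^sub>M M) G"
    and Gs: "\<And>s. s \<in> space N \<Longrightarrow> square_integrable M (\<lambda>w. G (s, w))"
    and K: "\<And>s a b. s \<in> space N \<Longrightarrow> K s a \<bullet> b = (\<integral>w. (G (s, w) \<bullet> a) * (G (s, w) \<bullet> b) \<partial>M)"
  shows "Bochner_integrable N K"
    and "Bochner_integral N K a \<bullet> b = (\<integral>x. (G x \<bullet> a) * (G x \<bullet> b) \<partial>(N \<Otimes>\<^sub>M M))"
proof -
  interpret N: finite_measure N by fact
  interpret M: finite_measure M by fact
  interpret P: pair_sigma_finite N M ..
  have Gm[measurable]: "G \<in> borel_measurable (N \<Otimes>\<^sub>M M)" using G by (simp add: square_integrable_def)
  have Km: "(\<lambda>s. K s a \<bullet> b) \<in> borel_measurable N" for a b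
  proof -
    have "(\<lambda>s. \<integral>w. (G (s, w) \<bullet> a) * (G (s, w) \<bullet> b) \<partial>M) \<in> borel_measurable N" by measurable
    then show ?thesis by (subst measurable_cong[OF K])
  qed
  obtain Gi where "(\<forall>i. simple_function (N \<Otimes>\<^sub>M M) (Gi i)) \<and>
      (\<forall>x\<in>space (N \<Otimes>\<^sub>M M). (\<lambda>i. Gi i x) \<longlonglongrightarrow> G x) \<and>
      (\<forall>i. \<forall>x\<in>space (N \<Otimes>\<^sub>M M). dist (Gi i x) 0 \<le> 2 * dist (G x) 0)"
    using borel_measurable_implies_sequence_metric[OF Gm, of 0] by blast
  then have Gi: "\<And>i. simple_function (N \<Otimes>\<^sub>M M) (Gi i)"
    and Gil: "\<And>x. x \<in> space (N \<Otimes>\<^sub>M M) \<Longrightarrow> (\<lambda>i. Gi i x) \<longlonglongrightarrow> G x"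
    and Gib: "\<And>i x. x \<in> space (N \<Otimes>\<^sub>M M) \<Longrightarrow> norm (Gi i x) \<le> 2 * norm (G x)"
    by simp_all
  have [measurable]: "Gi i \<in> borel_measurable (N \<Otimes>\<^sub>M M)" for i
    using Gi by (rule borel_measurable_simple_function)
  have [measurable]: "Gi i \<in> measurable (N \<Otimes>\<^sub>M M) (count_space UNIV)" for i
    using Gi by (rule measurable_simple_function)
  define H where "H i = Gi i ` space (N \<Otimes>\<^sub>M M)" for i
  have finH: "finite (H i)" for i using Gi by (simp add: H_def simple_function_def)
  define Ki where "Ki i s = (\<Sum>h\<in>H i. measure M {w\<in>space M. Gi i (s, w) = h} *\<^sub>R (h \<otimes>\<^sub>H h))" for i s
  have approx: "L1_approximable N (Ki i)" for i
    unfolding Ki_def[abs_def]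
  proof (intro L1_approximable_sum L1_approximable_scaleR N.integrable_const_bound[where B = "measure M (space M)"] AE_I2)
    fix h s
    show "norm (measure M {w \<in> space M. Gi i (s, w) = h}) \<le> measure M (space M)"
      by (simp add: M.bounded_measure)
    \<comment> \<open>As the integral over w of the indicator of a set measurable in the product,
      the measure of the section is measurable in s.\<close>
    have "measure M {w \<in> space M. Gi i (s, w) = h} =
        (\<integral>w. indicator {x \<in> space (N \<Otimes>\<^sub>M M). Gi i x = h} (s, w) \<partial>M)" if "s \<in> space N" for s
    proof -
      have "(\<integral>w. indicator {x \<in> space (N \<Otimes>\<^sub>M M). Gi i x = h} (s, w) \<partial>M) =
          (\<integral>w. indicat_real {w \<in> space M. Gi i (s, w) = h} w \<partial>M)"
        using that by (intro Bochner_Integration.integral_cong) (auto simp: space_pair_measure indicator_def)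
      then show ?thesis by (simp add: Int_def conj_commute)
    qed
    then show "(\<lambda>s. measure M {w \<in> space M. Gi i (s, w) = h}) \<in> borel_measurable N"
      by (subst measurable_cong) measurable
  qed
  \<comment> \<open>The pointwise bound for the norm of u \<otimes> u - v \<otimes> v, with u and v
    the values of G and of its approximation. Each factor is at most 3 |G| because |v| \<le> 2 |u|,
    whence the dominating constant 9.\<close>
  define d where "d i x = norm (G x - Gi i x) * (norm (G x) + norm (Gi i x))" for i x
  have [measurable]: "d i \<in> borel_measurable (N \<Otimes>\<^sub>M M)" for i unfolding d_def[abs_def] by measurable
  have d0: "0 \<le> d i x" for i x by (simp add: d_def)
  have d9: "d i x \<le> 9 * (norm (G x))\<^sup>2" if "x \<in> space (N \<Otimes>\<^sub>M M)" for i x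
  proof -
    have "norm (G x - Gi i x) \<le> 3 * norm (G x)"
      using norm_triangle_ineq4[of "G x" "Gi i x"] Gib[OF that, of i] by simp
    moreover have "norm (G x) + norm (Gi i x) \<le> 3 * norm (G x)" using Gib[OF that, of i] by simp
    ultimately have "d i x \<le> (3 * norm (G x)) * (3 * norm (G x))" unfolding d_def by (intro mult_mono) auto
    then show ?thesis by (simp add: power2_eq_square)
  qed
  have Kdiff: "ennreal (norm (K s - Ki i s)) \<le> (\<integral>\<^sup>+w. ennreal (d i (s, w)) \<partial>M)" if s: "s \<in> space N" for s i
  proof -
    have sw: "(s, w) \<in> space (N \<Otimes>\<^sub>M M)" if "w \<in> space M" for w using s that by (simp add: space_pair_measure)
    have [measurable]: "(\<lambda>w. G (s, w)) \<in> borel_measurable M" "(\<lambda>w. Gi i (s, w)) \<in> borel_measurable M"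
      "(\<lambda>w. d i (s, w)) \<in> borel_measurable M" "(\<lambda>w. Gi i (s, w)) \<in> measurable M (count_space UNIV)"
      using s by measurable
    have Gis: "square_integrable M (\<lambda>w. Gi i (s, w))"
      by (rule square_integrable_bound[OF Gs[OF s], of _ 2]) (use Gib sw in auto)
    have dint: "integrable M (\<lambda>w. d i (s, w))"
      by (rule Bochner_Integration.integrable_bound[of _ "\<lambda>w. 9 * (norm (G (s, w)))\<^sup>2"])
         (use Gs[OF s] d9 d0 sw in \<open>auto simp: square_integrable_def\<close>)
    have Kii: "Ki i s a \<bullet> b = (\<integral>w. (Gi i (s, w) \<bullet> a) * (Gi i (s, w) \<bullet> b) \<partial>M)" for a b
    proof -
      have "(\<integral>w. (Gi i (s, w) \<bullet> a) * (Gi i (s, w) \<bullet> b) \<partial>M) =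
          (\<integral>w. (\<Sum>h\<in>H i. indicator {w\<in>space M. Gi i (s, w) = h} w * ((h \<bullet> a) * (h \<bullet> b))) \<partial>M)"
      proof (rule Bochner_Integration.integral_cong[OF refl])
        fix w assume w: "w \<in> space M"
        have "(\<Sum>h\<in>H i. indicator {w\<in>space M. Gi i (s, w) = h} w * ((h \<bullet> a) * (h \<bullet> b))) =
            (\<Sum>h\<in>H i. if h = Gi i (s, w) then (h \<bullet> a) * (h \<bullet> b) else 0)"
          using w by (intro sum.cong) (auto simp: indicator_def)
        also have "\<dots> = (Gi i (s, w) \<bullet> a) * (Gi i (s, w) \<bullet> b)"
          using finH[of i] sw[OF w] by (simp add: H_def)
        finally show "(Gi i (s, w) \<bullet> a) * (Gi i (s, w) \<bullet> b) =
            (\<Sum>h\<in>H i. indicator {w\<in>space M. Gi i (s, w) = h} w * ((h \<bullet> a) * (h \<bullet> b)))" by simp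
      qed
      also have "\<dots> = (\<Sum>h\<in>H i. measure M {w\<in>space M. Gi i (s, w) = h} * ((h \<bullet> a) * (h \<bullet> b)))"
        by (subst Bochner_Integration.integral_sum) (auto intro!: sum.cong simp: M.emeasure_finite less_top[symmetric])
      also have "\<dots> = Ki i s a \<bullet> b"
        by (simp add: Ki_def blinfun.sum_left blinfun.scaleR_left inner_sum_left tensor.rep_eq mult.assoc)
      finally show ?thesis by simp
    qed
    have "norm (K s - Ki i s) \<le> (\<integral>w. d i (s, w) \<partial>M)"
    proof (rule norm_blinfun_le_inner)
      fix a b
      have i1: "integrable M (\<lambda>w. (G (s, w) \<bullet> a) * (G (s, w) \<bullet> b))"
        using integrable_inner[OF square_integrable_inner_const[OF Gs[OF s], of a] square_integrable_inner_const[OF Gs[OF s], of b]]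
        by simp
      have i2: "integrable M (\<lambda>w. (Gi i (s, w) \<bullet> a) * (Gi i (s, w) \<bullet> b))"
        using integrable_inner[OF square_integrable_inner_const[OF Gis, of a] square_integrable_inner_const[OF Gis, of b]]
        by simp
      have "(K s - Ki i s) a \<bullet> b = (\<integral>w. (G (s, w) \<bullet> a) * (G (s, w) \<bullet> b) - (Gi i (s, w) \<bullet> a) * (Gi i (s, w) \<bullet> b) \<partial>M)"
        using i1 i2 by (simp add: blinfun.bilinear_simps inner_diff_left K[OF s] Kii)
      then have "\<bar>(K s - Ki i s) a \<bullet> b\<bar> \<le>
          (\<integral>w. \<bar>(G (s, w) \<bullet> a) * (G (s, w) \<bullet> b) - (Gi i (s, w) \<bullet> a) * (Gi i (s, w) \<bullet> b)\<bar> \<partial>M)"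
        by (simp only: integral_abs_bound)
      also have "\<dots> \<le> (\<integral>w. d i (s, w) * (norm a * norm b) \<partial>M)"
      proof (rule integral_mono)
        fix w
        let ?u = "G (s, w)" and ?v = "Gi i (s, w)"
        have "(?u \<bullet> a) * (?u \<bullet> b) - (?v \<bullet> a) * (?v \<bullet> b) = ((?u - ?v) \<bullet> a) * (?u \<bullet> b) + (?v \<bullet> a) * ((?u - ?v) \<bullet> b)"
          by (simp add: inner_diff_left algebra_simps)
        then have "\<bar>(?u \<bullet> a) * (?u \<bullet> b) - (?v \<bullet> a) * (?v \<bullet> b)\<bar> \<le> \<bar>(?u - ?v) \<bullet> a\<bar> * \<bar>?u \<bullet> b\<bar> + \<bar>?v \<bullet> a\<bar> * \<bar>(?u - ?v) \<bullet> b\<bar>"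
          by (metis abs_mult abs_triangle_ineq)
        also have "\<dots> \<le> (norm (?u - ?v) * norm a) * (norm ?u * norm b) + (norm ?v * norm a) * (norm (?u - ?v) * norm b)"
          by (intro add_mono mult_mono Cauchy_Schwarz_ineq2) auto
        also have "\<dots> = d i (s, w) * (norm a * norm b)" by (simp add: d_def algebra_simps)
        finally show "\<bar>(?u \<bullet> a) * (?u \<bullet> b) - (?v \<bullet> a) * (?v \<bullet> b)\<bar> \<le> d i (s, w) * (norm a * norm b)" .
      qed (use i1 i2 dint in auto)
      also have "\<dots> = (\<integral>w. d i (s, w) \<partial>M) * norm a * norm b" by (simp add: mult.assoc)
      finally show "\<bar>(K s - Ki i s) a \<bullet> b\<bar> \<le> (\<integral>w. d i (s, w) \<partial>M) * norm a * norm b" .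
    qed (simp add: d0)
    then have "ennreal (norm (K s - Ki i s)) \<le> ennreal (\<integral>w. d i (s, w) \<partial>M)" by (rule ennreal_leI)
    also have "\<dots> = (\<integral>\<^sup>+w. ennreal (d i (s, w)) \<partial>M)"
      using dint by (simp add: nn_integral_eq_integral d0)
    finally show ?thesis .
  qed
  \<comment> \<open>Dominated convergence takes place on the product space with scalar functions;
    integrating \<open>Kdiff\<close> over s turns it into L^1 convergence in operator norm.\<close>
  have dlim: "(\<lambda>i. \<integral>\<^sup>+x. ennreal (d i x) \<partial>(N \<Otimes>\<^sub>M M)) \<longlonglongrightarrow> (\<integral>\<^sup>+x. 0 \<partial>(N \<Otimes>\<^sub>M M))"
  proof (rule nn_integral_dominated_convergence[where w = "\<lambda>x. ennreal (9 * (norm (G x))\<^sup>2)"])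
    show "(\<integral>\<^sup>+x. ennreal (9 * (norm (G x))\<^sup>2) \<partial>(N \<Otimes>\<^sub>M M)) < \<infinity>"
      using G by (subst nn_integral_eq_integral) (auto simp: square_integrable_def)
    show "AE x in N \<Otimes>\<^sub>M M. (\<lambda>i. ennreal (d i x)) \<longlonglongrightarrow> 0"
    proof (intro AE_I2)
      fix x assume "x \<in> space (N \<Otimes>\<^sub>M M)"
      note l = Gil[OF this]
      have "(\<lambda>i. d i x) \<longlonglongrightarrow> norm (G x - G x) * (norm (G x) + norm (G x))"
        unfolding d_def by (intro tendsto_intros l)
      from tendsto_ennrealI[OF this] show "(\<lambda>i. ennreal (d i x)) \<longlonglongrightarrow> 0" by simp
    qed
  qed (use d9 in \<open>auto intro!: ennreal_leI\<close>)
  have "L1_approximable N K"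
  proof (rule L1_approximable_limit[OF Km])
    fix e :: real assume "e > 0"
    with order_tendstoD(2)[OF dlim, of "ennreal e"] obtain i where
      i: "(\<integral>\<^sup>+x. ennreal (d i x) \<partial>(N \<Otimes>\<^sub>M M)) < ennreal e" by (auto simp: eventually_sequentially)
    have "(\<integral>\<^sup>+s. ennreal (norm (K s - Ki i s)) \<partial>N) \<le> (\<integral>\<^sup>+s. \<integral>\<^sup>+w. ennreal (d i (s, w)) \<partial>M \<partial>N)"
      by (intro nn_integral_mono Kdiff)
    also have "\<dots> = (\<integral>\<^sup>+x. ennreal (d i x) \<partial>(N \<Otimes>\<^sub>M M))" by (rule M.nn_integral_fst) measurable
    also note i
    finally show "\<exists>g. L1_approximable N g \<and> (\<integral>\<^sup>+s. ennreal (norm (K s - g s)) \<partial>N) < ennreal e"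
      using approx by blast
  qed
  then show int: "Bochner_integrable N K" by (rule L1_approximable_Bochner_integrable)
  have "Bochner_integral N K a \<bullet> b = (\<integral>s. K s a \<bullet> b \<partial>N)" by (rule Bochner_integral_inner[OF Km int])
  also have "\<dots> = (\<integral>s. \<integral>w. (G (s, w) \<bullet> a) * (G (s, w) \<bullet> b) \<partial>M \<partial>N)"
    by (intro Bochner_Integration.integral_cong refl K)
  also have "\<dots> = (\<integral>x. (G x \<bullet> a) * (G x \<bullet> b) \<partial>(N \<Otimes>\<^sub>M M))"
    using integrable_inner[OF square_integrable_inner_const[OF G, of a] square_integrable_inner_const[OF G, of b]]
    by (intro P.integral_fst') simp
  finally show "Bochner_integral N K a \<bullet> b = (\<integral>x. (G x \<bullet> a) * (G x \<bullet> b) \<partial>(N \<Otimes>\<^sub>M M))" .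
qed

text \<open>The second moment lemma with M in the role of time and a one-point probability space in
  the role of chance: the expectation of u \<otimes> u is then u \<otimes> u itself.\<close>

lemma Bochner_tensor_square:
  fixes u :: "'a \<Rightarrow> 'h::{real_inner, banach, second_countable_topology}"
  assumes M: "finite_measure M" and u: "square_integrable M u"
  shows "Bochner_integrable M (\<lambda>w. u w \<otimes>\<^sub>H u w)"
    and "Bochner_integral M (\<lambda>w. u w \<otimes>\<^sub>H u w) a \<bullet> b = (\<integral>w. (u w \<bullet> a) * (u w \<bullet> b) \<partial>M)"
proof -
  have [measurable]: "u \<in> borel_measurable M" using u by (simp add: square_integrable_def)
  let ?N = "return (count_space UNIV) ()"
  interpret N: prob_space ?N by (rule prob_space_return) simp
  have f: "finite_measure ?N" by (rule N.finite_measure_axioms)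
  interpret M: finite_measure M by fact
  interpret P: pair_sigma_finite M ?N ..
  have e: "(\<integral>\<^sup>+x. ennreal ((norm (u (fst x)))\<^sup>2) \<partial>(M \<Otimes>\<^sub>M ?N)) = (\<integral>\<^sup>+w. ennreal ((norm (u w))\<^sup>2) \<partial>M)"
    by (subst N.nn_integral_fst[symmetric]) (simp_all add: nn_integral_return)
  have G: "square_integrable (M \<Otimes>\<^sub>M ?N) (\<lambda>x. u (fst x))"
    using u by (simp add: square_integrable_iff e)
  have Gs: "square_integrable ?N (\<lambda>w. u (fst (s, w)))" for s
    by (simp add: square_integrable_def)
  have K: "(u s \<otimes>\<^sub>H u s) a \<bullet> b = (\<integral>w. (u (fst (s, w)) \<bullet> a) * (u (fst (s, w)) \<bullet> b) \<partial>?N)" for s a b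
    using N.prob_space by (simp add: tensor.rep_eq)
  show int: "Bochner_integrable M (\<lambda>w. u w \<otimes>\<^sub>H u w)"
    by (rule Bochner_second_moment(1)[OF M f G Gs K])
  show "Bochner_integral M (\<lambda>w. u w \<otimes>\<^sub>H u w) a \<bullet> b = (\<integral>w. (u w \<bullet> a) * (u w \<bullet> b) \<partial>M)"
    by (subst Bochner_integral_inner[OF _ int]) (simp_all add: tensor.rep_eq)
qed

subsection \<open>The Ito isometry\<close>

lemma square_integrable_cong:
  assumes "\<And>w. w \<in> space M \<Longrightarrow> f w = g w"
  shows "square_integrable M f \<longleftrightarrow> square_integrable M g"
proof -
  have "f \<in> borel_measurable M \<longleftrightarrow> g \<in> borel_measurable M"
    using assms by (rule measurable_cong)
  moreover have "integrable M (\<lambda>w. (norm (f w))\<^sup>2) \<longleftrightarrow> integrable M (\<lambda>w. (norm (g w))\<^sup>2)"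
    using assms by (intro Bochner_Integration.integrable_cong) simp_all
  ultimately show ?thesis by (simp add: square_integrable_def)
qed

lemma inner_blinfun_eq_adjoint:
  fixes T :: "'h::{real_inner, banach} \<Rightarrow>\<^sub>L 'h"
  shows "T x \<bullet> y = x \<bullet> blinfun_adjoint T y"
  by (metis blinfun_adjoint_inner inner_commute)

lemma blinfun_adjoint_sum_scaleR:
  fixes T :: "'i \<Rightarrow> 'h::{real_inner, banach} \<Rightarrow>\<^sub>L 'h"
  shows "blinfun_adjoint (\<Sum>j\<in>J. c j *\<^sub>R T j) f = (\<Sum>j\<in>J. c j *\<^sub>R blinfun_adjoint (T j) f)"
proof -
  have "blinfun_adjoint (\<Sum>j\<in>J. c j *\<^sub>R T j) f \<bullet> y = (\<Sum>j\<in>J. c j *\<^sub>R blinfun_adjoint (T j) f) \<bullet> y" for y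
    by (simp add: blinfun_adjoint_inner blinfun.sum_left blinfun.scaleR_left inner_sum_left inner_sum_right)
  then show ?thesis by (metis vector_eq_rdot)
qed

text \<open>Splitting along the finitely many level sets replaces a random operator by fixed
  operators weighted with real indicators. All later arguments about random simple operators rest on
  this reduction.\<close>

lemma simple_function_decompose:
  fixes h :: "'b \<Rightarrow> 'c::real_vector"
  assumes "simple_function N \<phi>" "w \<in> space N"
  shows "h (\<phi> w) = (\<Sum>T\<in>\<phi> ` space N. indicator {x\<in>space N. \<phi> x = T} w *\<^sub>R h T)"
proof -
  have "(\<Sum>T\<in>\<phi> ` space N. indicator {x\<in>space N. \<phi> x = T} w *\<^sub>R h T) =
      (\<Sum>T\<in>\<phi> ` space N. if \<phi> w = T then h T else 0)"
    using assms(2) by (intro sum.cong refl) (auto simp: indicator_def)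
  also have "\<dots> = h (\<phi> w)" using assms by (simp add: simple_function_def)
  finally show ?thesis by simp
qed

lemma borel_measurable_simple_apply:
  fixes \<phi> :: "'a \<Rightarrow> 'b::{real_inner, second_countable_topology} \<Rightarrow>\<^sub>L 'c::{real_inner, second_countable_topology}"
  assumes \<phi>: "simple_function N \<phi>" and D[measurable]: "D \<in> borel_measurable N"
  shows "(\<lambda>w. \<phi> w (D w)) \<in> borel_measurable N"
proof -
  have [measurable]: "\<phi> \<in> measurable N (count_space UNIV)" using \<phi> by (rule measurable_simple_function)
  have [measurable]: "blinfun_apply T \<in> borel_measurable borel" for T :: "'b \<Rightarrow>\<^sub>L 'c"
    by (intro borel_measurable_continuous_onI linear_continuous_on blinfun.bounded_linear_right)
  have "(\<lambda>w. \<Sum>T\<in>\<phi> ` space N. indicator {x\<in>space N. \<phi> x = T} w *\<^sub>R T (D w)) \<in> borel_measurable N"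
    by measurable
  then show ?thesis
    by (subst measurable_cong[OF simple_function_decompose[OF \<phi>, of _ "\<lambda>T. blinfun_apply T (D _)"]])
qed

lemma simple_function_subalgebra:
  assumes "subalgebra M N" "simple_function N \<phi>"
  shows "simple_function M \<phi>"
  using assms by (auto simp: simple_function_def subalgebra_def)

lemma (in prob_space) normal_variable_moments:
  assumes X: "normal_variable M X 0 v"
  shows "integrable M (\<lambda>w. (X w)\<^sup>2)" "expectation X = 0" "expectation (\<lambda>w. (X w)\<^sup>2) = v"
proof -
  have [measurable]: "X \<in> borel_measurable M" using X by (simp add: normal_variable_def)
  have "integrable M (\<lambda>w. (X w)\<^sup>2) \<and> expectation X = 0 \<and> expectation (\<lambda>w. (X w)\<^sup>2) = v"
  proof (cases "v = 0")
    case True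
    with X have ae: "AE w in M. X w = 0" by (simp add: normal_variable_def)
    have "integrable M (\<lambda>w. (X w)\<^sup>2)" using ae by (subst integrable_cong_AE[where g = "\<lambda>_. 0"]) auto
    moreover have "expectation X = 0" using ae by (subst integral_cong_AE[where g = "\<lambda>_. 0"]) auto
    moreover have "expectation (\<lambda>w. (X w)\<^sup>2) = 0" using ae by (subst integral_cong_AE[where g = "\<lambda>_. 0"]) auto
    ultimately show ?thesis using True by simp
  next
    case False
    with X have v: "v > 0" and D: "distributed M lborel X (normal_density 0 (sqrt v))"
      by (auto simp: normal_variable_def)
    have s: "0 < sqrt v" using v by simp
    have e: "expectation X = 0" using normal_distributed_expectation[OF s D] .
    have "integrable M (\<lambda>w. (X w)\<^sup>2)"
      using integrable_normal_moment[OF s, of 0 2] distributed_integrable[OF D, of "\<lambda>x. x\<^sup>2"] by simp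
    moreover have "expectation (\<lambda>w. (X w)\<^sup>2) = v"
      using normal_distributed_variance[OF s D] e v by simp
    ultimately show ?thesis using e by simp
  qed
  then show "integrable M (\<lambda>w. (X w)\<^sup>2)" "expectation X = 0" "expectation (\<lambda>w. (X w)\<^sup>2) = v" by auto
qed

section \<open>Increments of a Wiener process and simple random operators applied to them\<close>

locale wiener = prob_space M for M :: "'a measure" +
  fixes F :: "real \<Rightarrow> 'a measure"
    and W :: "real \<Rightarrow> 'a \<Rightarrow> 'h::{real_inner, banach, second_countable_topology}"
    and Q :: "'h \<Rightarrow>\<^sub>L 'h"
  assumes filt: "filtered_prob_space M F" and wiener: "Wiener_process M F W Q"
begin

lemma subalgebra_M: "0 \<le> t \<Longrightarrow> subalgebra M (F t)"
  using filt by (auto simp: filtered_prob_space_def)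

lemma subalgebra_mono: "0 \<le> s \<Longrightarrow> s \<le> t \<Longrightarrow> subalgebra (F t) (F s)"
  using filt subalgebra_M[of s] subalgebra_M[of t] by (auto simp: filtered_prob_space_def subalgebra_def)

lemma space_F [simp]: "0 \<le> t \<Longrightarrow> space (F t) = space M"
  using subalgebra_M by (auto simp: subalgebra_def)

lemma increment_measurable_F:
  assumes "0 \<le> s" "s \<le> t" "t \<le> r"
  shows "(\<lambda>w. W t w - W s w) \<in> borel_measurable (F r)"
proof -
  have "W t \<in> borel_measurable (F t)" "W s \<in> borel_measurable (F s)"
    using wiener assms by (auto simp: Wiener_process_def adapted_process_def)
  then have "W t \<in> borel_measurable (F r)" "W s \<in> borel_measurable (F r)"
    using measurable_from_subalg[OF subalgebra_mono] assms by (meson order_trans)+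
  then show ?thesis by simp
qed

lemma increment_measurable:
  assumes "0 \<le> s" "s \<le> t"
  shows "(\<lambda>w. W t w - W s w) \<in> borel_measurable M"
  using measurable_from_subalg[OF subalgebra_M increment_measurable_F] assms by (meson order_refl order_trans)

lemma Q_symmetric: "symmetric_op Q" and Q_positive: "positive_op Q"
  using wiener by (auto simp: Wiener_process_def covariance_class_def)

lemma Q_inner: "Q x \<bullet> y = op_sqrt Q x \<bullet> op_sqrt Q y"
proof -
  have "Q x = op_sqrt Q (op_sqrt Q x)" using op_sqrt(2)[OF Q_symmetric Q_positive]
    by (metis blinfun_apply_blinfun_compose)
  then show ?thesis using op_sqrt(1)[OF Q_symmetric Q_positive] by (simp add: symmetric_op_def)
qed

lemma obtain_basis:
  obtains E where "orthonormal_basis E" "(\<integral>\<^sup>+e. ennreal (Q e \<bullet> e) \<partial>count_space E) < \<infinity>"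
  using wiener by (auto simp: Wiener_process_def covariance_class_def)

context
  fixes s t :: real
  assumes st: "0 \<le> s" "s \<le> t"
begin

lemma increment_normal: "normal_variable M (\<lambda>w. (W t w - W s w) \<bullet> f) 0 ((t - s) * (Q f \<bullet> f))"
  using wiener st by (auto simp: Wiener_process_def)

text \<open>The definition controls the scalar projections of an increment only. Parseval and
  Tonelli add up their variances to (t - s) times the trace of Q, which is finite because Q is of
  trace class.\<close>

lemma square_integrable_increment: "square_integrable M (\<lambda>w. W t w - W s w)"
proof -
  note [measurable] = increment_measurable[OF st]
  obtain E where E: "orthonormal_basis E" and tr: "(\<integral>\<^sup>+e. ennreal (Q e \<bullet> e) \<partial>count_space E) < \<infinity>"
    by (rule obtain_basis)
  have "(\<integral>\<^sup>+w. ennreal ((norm (W t w - W s w))\<^sup>2) \<partial>M) =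
      (\<integral>\<^sup>+w. \<integral>\<^sup>+e. ennreal (((W t w - W s w) \<bullet> e)\<^sup>2) \<partial>count_space E \<partial>M)"
    by (simp add: parseval[OF E])
  also have "\<dots> = (\<integral>\<^sup>+e. \<integral>\<^sup>+w. ennreal (((W t w - W s w) \<bullet> e)\<^sup>2) \<partial>M \<partial>count_space E)"
    by (rule nn_integral_count_space_nn_integral) (simp_all add: orthonormal_basis_countable[OF E])
  also have "\<dots> = (\<integral>\<^sup>+e. ennreal (t - s) * ennreal (Q e \<bullet> e) \<partial>count_space E)"
  proof (rule nn_integral_cong)
    fix e
    show "(\<integral>\<^sup>+w. ennreal (((W t w - W s w) \<bullet> e)\<^sup>2) \<partial>M) = ennreal (t - s) * ennreal (Q e \<bullet> e)"
      using normal_variable_moments[OF increment_normal[of e]] st Q_positive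
      by (simp add: nn_integral_eq_integral ennreal_mult positive_op_def)
  qed
  also have "\<dots> = ennreal (t - s) * (\<integral>\<^sup>+e. ennreal (Q e \<bullet> e) \<partial>count_space E)"
    by (rule nn_integral_cmult) simp
  also have "\<dots> < \<infinity>" using tr by (simp add: ennreal_mult_less_top)
  finally show ?thesis by (simp add: square_integrable_iff)
qed

lemma increment_inner_integrable:
  "integrable M (\<lambda>w. (W t w - W s w) \<bullet> u)"
  "integrable M (\<lambda>w. ((W t w - W s w) \<bullet> u) * ((W t w - W s w) \<bullet> v))"
proof -
  have *: "square_integrable M (\<lambda>w. (W t w - W s w) \<bullet> u)" for u
    using square_integrable_increment by (rule square_integrable_inner_const)
  have "square_integrable M (\<lambda>w. 1::real)" by (simp add: square_integrable_def)
  from integrable_inner[OF * this] show "integrable M (\<lambda>w. (W t w - W s w) \<bullet> u)" by simp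
  from integrable_inner[OF *[of u] *[of v]]
  show "integrable M (\<lambda>w. ((W t w - W s w) \<bullet> u) * ((W t w - W s w) \<bullet> v))" by simp
qed

text \<open>Polarization: the product of two projections is a quarter of the difference of the
  squared projections on u + v and u - v, whose variances are known.\<close>

lemma increment_covariance:
  "expectation (\<lambda>w. ((W t w - W s w) \<bullet> u) * ((W t w - W s w) \<bullet> v)) = (t - s) * (Q u \<bullet> v)"
proof -
  let ?D = "\<lambda>w. W t w - W s w"
  have "(?D w \<bullet> u) * (?D w \<bullet> v) = (1/4) * ((?D w \<bullet> (u + v))\<^sup>2 - (?D w \<bullet> (u - v))\<^sup>2)" for w
    by (simp add: inner_add_right inner_diff_right power2_eq_square algebra_simps)
  then have "expectation (\<lambda>w. (?D w \<bullet> u) * (?D w \<bullet> v)) =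
      expectation (\<lambda>w. (1/4) * ((?D w \<bullet> (u + v))\<^sup>2 - (?D w \<bullet> (u - v))\<^sup>2))" by (simp only:)
  also have "\<dots> = (1/4) * (expectation (\<lambda>w. (?D w \<bullet> (u + v))\<^sup>2) - expectation (\<lambda>w. (?D w \<bullet> (u - v))\<^sup>2))"
    using normal_variable_moments(1)[OF increment_normal] by simp
  also have "\<dots> = (1/4) * ((t - s) * (Q (u + v) \<bullet> (u + v)) - (t - s) * (Q (u - v) \<bullet> (u - v)))"
    by (simp only: normal_variable_moments(3)[OF increment_normal])
  also have "Q v \<bullet> u = Q u \<bullet> v" using Q_symmetric by (metis symmetric_op_def inner_commute)
  then have "(1/4) * ((t - s) * (Q (u + v) \<bullet> (u + v)) - (t - s) * (Q (u - v) \<bullet> (u - v))) = (t - s) * (Q u \<bullet> v)"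
    by (simp add: blinfun.bilinear_simps inner_add_left inner_add_right inner_diff_left inner_diff_right algebra_simps)
  finally show ?thesis .
qed

text \<open>The sigma-algebra of \<xi> lies in \<open>F s\<close>, and that of a Borel function of
  the increment lies in that of the increment itself; independence is inherited by smaller
  families.\<close>

lemma increment_indep:
  fixes \<xi> :: "'a \<Rightarrow> real" and g :: "'h \<Rightarrow> real"
  assumes \<xi>: "\<xi> \<in> borel_measurable (F s)" and [measurable]: "g \<in> borel_measurable borel"
  shows "indep_var borel \<xi> borel (\<lambda>w. g (W t w - W s w))"
proof -
  let ?D = "\<lambda>w. W t w - W s w"
  note [measurable] = increment_measurable[OF st]
  have [measurable]: "\<xi> \<in> borel_measurable M"
    using measurable_from_subalg[OF subalgebra_M[OF st(1)] \<xi>] .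
  have ind: "indep_set (sets (F s)) {?D -` A \<inter> space M | A. A \<in> sets borel}"
    using wiener st by (auto simp: Wiener_process_def)
  have 1: "sigma_sets (space M) {\<xi> -` A \<inter> space M | A. A \<in> sets borel} \<subseteq> sets (F s)"
    using sets.sigma_sets_subset[of "{\<xi> -` A \<inter> space M | A. A \<in> sets borel}" "F s"]
      measurable_sets[OF \<xi>] st by auto
  have "{(\<lambda>w. g (?D w)) -` A \<inter> space M | A. A \<in> sets borel} \<subseteq> sets (vimage_algebra (space M) ?D borel)"
  proof safe
    fix A :: "real set" assume "A \<in> sets borel"
    then have "g -` A \<inter> space borel \<in> sets borel" by measurable
    then have "?D -` (g -` A) \<inter> space M \<in> sets (vimage_algebra (space M) ?D borel)"
      by (intro in_vimage_algebra) simp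
    then show "(\<lambda>w. g (?D w)) -` A \<inter> space M \<in> sets (vimage_algebra (space M) ?D borel)"
      by (simp add: vimage_def)
  qed
  then have "sigma_sets (space M) {(\<lambda>w. g (?D w)) -` A \<inter> space M | A. A \<in> sets borel} \<subseteq>
      sets (vimage_algebra (space M) ?D borel)"
    using sets.sigma_sets_subset[of _ "vimage_algebra (space M) ?D borel"] by simp
  \<comment> \<open>The preimages of Borel sets already form a sigma-algebra, so the family in
    \<open>Wiener_process\<close> contains everything generated by g of the increment.\<close>
  also have "\<dots> = {?D -` A \<inter> space M | A. A \<in> sets borel}" by (rule sets_vimage_algebra2) simp
  finally have 2: "sigma_sets (space M) {(\<lambda>w. g (?D w)) -` A \<inter> space M | A. A \<in> sets borel} \<subseteq> \<dots>" .
  show ?thesis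
    unfolding indep_var_eq
  proof (intro conjI)
    show "indep_set (sigma_sets (space M) {\<xi> -` A \<inter> space M |A. A \<in> sets borel})
        (sigma_sets (space M) {(\<lambda>w. g (?D w)) -` A \<inter> space M |A. A \<in> sets borel})"
      using ind 1 2 unfolding indep_sets2_eq by (meson order_trans subsetD)
  qed measurable
qed

text \<open>Independence gives both the factorization of the expectations and the integrability of
  the products, so \<xi> may be unbounded.\<close>

lemma increment_times:
  fixes \<xi> :: "'a \<Rightarrow> real"
  assumes \<xi>: "\<xi> \<in> borel_measurable (F s)" "integrable M \<xi>"
  shows "integrable M (\<lambda>w. \<xi> w * ((W t w - W s w) \<bullet> u))"
    and "expectation (\<lambda>w. \<xi> w * ((W t w - W s w) \<bullet> u)) = 0"
    and "integrable M (\<lambda>w. \<xi> w * (((W t w - W s w) \<bullet> u) * ((W t w - W s w) \<bullet> v)))"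
    and "expectation (\<lambda>w. \<xi> w * (((W t w - W s w) \<bullet> u) * ((W t w - W s w) \<bullet> v))) =
      expectation \<xi> * ((t - s) * (Q u \<bullet> v))"
proof -
  have i1: "indep_var borel \<xi> borel (\<lambda>w. (W t w - W s w) \<bullet> u)"
    by (rule increment_indep[OF \<xi>(1), of "\<lambda>x. x \<bullet> u"]) simp
  have i2: "indep_var borel \<xi> borel (\<lambda>w. ((W t w - W s w) \<bullet> u) * ((W t w - W s w) \<bullet> v))"
    by (rule increment_indep[OF \<xi>(1), of "\<lambda>x. (x \<bullet> u) * (x \<bullet> v)"]) simp
  show "integrable M (\<lambda>w. \<xi> w * ((W t w - W s w) \<bullet> u))"
    by (rule indep_var_integrable[OF i1 \<xi>(2) increment_inner_integrable(1)])
  show "integrable M (\<lambda>w. \<xi> w * (((W t w - W s w) \<bullet> u) * ((W t w - W s w) \<bullet> v)))"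
    by (rule indep_var_integrable[OF i2 \<xi>(2) increment_inner_integrable(2)])
  show "expectation (\<lambda>w. \<xi> w * ((W t w - W s w) \<bullet> u)) = 0"
    using indep_var_lebesgue_integral[OF i1 \<xi>(2) increment_inner_integrable(1)]
      normal_variable_moments(2)[OF increment_normal[of u]] by simp
  show "expectation (\<lambda>w. \<xi> w * (((W t w - W s w) \<bullet> u) * ((W t w - W s w) \<bullet> v))) =
      expectation \<xi> * ((t - s) * (Q u \<bullet> v))"
    using indep_var_lebesgue_integral[OF i2 \<xi>(2) increment_inner_integrable(2)]
    by (simp add: increment_covariance)
qed

context
  fixes \<phi> :: "'a \<Rightarrow> 'h \<Rightarrow>\<^sub>L 'h"
  assumes \<phi>: "simple_function (F s) \<phi>"
begin

lemma simple_M: "simple_function M \<phi>"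
  using simple_function_subalgebra[OF subalgebra_M[OF st(1)] \<phi>] .

lemma indicator_level:
  "(\<lambda>w. indicator {x\<in>space M. \<phi> x = T} w :: real) \<in> borel_measurable (F s)"
  "integrable M (\<lambda>w. indicator {x\<in>space M. \<phi> x = T} w :: real)"
proof -
  have "{x\<in>space (F s). \<phi> x = T} \<in> sets (F s)"
    using measurable_simple_function[OF \<phi>] by measurable
  then show 1: "(\<lambda>w. indicator {x\<in>space M. \<phi> x = T} w :: real) \<in> borel_measurable (F s)"
    using st by simp
  have [measurable]: "(\<lambda>w. indicator {x\<in>space M. \<phi> x = T} w :: real) \<in> borel_measurable M"
    using measurable_from_subalg[OF subalgebra_M[OF st(1)] 1] .
  show "integrable M (\<lambda>w. indicator {x\<in>space M. \<phi> x = T} w :: real)"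
    by (rule integrable_const_bound[of _ 1]) auto
qed

lemma square_integrable_simple_increment: "square_integrable M (\<lambda>w. \<phi> w (W t w - W s w))"
proof -
  let ?D = "\<lambda>w. W t w - W s w"
  have [measurable]: "(\<lambda>w. indicator {x\<in>space M. \<phi> x = T} w :: real) \<in> borel_measurable M" for T
    using indicator_level(2) by (rule borel_measurable_integrable)
  have "square_integrable M (\<lambda>w. \<Sum>T\<in>\<phi> ` space M. indicator {x\<in>space M. \<phi> x = T} w *\<^sub>R T (?D w))"
  proof (rule square_integrable_sum)
    fix T assume "T \<in> \<phi> ` space M"
    have T: "square_integrable M (\<lambda>w. T (?D w))"
      by (rule square_integrable_blinfun[OF square_integrable_increment])
    then have [measurable]: "(\<lambda>w. T (?D w)) \<in> borel_measurable M" by (simp add: square_integrable_def)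
    show "square_integrable M (\<lambda>w. indicator {x\<in>space M. \<phi> x = T} w *\<^sub>R T (?D w))"
    proof (rule square_integrable_bound[OF T, of _ 1])
      show "(\<lambda>w. indicator {x\<in>space M. \<phi> x = T} w *\<^sub>R T (?D w)) \<in> borel_measurable M" by measurable
    qed (auto simp: indicator_def)
  qed
  then show ?thesis
    by (subst square_integrable_cong[OF simple_function_decompose[OF simple_M, of _ "\<lambda>T. blinfun_apply T (?D _)"]])
qed

lemma simple_increment_inner_decompose:
  assumes "w \<in> space M"
  shows "\<phi> w (W t w - W s w) \<bullet> f =
    (\<Sum>T\<in>\<phi> ` space M. indicator {x\<in>space M. \<phi> x = T} w * ((W t w - W s w) \<bullet> blinfun_adjoint T f))"
  using simple_function_decompose[OF simple_M assms, of "\<lambda>T. blinfun_apply T (W t w - W s w) \<bullet> f"]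
  by (simp add: inner_blinfun_eq_adjoint)

text \<open>After the split into level sets, the weight \<xi> times an indicator is known at time s,
  and the projected increment is independent of it with mean zero. The weight 1 yields the mean of
  an elementary integral, an earlier summand as weight its cross terms.\<close>

lemma simple_increment_orthogonal:
  fixes \<xi> :: "'a \<Rightarrow> real"
  assumes \<xi>: "\<xi> \<in> borel_measurable (F s)" "integrable M \<xi>"
  shows "expectation (\<lambda>w. \<xi> w * (\<phi> w (W t w - W s w) \<bullet> f)) = 0"
proof -
  let ?i = "\<lambda>T w. indicator {x\<in>space M. \<phi> x = T} w :: real"
  let ?D = "\<lambda>w. W t w - W s w"
  have m: "(\<lambda>w. \<xi> w * ?i T w) \<in> borel_measurable (F s)" for T
    using \<xi>(1) indicator_level(1) by measurable
  have i: "integrable M (\<lambda>w. \<xi> w * ?i T w)" for T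
    using \<xi>(2) measurable_from_subalg[OF subalgebra_M[OF st(1)] m]
    by (rule Bochner_Integration.integrable_bound) (auto simp: indicator_def)
  have "expectation (\<lambda>w. \<xi> w * (\<phi> w (?D w) \<bullet> f)) =
      expectation (\<lambda>w. \<Sum>T\<in>\<phi> ` space M. (\<xi> w * ?i T w) * (?D w \<bullet> blinfun_adjoint T f))"
    by (rule Bochner_Integration.integral_cong)
       (simp_all add: simple_increment_inner_decompose sum_distrib_left mult.assoc)
  also have "\<dots> = (\<Sum>T\<in>\<phi> ` space M. expectation (\<lambda>w. (\<xi> w * ?i T w) * (?D w \<bullet> blinfun_adjoint T f)))"
    by (rule Bochner_Integration.integral_sum) (rule increment_times(1)[OF m i])
  also have "\<dots> = 0" by (intro sum.neutral ballI increment_times(2)[OF m i])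
  finally show ?thesis .
qed

text \<open>On the level set where \<phi> equals T, the operator moves to the test vectors by its
  adjoint, and the covariance of the increment is (t - s) times the form of Q.
  \<open>Q_inner\<close> rewrites that form as an inner product of images under the square
  root.\<close>

lemma simple_increment_isometry:
  "expectation (\<lambda>w. (\<phi> w (W t w - W s w) \<bullet> f) * (\<phi> w (W t w - W s w) \<bullet> g)) =
    (t - s) * expectation (\<lambda>w. op_sqrt Q (blinfun_adjoint (\<phi> w) f) \<bullet> op_sqrt Q (blinfun_adjoint (\<phi> w) g))"
proof -
  let ?i = "\<lambda>T w. indicator {x\<in>space M. \<phi> x = T} w :: real"
  let ?D = "\<lambda>w. W t w - W s w" and ?a = "blinfun_adjoint"
  have "expectation (\<lambda>w. (\<phi> w (?D w) \<bullet> f) * (\<phi> w (?D w) \<bullet> g)) =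
      expectation (\<lambda>w. \<Sum>T\<in>\<phi> ` space M. ?i T w * ((?D w \<bullet> ?a T f) * (?D w \<bullet> ?a T g)))"
  proof (rule Bochner_Integration.integral_cong[OF refl])
    fix w assume w: "w \<in> space M"
    show "(\<phi> w (?D w) \<bullet> f) * (\<phi> w (?D w) \<bullet> g) =
        (\<Sum>T\<in>\<phi> ` space M. ?i T w * ((?D w \<bullet> ?a T f) * (?D w \<bullet> ?a T g)))"
      using simple_function_decompose[OF simple_M w, of "\<lambda>T. (blinfun_apply T (?D w) \<bullet> f) * (blinfun_apply T (?D w) \<bullet> g)"]
      by (simp add: inner_blinfun_eq_adjoint)
  qed
  also have "\<dots> = (\<Sum>T\<in>\<phi> ` space M. expectation (\<lambda>w. ?i T w * ((?D w \<bullet> ?a T f) * (?D w \<bullet> ?a T g))))"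
    by (rule Bochner_Integration.integral_sum) (rule increment_times(3)[OF indicator_level])
  also have "\<dots> = (\<Sum>T\<in>\<phi> ` space M. expectation (?i T) * ((t - s) * (Q (?a T f) \<bullet> ?a T g)))"
    by (intro sum.cong refl increment_times(4)[OF indicator_level])
  also have "\<dots> = (t - s) * (\<Sum>T\<in>\<phi> ` space M. expectation (\<lambda>w. ?i T w * (Q (?a T f) \<bullet> ?a T g)))"
    by (simp add: sum_distrib_left mult_ac)
  also have "(\<Sum>T\<in>\<phi> ` space M. expectation (\<lambda>w. ?i T w * (Q (?a T f) \<bullet> ?a T g))) =
      expectation (\<lambda>w. \<Sum>T\<in>\<phi> ` space M. ?i T w * (Q (?a T f) \<bullet> ?a T g))"
    using indicator_level(2) by (intro Bochner_Integration.integral_sum[symmetric] integrable_mult_left)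
  also have "\<dots> = expectation (\<lambda>w. op_sqrt Q (?a (\<phi> w) f) \<bullet> op_sqrt Q (?a (\<phi> w) g))"
  proof (rule Bochner_Integration.integral_cong[OF refl])
    fix w assume w: "w \<in> space M"
    show "(\<Sum>T\<in>\<phi> ` space M. ?i T w * (Q (?a T f) \<bullet> ?a T g)) =
        op_sqrt Q (?a (\<phi> w) f) \<bullet> op_sqrt Q (?a (\<phi> w) g)"
      using simple_function_decompose[OF simple_M w, of "\<lambda>T. Q (?a T f) \<bullet> ?a T g"] by (simp add: Q_inner)
  qed
  finally show ?thesis .
qed

end
end

end

lemma square_integrable_bounded:
  assumes "finite_measure M" and [measurable]: "f \<in> borel_measurable M"
    and "\<And>w. w \<in> space M \<Longrightarrow> norm (f w) \<le> C"
  shows "square_integrable M f"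
proof -
  interpret finite_measure M by fact
  have "(norm (f w))\<^sup>2 \<le> C\<^sup>2" if "w \<in> space M" for w
    using assms(3)[OF that] by (intro power_mono) auto
  then have "integrable M (\<lambda>w. (norm (f w))\<^sup>2)"
    by (intro integrable_const_bound[of _ "C\<^sup>2"]) auto
  then show ?thesis by (simp add: square_integrable_def)
qed

lemma square_integrable_integrable:
  fixes f :: "'a \<Rightarrow> 'b::{real_inner, banach, second_countable_topology}"
  assumes "finite_measure M" "square_integrable M f"
  shows "integrable M f"
proof -
  interpret finite_measure M by fact
  have [measurable]: "f \<in> borel_measurable M" using assms by (simp add: square_integrable_def)
  have "x \<le> 1 + x\<^sup>2" for x :: real using zero_le_power2[of "x - 1/2"] by (simp add: power2_eq_square algebra_simps)
  then have "AE w in M. norm (f w) \<le> norm (1 + (norm (f w))\<^sup>2)" by simp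
  then show ?thesis
    by (rule Bochner_Integration.integrable_bound[rotated -1]) (use assms in \<open>auto simp: square_integrable_def\<close>)
qed

lemma square_integrable_cong_AE:
  assumes "square_integrable M f" and [measurable]: "g \<in> borel_measurable M" and "AE w in M. g w = f w"
  shows "square_integrable M g"
proof -
  have [measurable]: "f \<in> borel_measurable M" using assms by (simp add: square_integrable_def)
  have "integrable M (\<lambda>w. (norm (g w))\<^sup>2) \<longleftrightarrow> integrable M (\<lambda>w. (norm (f w))\<^sup>2)"
    using assms(3) by (intro integrable_cong_AE) auto
  then show ?thesis using assms by (simp add: square_integrable_def)
qed

lemma L2_tendsto_inner_const:
  fixes a :: "'a \<Rightarrow> 'h::{real_inner, second_countable_topology}"
  assumes [measurable]: "\<And>k. a\<^sub>k k \<in> borel_measurable M" "a \<in> borel_measurable M"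
    and l: "(\<lambda>k. \<integral>\<^sup>+w. ennreal ((norm (a w - a\<^sub>k k w))\<^sup>2) \<partial>M) \<longlonglongrightarrow> 0"
  shows "(\<lambda>k. \<integral>\<^sup>+w. ennreal ((norm (a w \<bullet> f - a\<^sub>k k w \<bullet> f))\<^sup>2) \<partial>M) \<longlonglongrightarrow> 0"
proof (rule tendsto_sandwich[OF _ _ tendsto_const])
  have "(\<integral>\<^sup>+w. ennreal ((norm (a w \<bullet> f - a\<^sub>k k w \<bullet> f))\<^sup>2) \<partial>M) \<le>
      (\<integral>\<^sup>+w. ennreal ((norm f)\<^sup>2) * ennreal ((norm (a w - a\<^sub>k k w))\<^sup>2) \<partial>M)" for k
  proof (intro nn_integral_mono)
    fix w
    have "(norm (a w \<bullet> f - a\<^sub>k k w \<bullet> f))\<^sup>2 \<le> (norm f * norm (a w - a\<^sub>k k w))\<^sup>2"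
      using Cauchy_Schwarz_ineq2[of "a w - a\<^sub>k k w" f]
      by (intro power_mono) (simp_all add: inner_diff_left mult.commute)
    then show "ennreal ((norm (a w \<bullet> f - a\<^sub>k k w \<bullet> f))\<^sup>2) \<le> ennreal ((norm f)\<^sup>2) * ennreal ((norm (a w - a\<^sub>k k w))\<^sup>2)"
      by (simp add: power_mult_distrib ennreal_leI flip: ennreal_mult)
  qed
  then show "eventually (\<lambda>k. (\<integral>\<^sup>+w. ennreal ((norm (a w \<bullet> f - a\<^sub>k k w \<bullet> f))\<^sup>2) \<partial>M) \<le>
      ennreal ((norm f)\<^sup>2) * (\<integral>\<^sup>+w. ennreal ((norm (a w - a\<^sub>k k w))\<^sup>2) \<partial>M)) sequentially"
    by (simp add: nn_integral_cmult)
  have "(\<lambda>k. ennreal ((norm f)\<^sup>2) * (\<integral>\<^sup>+w. ennreal ((norm (a w - a\<^sub>k k w))\<^sup>2) \<partial>M)) \<longlonglongrightarrow> ennreal ((norm f)\<^sup>2) * 0"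
    by (intro ennreal_tendsto_cmult l) simp
  then show "(\<lambda>k. ennreal ((norm f)\<^sup>2) * (\<integral>\<^sup>+w. ennreal ((norm (a w - a\<^sub>k k w))\<^sup>2) \<partial>M)) \<longlonglongrightarrow> 0" by simp
qed simp

lemma blinfun_adjoint_diff:
  fixes T :: "'h::{real_inner, banach} \<Rightarrow>\<^sub>L 'h"
  shows "blinfun_adjoint (T - T') f = blinfun_adjoint T f - blinfun_adjoint T' f"
proof -
  have "blinfun_adjoint (T - T') f \<bullet> y = (blinfun_adjoint T f - blinfun_adjoint T' f) \<bullet> y" for y
    by (simp add: blinfun_adjoint_inner blinfun.bilinear_simps inner_diff_left inner_diff_right)
  then show ?thesis by (metis vector_eq_rdot)
qed

text \<open>The coefficient of the left-hand vector at e equals <f, T R e>; Cauchy-Schwarz and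
  Parseval finish. The lemma converts the Hilbert-Schmidt convergence in the definition of the
  stochastic integral into L^2 convergence for each test vector. An existing basis is required
  because \<open>hs_norm_sq\<close> picks one by \<open>SOME\<close>.\<close>

lemma hs_norm_sq_ge_adjoint:
  fixes T R :: "'h::{real_inner, banach, second_countable_topology} \<Rightarrow>\<^sub>L 'h"
  assumes "\<exists>E::'h set. orthonormal_basis E" "symmetric_op R"
  shows "ennreal ((norm (R (blinfun_adjoint T f)))\<^sup>2) \<le> ennreal ((norm f)\<^sup>2) * hs_norm_sq (T o\<^sub>L R)"
proof -
  define E :: "'h set" where "E = (SOME E. orthonormal_basis E)"
  have E: "orthonormal_basis E" unfolding E_def by (rule someI_ex) (rule assms)
  have "ennreal ((norm (R (blinfun_adjoint T f)))\<^sup>2) = (\<integral>\<^sup>+e. ennreal ((R (blinfun_adjoint T f) \<bullet> e)\<^sup>2) \<partial>count_space E)"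
    by (simp add: parseval[OF E])
  also have "\<dots> \<le> (\<integral>\<^sup>+e. ennreal ((norm f)\<^sup>2) * ennreal ((norm ((T o\<^sub>L R) e))\<^sup>2) \<partial>count_space E)"
  proof (intro nn_integral_mono)
    fix e
    have "R (blinfun_adjoint T f) \<bullet> e = f \<bullet> (T o\<^sub>L R) e"
      using assms(2) by (simp add: symmetric_op_def blinfun_adjoint_inner)
    then have "(R (blinfun_adjoint T f) \<bullet> e)\<^sup>2 \<le> (norm f * norm ((T o\<^sub>L R) e))\<^sup>2"
      using Cauchy_Schwarz_ineq2[of f "(T o\<^sub>L R) e"] by (simp add: abs_le_square_iff[symmetric])
    then show "ennreal ((R (blinfun_adjoint T f) \<bullet> e)\<^sup>2) \<le> ennreal ((norm f)\<^sup>2) * ennreal ((norm ((T o\<^sub>L R) e))\<^sup>2)"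
      by (simp add: power_mult_distrib ennreal_leI flip: ennreal_mult)
  qed
  also have "\<dots> = ennreal ((norm f)\<^sup>2) * hs_norm_sq (T o\<^sub>L R)"
    unfolding hs_norm_sq_def E_def[symmetric] by (rule nn_integral_cmult) simp
  finally show ?thesis .
qed

lemma finite_measure_lborel_interval: "finite_measure (restrict_space lborel {0..T::real})"
  by (rule finite_measureI) (simp add: emeasure_restrict_space space_restrict_space emeasure_lborel_Icc_eq)

section \<open>Elementary integrands: mean, isometry and their counterparts on the product of time
  and chance\<close>

context wiener
begin

lemma elementary_times:
  assumes "elementary_integrand F T n \<tau> \<phi>" "i \<le> j" "j \<le> n"
  shows "0 \<le> \<tau> i" "\<tau> i \<le> \<tau> j" "\<tau> j \<le> T"
proof -
  have mono: "\<tau> i \<le> \<tau> j" if "i \<le> j" "j \<le> n" for i j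
    using that
  proof (induction j rule: dec_induct)
    case (step k)
    then show ?case using assms(1) by (auto simp: elementary_integrand_def intro: order_trans)
  qed simp
  show "\<tau> i \<le> \<tau> j" using mono assms by simp
  show "0 \<le> \<tau> i" using mono[of 0 i] assms by (simp add: elementary_integrand_def)
  show "\<tau> j \<le> T" using mono[of j n] assms by (simp add: elementary_integrand_def)
qed

context
  fixes T :: real and n :: nat and \<tau> :: "nat \<Rightarrow> real" and \<phi> :: "nat \<Rightarrow> 'a \<Rightarrow> 'h \<Rightarrow>\<^sub>L 'h"
  assumes el: "elementary_integrand F T n \<tau> \<phi>"
begin

lemma step_times: "j < n \<Longrightarrow> 0 \<le> \<tau> j" "j < n \<Longrightarrow> \<tau> j \<le> \<tau> (Suc j)"
  using elementary_times(1)[OF el, of j n] elementary_times(2)[OF el, of j "Suc j"] by auto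

lemma step_simple: "j < n \<Longrightarrow> simple_function (F (\<tau> j)) (\<phi> j)"
  using el by (simp add: elementary_integrand_def)

lemma square_integrable_step:
  "j < n \<Longrightarrow> square_integrable M (\<lambda>w. \<phi> j w (W (\<tau> (Suc j)) w - W (\<tau> j) w))"
  by (rule square_integrable_simple_increment[OF step_times step_simple])

lemma square_integrable_elementary_integral:
  "square_integrable M (elementary_integral W n \<tau> \<phi>)"
  unfolding elementary_integral_def[abs_def] by (rule square_integrable_sum) (simp add: square_integrable_step)

lemma elementary_integral_mean: "expectation (\<lambda>w. elementary_integral W n \<tau> \<phi> w \<bullet> f) = 0"
proof -
  let ?a = "\<lambda>j w. \<phi> j w (W (\<tau> (Suc j)) w - W (\<tau> j) w) \<bullet> f"
  have int: "integrable M (?a j)" if "j < n" for j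
    by (intro square_integrable_integrable[OF finite_measure_axioms]
        square_integrable_inner_const square_integrable_step that)
  have zero: "expectation (?a j) = 0" if "j < n" for j
  proof -
    have "expectation (\<lambda>w. 1 * ?a j w) = 0"
      using that by (intro simple_increment_orthogonal step_times step_simple) auto
    then show ?thesis by (simp only: mult_1_left)
  qed
  have "expectation (\<lambda>w. elementary_integral W n \<tau> \<phi> w \<bullet> f) = expectation (\<lambda>w. \<Sum>j<n. ?a j w)"
    by (simp only: elementary_integral_def inner_sum_left)
  also have "\<dots> = (\<Sum>j<n. expectation (?a j))"
    by (rule Bochner_Integration.integral_sum) (simp add: int)
  also have "\<dots> = 0" by (simp add: zero)
  finally show ?thesis .
qed

text \<open>Expanding the product of sums, the cross terms vanish because the earlier summand is
  known when the later increment starts; the diagonal terms are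
  \<open>simple_increment_isometry\<close>.\<close>

lemma elementary_integral_isometry:
  "expectation (\<lambda>w. (elementary_integral W n \<tau> \<phi> w \<bullet> f) * (elementary_integral W n \<tau> \<phi> w \<bullet> g)) =
    (\<Sum>j<n. (\<tau> (Suc j) - \<tau> j) *
      expectation (\<lambda>w. op_sqrt Q (blinfun_adjoint (\<phi> j w) f) \<bullet> op_sqrt Q (blinfun_adjoint (\<phi> j w) g)))"
proof -
  define a where "a j w = \<phi> j w (W (\<tau> (Suc j)) w - W (\<tau> j) w)" for j w
  have sq: "square_integrable M (\<lambda>w. a j w \<bullet> f)" if "j < n" for j f
    unfolding a_def by (rule square_integrable_inner_const[OF square_integrable_step[OF that]])
  have int: "integrable M (\<lambda>w. (a i w \<bullet> f) * (a j w \<bullet> g))" if "i < n" "j < n" for i j f g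
    using integrable_inner[OF sq[OF that(1), of f] sq[OF that(2), of g]] by simp
  have cross: "expectation (\<lambda>w. (a i w \<bullet> f) * (a j w \<bullet> g)) = 0" if "i < j" "j < n" for i j f g
    unfolding a_def[of j]
  proof (rule simple_increment_orthogonal[OF step_times step_simple])
    \<comment> \<open>The summand i uses W up to time \<open>\<tau> (Suc i)\<close>, which is at
      most \<open>\<tau> j\<close> because i < j; this makes it measurable with respect to
      \<open>F (\<tau> j)\<close>.\<close>
    have t: "0 \<le> \<tau> i" "\<tau> i \<le> \<tau> (Suc i)" "\<tau> (Suc i) \<le> \<tau> j"
      using step_times[of i] elementary_times(2)[OF el, of "Suc i" j] that by auto
    have "simple_function (F (\<tau> j)) (\<phi> i)"
      using t that by (intro simple_function_subalgebra[OF subalgebra_mono step_simple]) auto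
    then have "a i \<in> borel_measurable (F (\<tau> j))"
      unfolding a_def[abs_def] using t by (intro borel_measurable_simple_apply increment_measurable_F) auto
    then show "(\<lambda>w. a i w \<bullet> f) \<in> borel_measurable (F (\<tau> j))" by measurable
    show "integrable M (\<lambda>w. a i w \<bullet> f)"
      using that by (intro square_integrable_integrable[OF finite_measure_axioms] sq) auto
  qed (use that in auto)
  have "expectation (\<lambda>w. (elementary_integral W n \<tau> \<phi> w \<bullet> f) * (elementary_integral W n \<tau> \<phi> w \<bullet> g)) =
      expectation (\<lambda>w. \<Sum>i<n. \<Sum>j<n. (a i w \<bullet> f) * (a j w \<bullet> g))"
    by (simp add: elementary_integral_def a_def inner_sum_left sum_product)
  also have "\<dots> = (\<Sum>i<n. expectation (\<lambda>w. \<Sum>j<n. (a i w \<bullet> f) * (a j w \<bullet> g)))"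
    by (rule Bochner_Integration.integral_sum) (auto intro!: Bochner_Integration.integrable_sum int)
  also have "\<dots> = (\<Sum>i<n. \<Sum>j<n. expectation (\<lambda>w. (a i w \<bullet> f) * (a j w \<bullet> g)))"
    by (intro sum.cong refl Bochner_Integration.integral_sum int) auto
  also have "\<dots> = (\<Sum>i<n. \<Sum>j<n. if i = j then expectation (\<lambda>w. (a i w \<bullet> f) * (a i w \<bullet> g)) else 0)"
  proof (intro sum.cong refl)
    fix i j assume ij: "i \<in> {..<n}" "j \<in> {..<n}"
    consider "i < j" | "i = j" | "j < i" by linarith
    then show "expectation (\<lambda>w. (a i w \<bullet> f) * (a j w \<bullet> g)) =
        (if i = j then expectation (\<lambda>w. (a i w \<bullet> f) * (a i w \<bullet> g)) else 0)"
    proof cases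
      case 3
      then show ?thesis using cross[of j i g f] ij by (simp add: mult.commute)
    qed (use cross[of i j f g] ij in auto)
  qed
  also have "\<dots> = (\<Sum>i<n. expectation (\<lambda>w. (a i w \<bullet> f) * (a i w \<bullet> g)))" by simp
  also have "\<dots> = (\<Sum>j<n. (\<tau> (Suc j) - \<tau> j) *
      expectation (\<lambda>w. op_sqrt Q (blinfun_adjoint (\<phi> j w) f) \<bullet> op_sqrt Q (blinfun_adjoint (\<phi> j w) g)))"
    unfolding a_def by (intro sum.cong refl simple_increment_isometry[OF step_times step_simple]) auto
  finally show ?thesis .
qed

lemma elementary_process_adjoint:
  "op_sqrt Q (blinfun_adjoint (elementary_process n \<tau> \<phi> s w) f) =
    (\<Sum>j<n. indicator {\<tau> j<..\<tau> (Suc j)} s *\<^sub>R op_sqrt Q (blinfun_adjoint (\<phi> j w) f))"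
  by (simp only: elementary_process_def blinfun_adjoint_sum_scaleR blinfun.sum_right blinfun.scaleR_right)

abbreviation "time_interval \<equiv> restrict_space lborel {0..T}"

lemma step_adjoint_bounded:
  assumes "j < n"
  obtains C where "(\<lambda>w. op_sqrt Q (blinfun_adjoint (\<phi> j w) f)) \<in> borel_measurable M"
    "\<And>w. w \<in> space M \<Longrightarrow> norm (op_sqrt Q (blinfun_adjoint (\<phi> j w) f)) \<le> C"
proof -
  let ?h = "\<lambda>w. op_sqrt Q (blinfun_adjoint (\<phi> j w) f)"
  have "simple_function M (\<phi> j)"
    using simple_function_subalgebra[OF subalgebra_M[OF step_times(1)] step_simple] assms by blast
  then have s: "simple_function M ?h" by (rule simple_function_compose1)
  then have "finite (?h ` space M)" by (simp add: simple_function_def)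
  then have "bounded (?h ` space M)" by (rule finite_imp_bounded)
  then obtain C where "\<forall>x\<in>?h ` space M. norm x \<le> C" by (auto simp: bounded_iff)
  with s show ?thesis by (intro that[of C]) (auto intro: borel_measurable_simple_function)
qed

text \<open>A step is an indicator in time multiplied by a bounded function of chance, hence square
  integrable on a finite measure, and Fubini separates the two factors. The length of the step is
  seen in full because it lies in [0, T].\<close>

lemma step_product:
  assumes "j < n"
  shows "square_integrable (time_interval \<Otimes>\<^sub>M M)
      (\<lambda>x. indicator {\<tau> j<..\<tau> (Suc j)} (fst x) *\<^sub>R op_sqrt Q (blinfun_adjoint (\<phi> j (snd x)) f))"
    (is "square_integrable _ (?h f)")
    and "(\<integral>x. indicator {\<tau> j<..\<tau> (Suc j)} (fst x) *
        (op_sqrt Q (blinfun_adjoint (\<phi> j (snd x)) f) \<bullet> op_sqrt Q (blinfun_adjoint (\<phi> j (snd x)) g)) \<partial>(time_interval \<Otimes>\<^sub>M M)) =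
      (\<tau> (Suc j) - \<tau> j) *
        expectation (\<lambda>w. op_sqrt Q (blinfun_adjoint (\<phi> j w) f) \<bullet> op_sqrt Q (blinfun_adjoint (\<phi> j w) g))"
    and "integrable (time_interval \<Otimes>\<^sub>M M) (\<lambda>x. indicator {\<tau> j<..\<tau> (Suc j)} (fst x) *
        (op_sqrt Q (blinfun_adjoint (\<phi> j (snd x)) f) \<bullet> op_sqrt Q (blinfun_adjoint (\<phi> j (snd x)) g)))"
proof -
  interpret time_interval: finite_measure time_interval by (rule finite_measure_lborel_interval)
  interpret P: pair_sigma_finite time_interval M ..
  have fin: "finite_measure (time_interval \<Otimes>\<^sub>M M)"
    using finite_measure_pair_measure[OF finite_measure_axioms time_interval.finite_measure_axioms] .
  have [measurable]: "(indicator {\<tau> j<..\<tau> (Suc j)} :: real \<Rightarrow> real) \<in> borel_measurable time_interval"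
    by (intro measurable_restrict_space1) simp
  show sq: "square_integrable (time_interval \<Otimes>\<^sub>M M) (?h f)" for f
  proof -
    obtain C where m[measurable]: "(\<lambda>w. op_sqrt Q (blinfun_adjoint (\<phi> j w) f)) \<in> borel_measurable M"
      and C: "\<And>w. w \<in> space M \<Longrightarrow> norm (op_sqrt Q (blinfun_adjoint (\<phi> j w) f)) \<le> C"
      by (rule step_adjoint_bounded[OF assms, of f]) blast
    show ?thesis
    proof (rule square_integrable_bounded[OF fin])
      show "?h f \<in> borel_measurable (time_interval \<Otimes>\<^sub>M M)" by measurable
      fix x assume "x \<in> space (time_interval \<Otimes>\<^sub>M M)"
      then have "snd x \<in> space M" by (auto simp: space_pair_measure)
      from C[OF this] show "norm (?h f x) \<le> C"
        by (auto simp: indicator_def intro: order_trans[OF norm_ge_zero])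
    qed
  qed
  have "?h f x \<bullet> ?h g x = indicator {\<tau> j<..\<tau> (Suc j)} (fst x) *
      (op_sqrt Q (blinfun_adjoint (\<phi> j (snd x)) f) \<bullet> op_sqrt Q (blinfun_adjoint (\<phi> j (snd x)) g))" for x
    by (simp add: indicator_def)
  with integrable_inner[OF sq[of f] sq[of g]] show int: "integrable (time_interval \<Otimes>\<^sub>M M) (\<lambda>x. indicator {\<tau> j<..\<tau> (Suc j)} (fst x) *
        (op_sqrt Q (blinfun_adjoint (\<phi> j (snd x)) f) \<bullet> op_sqrt Q (blinfun_adjoint (\<phi> j (snd x)) g)))"
    by (simp only:)
  have "{\<tau> j<..\<tau> (Suc j)} \<subseteq> {0..T}"
    using step_times(1)[OF assms] elementary_times(3)[OF el, of "Suc j" "Suc j"] assms by auto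
  then have meas: "measure time_interval {\<tau> j<..\<tau> (Suc j)} = \<tau> (Suc j) - \<tau> j"
    using step_times(2)[OF assms] by (subst measure_restrict_space) auto
  have "(\<integral>x. indicator {\<tau> j<..\<tau> (Suc j)} (fst x) *
        (op_sqrt Q (blinfun_adjoint (\<phi> j (snd x)) f) \<bullet> op_sqrt Q (blinfun_adjoint (\<phi> j (snd x)) g)) \<partial>(time_interval \<Otimes>\<^sub>M M)) =
     (\<integral>s. (\<integral>w. indicator {\<tau> j<..\<tau> (Suc j)} s *
        (op_sqrt Q (blinfun_adjoint (\<phi> j w) f) \<bullet> op_sqrt Q (blinfun_adjoint (\<phi> j w) g)) \<partial>M) \<partial>time_interval)"
    using P.integral_fst'[OF int] by simp
  also have "\<dots> = (\<integral>s. indicator {\<tau> j<..\<tau> (Suc j)} s \<partial>time_interval) *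
      expectation (\<lambda>w. op_sqrt Q (blinfun_adjoint (\<phi> j w) f) \<bullet> op_sqrt Q (blinfun_adjoint (\<phi> j w) g))"
    by simp
  also have "(\<integral>s. indicator {\<tau> j<..\<tau> (Suc j)} s \<partial>time_interval) = \<tau> (Suc j) - \<tau> j"
    using meas \<open>{\<tau> j<..\<tau> (Suc j)} \<subseteq> {0..T}\<close> by (simp add: space_restrict_space Int_absorb2)
  finally show "(\<integral>x. indicator {\<tau> j<..\<tau> (Suc j)} (fst x) *
        (op_sqrt Q (blinfun_adjoint (\<phi> j (snd x)) f) \<bullet> op_sqrt Q (blinfun_adjoint (\<phi> j (snd x)) g)) \<partial>(time_interval \<Otimes>\<^sub>M M)) =
      (\<tau> (Suc j) - \<tau> j) *
        expectation (\<lambda>w. op_sqrt Q (blinfun_adjoint (\<phi> j w) f) \<bullet> op_sqrt Q (blinfun_adjoint (\<phi> j w) g))" .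
qed

lemma elementary_process_square_integrable:
  "square_integrable (time_interval \<Otimes>\<^sub>M M)
    (\<lambda>x. op_sqrt Q (blinfun_adjoint (elementary_process n \<tau> \<phi> (fst x) (snd x)) f))"
  unfolding elementary_process_adjoint by (intro square_integrable_sum step_product(1)) simp

text \<open>On the time side the off-diagonal terms vanish pointwise, since half-open steps are
  disjoint, and the diagonal terms integrate to the sum in
  \<open>elementary_integral_isometry\<close>.\<close>

lemma elementary_process_isometry:
  "(\<integral>x. op_sqrt Q (blinfun_adjoint (elementary_process n \<tau> \<phi> (fst x) (snd x)) f) \<bullet>
      op_sqrt Q (blinfun_adjoint (elementary_process n \<tau> \<phi> (fst x) (snd x)) g) \<partial>(time_interval \<Otimes>\<^sub>M M)) =
    expectation (\<lambda>w. (elementary_integral W n \<tau> \<phi> w \<bullet> f) * (elementary_integral W n \<tau> \<phi> w \<bullet> g))"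
proof -
  let ?i = "\<lambda>j s. indicator {\<tau> j<..\<tau> (Suc j)} s :: real"
  let ?b = "\<lambda>j w f. op_sqrt Q (blinfun_adjoint (\<phi> j w) f)"
  have disj: "?i i s * ?i j s = (if i = j then ?i i s else 0)" if "i < n" "j < n" for i j s
  proof -
    consider "i < j" | "i = j" | "j < i" by linarith
    then show ?thesis
    proof cases
      case 1
      then show ?thesis using elementary_times(2)[OF el, of "Suc i" j] that by (auto simp: indicator_def)
    next
      case 3
      then show ?thesis using elementary_times(2)[OF el, of "Suc j" i] that by (auto simp: indicator_def)
    qed (auto simp: indicator_def)
  qed
  have "(\<Sum>i<n. ?i i s *\<^sub>R ?b i w f) \<bullet> (\<Sum>j<n. ?i j s *\<^sub>R ?b j w g) = (\<Sum>j<n. ?i j s * (?b j w f \<bullet> ?b j w g))" for s w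
  proof -
    have "(\<Sum>i<n. ?i i s *\<^sub>R ?b i w f) \<bullet> (\<Sum>j<n. ?i j s *\<^sub>R ?b j w g) =
        (\<Sum>i<n. \<Sum>j<n. (?i i s * ?i j s) * (?b i w f \<bullet> ?b j w g))"
      unfolding inner_sum_left unfolding inner_sum_right by (intro sum.cong refl) simp
    also have "\<dots> = (\<Sum>i<n. \<Sum>j<n. if i = j then ?i i s * (?b i w f \<bullet> ?b i w g) else 0)"
      by (intro sum.cong refl) (simp add: disj)
    also have "\<dots> = (\<Sum>i<n. ?i i s * (?b i w f \<bullet> ?b i w g))" by simp
    finally show ?thesis .
  qed
  then have "(\<integral>x. op_sqrt Q (blinfun_adjoint (elementary_process n \<tau> \<phi> (fst x) (snd x)) f) \<bullet>
      op_sqrt Q (blinfun_adjoint (elementary_process n \<tau> \<phi> (fst x) (snd x)) g) \<partial>(time_interval \<Otimes>\<^sub>M M)) =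
    (\<integral>x. (\<Sum>j<n. ?i j (fst x) * (?b j (snd x) f \<bullet> ?b j (snd x) g)) \<partial>(time_interval \<Otimes>\<^sub>M M))"
    by (simp only: elementary_process_adjoint)
  also have "\<dots> = (\<Sum>j<n. \<integral>x. ?i j (fst x) * (?b j (snd x) f \<bullet> ?b j (snd x) g) \<partial>(time_interval \<Otimes>\<^sub>M M))"
    by (rule Bochner_Integration.integral_sum) (simp add: step_product(3))
  also have "\<dots> = (\<Sum>j<n. (\<tau> (Suc j) - \<tau> j) * expectation (\<lambda>w. ?b j w f \<bullet> ?b j w g))"
    by (intro sum.cong refl step_product(2)) simp
  finally show ?thesis by (simp only: elementary_integral_isometry)
qed

end

end

section \<open>General stochastic integrals as limits of elementary ones\<close>

lemma (in wiener) stochastic_integral_L2: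
  assumes I: "has_stochastic_integral M F W Q T \<Phi> I"
  shows "square_integrable M I" and "expectation (\<lambda>w. I w \<bullet> f) = 0"
proof -
  obtain n \<tau> \<phi> where el: "\<And>k. elementary_integrand F T (n k) (\<tau> k) (\<phi> k)"
    and l: "(\<lambda>k. \<integral>\<^sup>+w. ennreal ((norm (I w - elementary_integral W (n k) (\<tau> k) (\<phi> k) w))\<^sup>2) \<partial>M) \<longlonglongrightarrow> 0"
    and Im: "I \<in> borel_measurable M"
    using I unfolding has_stochastic_integral_def by blast
  note sq = square_integrable_elementary_integral[OF el]
  show I2: "square_integrable M I" by (rule square_integrable_limit[OF sq Im l])
  \<comment> \<open>On a probability space the constant f is square integrable, so the mean paired
    with f is an L^2 inner product and passes to the limit.\<close>
  have c: "square_integrable M (\<lambda>_. f)" by (simp add: square_integrable_def)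
  have "(\<lambda>k. expectation (\<lambda>w. elementary_integral W (n k) (\<tau> k) (\<phi> k) w \<bullet> f)) \<longlonglongrightarrow> expectation (\<lambda>w. I w \<bullet> f)"
    by (rule L2_tendsto_inner[OF sq c I2 c l]) simp
  then show "expectation (\<lambda>w. I w \<bullet> f) = 0"
    by (simp add: elementary_integral_mean[OF el] LIMSEQ_const_iff)
qed

text \<open>Both sides are L^2 inner products, over M and over the product space; they agree for
  elementary integrands, and both approximations converge, so the limits agree.\<close>

lemma (in wiener) stochastic_integral_isometry:
  fixes T :: real and \<Phi> :: "real \<Rightarrow> 'a \<Rightarrow> 'h \<Rightarrow>\<^sub>L 'h"
  defines "\<psi> f x \<equiv> op_sqrt Q (blinfun_adjoint (\<Phi> (fst x) (snd x)) f)"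
  assumes I: "has_stochastic_integral M F W Q T \<Phi> I"
    and m: "\<And>f. \<psi> f \<in> borel_measurable (restrict_space lborel {0..T} \<Otimes>\<^sub>M M)"
  shows "square_integrable (restrict_space lborel {0..T} \<Otimes>\<^sub>M M) (\<psi> f)"
    and "expectation (\<lambda>w. (I w \<bullet> f) * (I w \<bullet> g)) =
      (\<integral>x. \<psi> f x \<bullet> \<psi> g x \<partial>(restrict_space lborel {0..T} \<Otimes>\<^sub>M M))"
proof -
  let ?N = "restrict_space lborel {0..T}"
  obtain n \<tau> \<phi> where el: "\<And>k. elementary_integrand F T (n k) (\<tau> k) (\<phi> k)"
    and hs: "(\<lambda>k. \<integral>\<^sup>+s\<in>{0..T}. (\<integral>\<^sup>+w. hs_norm_sq ((\<Phi> s w - elementary_process (n k) (\<tau> k) (\<phi> k) s w) o\<^sub>L op_sqrt Q) \<partial>M) \<partial>lborel) \<longlonglongrightarrow> 0"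
    and l: "(\<lambda>k. \<integral>\<^sup>+w. ennreal ((norm (I w - elementary_integral W (n k) (\<tau> k) (\<phi> k) w))\<^sup>2) \<partial>M) \<longlonglongrightarrow> 0"
    and [measurable]: "I \<in> borel_measurable M"
    using I unfolding has_stochastic_integral_def by blast
  define \<psi>k where "\<psi>k k f x = op_sqrt Q (blinfun_adjoint (elementary_process (n k) (\<tau> k) (\<phi> k) (fst x) (snd x)) f)" for k f x
  have sqk: "square_integrable (?N \<Otimes>\<^sub>M M) (\<psi>k k f)" for k f
    unfolding \<psi>k_def[abs_def] by (rule elementary_process_square_integrable[OF el])
  have [measurable]: "\<psi> f \<in> borel_measurable (?N \<Otimes>\<^sub>M M)" "\<psi>k k f \<in> borel_measurable (?N \<Otimes>\<^sub>M M)" for k f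
    using m sqk by (auto simp: square_integrable_def)
  obtain E :: "'h set" where "orthonormal_basis E" by (rule obtain_basis)
  then have ex: "\<exists>E::'h set. orthonormal_basis E" by blast
  have lim: "(\<lambda>k. \<integral>\<^sup>+x. ennreal ((norm (\<psi> f x - \<psi>k k f x))\<^sup>2) \<partial>(?N \<Otimes>\<^sub>M M)) \<longlonglongrightarrow> 0" for f
  proof -
    \<comment> \<open>The added 1 makes c positive, so its inverse can be moved into the integral of
      the error, whose measurability is known. The Hilbert-Schmidt side is then compared by
      monotonicity alone, with no measurability claim about \<open>hs_norm_sq\<close>.\<close>
    define c where "c = (norm f)\<^sup>2 + 1"
    have c: "c > 0" "(norm f)\<^sup>2 \<le> c" by (simp_all add: c_def add_nonneg_pos)
    let ?X = "\<lambda>k. \<integral>\<^sup>+x. ennreal ((norm (\<psi> f x - \<psi>k k f x))\<^sup>2) \<partial>(?N \<Otimes>\<^sub>M M)"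
    let ?H = "\<lambda>k. \<integral>\<^sup>+s\<in>{0..T}. (\<integral>\<^sup>+w. hs_norm_sq ((\<Phi> s w - elementary_process (n k) (\<tau> k) (\<phi> k) s w) o\<^sub>L op_sqrt Q) \<partial>M) \<partial>lborel"
    have "?X k \<le> ennreal c * ?H k" for k
    proof -
      have "ennreal (1 / c) * ?X k = (\<integral>\<^sup>+x. ennreal (1 / c) * ennreal ((norm (\<psi> f x - \<psi>k k f x))\<^sup>2) \<partial>(?N \<Otimes>\<^sub>M M))"
        by (rule nn_integral_cmult[symmetric]) measurable
      also have "\<dots> = (\<integral>\<^sup>+s. \<integral>\<^sup>+w. ennreal (1 / c) * ennreal ((norm (\<psi> f (s, w) - \<psi>k k f (s, w)))\<^sup>2) \<partial>M \<partial>?N)"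
        by (rule nn_integral_fst[symmetric]) measurable
      also have "\<dots> \<le> (\<integral>\<^sup>+s. \<integral>\<^sup>+w. hs_norm_sq ((\<Phi> s w - elementary_process (n k) (\<tau> k) (\<phi> k) s w) o\<^sub>L op_sqrt Q) \<partial>M \<partial>?N)"
      proof (intro nn_integral_mono)
        fix s w
        let ?D = "\<Phi> s w - elementary_process (n k) (\<tau> k) (\<phi> k) s w"
        have "ennreal ((norm (\<psi> f (s, w) - \<psi>k k f (s, w)))\<^sup>2) = ennreal ((norm (op_sqrt Q (blinfun_adjoint ?D f)))\<^sup>2)"
          by (simp add: \<psi>_def \<psi>k_def blinfun_adjoint_diff blinfun.diff_right)
        also have "\<dots> \<le> ennreal ((norm f)\<^sup>2) * hs_norm_sq (?D o\<^sub>L op_sqrt Q)"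
          by (rule hs_norm_sq_ge_adjoint[OF ex op_sqrt(1)[OF Q_symmetric Q_positive]])
        also have "\<dots> \<le> ennreal c * hs_norm_sq (?D o\<^sub>L op_sqrt Q)"
          by (intro mult_right_mono ennreal_leI c(2)) simp
        finally have "ennreal (1 / c) * ennreal ((norm (\<psi> f (s, w) - \<psi>k k f (s, w)))\<^sup>2) \<le>
            ennreal (1 / c) * (ennreal c * hs_norm_sq (?D o\<^sub>L op_sqrt Q))"
          by (rule mult_left_mono) simp
        then show "ennreal (1 / c) * ennreal ((norm (\<psi> f (s, w) - \<psi>k k f (s, w)))\<^sup>2) \<le> hs_norm_sq (?D o\<^sub>L op_sqrt Q)"
          using c by (simp add: mult.assoc[symmetric] flip: ennreal_mult)
      qed
      also have "\<dots> = ?H k" by (rule nn_integral_restrict_space) simp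
      finally have "ennreal c * (ennreal (1 / c) * ?X k) \<le> ennreal c * ?H k" by (rule mult_left_mono) simp
      then show ?thesis using c by (simp add: mult.assoc[symmetric] flip: ennreal_mult)
    qed
    then have up: "eventually (\<lambda>k. ?X k \<le> ennreal c * ?H k) sequentially" by simp
    have "(\<lambda>k. ennreal c * ?H k) \<longlonglongrightarrow> ennreal c * 0" by (intro ennreal_tendsto_cmult hs) simp
    then have "(\<lambda>k. ennreal c * ?H k) \<longlonglongrightarrow> 0" by simp
    from tendsto_sandwich[OF _ up tendsto_const this] show ?thesis by simp
  qed
  show sq: "square_integrable (?N \<Otimes>\<^sub>M M) (\<psi> f)" for f by (rule square_integrable_limit[OF sqk m lim])
  note I2 = stochastic_integral_L2(1)[OF I]
  note ek = square_integrable_elementary_integral[OF el]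
  have [measurable]: "elementary_integral W (n k) (\<tau> k) (\<phi> k) \<in> borel_measurable M" for k
    using ek by (auto simp: square_integrable_def)
  have 1: "(\<lambda>k. expectation (\<lambda>w. (elementary_integral W (n k) (\<tau> k) (\<phi> k) w \<bullet> f) \<bullet> (elementary_integral W (n k) (\<tau> k) (\<phi> k) w \<bullet> g)))
      \<longlonglongrightarrow> expectation (\<lambda>w. (I w \<bullet> f) \<bullet> (I w \<bullet> g))"
    by (intro L2_tendsto_inner square_integrable_inner_const ek I2 L2_tendsto_inner_const l) measurable
  have 2: "(\<lambda>k. \<integral>x. \<psi>k k f x \<bullet> \<psi>k k g x \<partial>(?N \<Otimes>\<^sub>M M)) \<longlonglongrightarrow> (\<integral>x. \<psi> f x \<bullet> \<psi> g x \<partial>(?N \<Otimes>\<^sub>M M))"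
    by (intro L2_tendsto_inner sqk sq lim)
  have "(\<integral>x. \<psi>k k f x \<bullet> \<psi>k k g x \<partial>(?N \<Otimes>\<^sub>M M)) =
      expectation (\<lambda>w. (elementary_integral W (n k) (\<tau> k) (\<phi> k) w \<bullet> f) \<bullet> (elementary_integral W (n k) (\<tau> k) (\<phi> k) w \<bullet> g))" for k
    unfolding \<psi>k_def inner_real_def by (rule elementary_process_isometry[OF el])
  with 1 2 have "expectation (\<lambda>w. (I w \<bullet> f) \<bullet> (I w \<bullet> g)) = (\<integral>x. \<psi> f x \<bullet> \<psi> g x \<partial>(?N \<Otimes>\<^sub>M M))"
    by (simp only: LIMSEQ_unique)
  then show "expectation (\<lambda>w. (I w \<bullet> f) * (I w \<bullet> g)) = (\<integral>x. \<psi> f x \<bullet> \<psi> g x \<partial>(?N \<Otimes>\<^sub>M M))"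
    by (simp only: inner_real_def)
qed

section \<open>Square integrability of mild solutions and measurability on the product space\<close>

lemma mild_solution_square_integrable:
  fixes Y :: "real \<Rightarrow> 'a \<Rightarrow> 'h::{real_inner, banach, second_countable_topology}"
  assumes "filtered_prob_space M F" "Wiener_process M F W Q" "mild_solution M F W Q U \<Phi> y Y" "0 \<le> s"
  shows "square_integrable M (Y s)"
proof -
  interpret wiener M F W Q
    using assms by (auto simp: wiener_def wiener_axioms_def filtered_prob_space_def)
  obtain I where I: "has_stochastic_integral M F W Q s (\<lambda>r w. U (s - r) o\<^sub>L \<Phi> r w) I"
    and ae: "AE w in M. Y s w = U s y + I w" and m: "Y s \<in> borel_measurable M"
    using assms(3,4) by (auto simp: mild_solution_def)
  have "square_integrable M (\<lambda>w. U s y + I w)"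
    by (intro square_integrable_add stochastic_integral_L2(1)[OF I]) (simp add: square_integrable_def)
  then show ?thesis using m ae by (rule square_integrable_cong_AE)
qed

text \<open>Every generator of the predictable sigma-algebra is a rectangle of a Borel set of times
  and an event, hence measurable in the product once cut down to [0, T].\<close>

lemma measurable_predictable_algebra:
  assumes "filtered_prob_space M F"
  shows "(\<lambda>x. x) \<in> measurable (restrict_space lborel {0..T} \<Otimes>\<^sub>M M) (predictable_algebra M F)"
  unfolding predictable_algebra_def
proof (rule measurable_measure_of)
  let ?N = "restrict_space lborel {0..T}"
  have sub: "sets (F t) \<subseteq> sets M" if "0 \<le> t" for t
    using assms that by (auto simp: filtered_prob_space_def subalgebra_def)
  have ss: "A \<subseteq> space M" if "0 \<le> t" "A \<in> sets (F t)" for t A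
    using sub[OF that(1)] that(2) by (intro sets.sets_into_space) blast
  let ?R = "{{0} \<times> A | A. A \<in> sets (F 0)} \<union> {{s<..t} \<times> A | s t A. 0 \<le> s \<and> s < t \<and> A \<in> sets (F s)}"
  have gen: "\<exists>B A s. y = B \<times> A \<and> B \<in> sets borel \<and> B \<subseteq> {0..} \<and> 0 \<le> s \<and> A \<in> sets (F s)"
    if y: "y \<in> ?R" for y :: "(real \<times> 'a) set"
  proof -
    consider A where "y = {0} \<times> A" "A \<in> sets (F 0)"
      | s t A where "y = {s<..t} \<times> A" "0 \<le> s" "s < t" "A \<in> sets (F s)"
      using y by blast
    then show ?thesis
    proof cases
      case 1
      then have "y = {0} \<times> A \<and> {0::real} \<in> sets borel \<and> {0::real} \<subseteq> {0..} \<and> 0 \<le> (0::real) \<and> A \<in> sets (F 0)"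
        by simp
      then show ?thesis by blast
    next
      case (2 s t A)
      then have "y = {s<..t} \<times> A \<and> {s<..t} \<in> sets borel \<and> {s<..t} \<subseteq> {0..} \<and> 0 \<le> s \<and> A \<in> sets (F s)"
        by auto
      then show ?thesis by blast
    qed
  qed
  show "?R \<subseteq> Pow ({0..} \<times> space M)"
  proof
    fix y assume "y \<in> ?R"
    from gen[OF this] obtain B A s where B: "y = B \<times> A" "B \<subseteq> {0..}" "0 \<le> s" "A \<in> sets (F s)"
      by (elim exE conjE)
    show "y \<in> Pow ({0..} \<times> space M)"
      unfolding B(1) Pow_iff by (rule Sigma_mono[OF B(2) ss[OF B(3,4)]])
  qed
  show "(\<lambda>x. x) \<in> space (?N \<Otimes>\<^sub>M M) \<rightarrow> {0..} \<times> space M"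
    by (auto simp: space_pair_measure space_restrict_space)
  have rect: "(\<lambda>x. x) -` (B \<times> A) \<inter> space (?N \<Otimes>\<^sub>M M) \<in> sets (?N \<Otimes>\<^sub>M M)"
    if "B \<in> sets borel" "A \<in> sets M" for A and B :: "real set"
  proof -
    have "(\<lambda>x. x) -` (B \<times> A) \<inter> space (?N \<Otimes>\<^sub>M M) = ({0..T} \<inter> B) \<times> A"
      using sets.sets_into_space[OF that(2)] by (auto simp: space_pair_measure space_restrict_space)
    moreover have "{0..T} \<inter> B \<in> sets ?N" using that(1) by (auto simp: sets_restrict_space)
    ultimately show ?thesis using that(2) by simp
  qed
  fix y assume "y \<in> ?R"
  from gen[OF this] obtain B A s where B: "y = B \<times> A" "B \<in> sets borel" "0 \<le> s" "A \<in> sets (F s)"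
    by (elim exE conjE)
  show "(\<lambda>x. x) -` y \<inter> space (?N \<Otimes>\<^sub>M M) \<in> sets (?N \<Otimes>\<^sub>M M)"
    unfolding B(1) using rect[OF B(2)] sub[OF B(3)] B(4) by blast
qed

text \<open>
  Dividing \<open>(z \<otimes> v) d = \<langle>z, d\<rangle> v\<close> by \<open>\<langle>z, d\<rangle>\<close>, where \<open>d\<close> is the first point of a dense sequence
  that is not orthogonal to \<open>z\<close>, recovers \<open>v\<close> measurably.
\<close>

lemma borel_measurable_tensor_factor:
  fixes z v :: "'a \<Rightarrow> 'h::{real_inner, second_countable_topology}"
  assumes [measurable]: "z \<in> borel_measurable M" and m[measurable]: "\<And>d. (\<lambda>x. (z x \<bullet> d) *\<^sub>R v x) \<in> borel_measurable M"
    and z: "\<And>x. x \<in> space M \<Longrightarrow> z x \<noteq> 0"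
  shows "v \<in> borel_measurable M"
proof -
  obtain D :: "'h set" where D: "countable D" "\<And>X. open X \<Longrightarrow> X \<noteq> {} \<Longrightarrow> \<exists>d\<in>D. d \<in> X"
    by (erule countable_dense_setE)
  define d where "d = from_nat_into D"
  have "D \<noteq> {}" using D(2)[of UNIV] by auto
  then have rd: "range d = D" unfolding d_def using D(1) by (rule range_from_nat_into)
  have ex: "\<exists>n. a \<bullet> d n \<noteq> 0" if "a \<noteq> 0" for a
  proof -
    have "open {x. 0 < a \<bullet> x}" by (intro open_Collect_less continuous_intros)
    moreover have "a \<in> {x. 0 < a \<bullet> x}" using that by simp
    ultimately obtain e where "e \<in> D" "0 < a \<bullet> e" using D(2)[of "{x. 0 < a \<bullet> x}"] by blast
    then show ?thesis using rd by (metis less_irrefl rangeE)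
  qed
  \<comment> \<open>A measurable index with countably many values: the quotients for the separate n
    are glued by \<open>measurable_compose_countable\<close>.\<close>
  define k where "k x = (LEAST n. z x \<bullet> d n \<noteq> 0)" for x
  have [measurable]: "k \<in> measurable M (count_space UNIV)" unfolding k_def[abs_def] by measurable
  have "(\<lambda>x. (1 / (z x \<bullet> d (k x))) *\<^sub>R ((z x \<bullet> d (k x)) *\<^sub>R v x)) \<in> borel_measurable M"
    by (rule measurable_compose_countable[of "\<lambda>n x. (1 / (z x \<bullet> d n)) *\<^sub>R ((z x \<bullet> d n) *\<^sub>R v x)"]) measurable
  moreover have eq: "(1 / (z x \<bullet> d (k x))) *\<^sub>R ((z x \<bullet> d (k x)) *\<^sub>R v x) = v x" if "x \<in> space M" for x
  proof -
    have "z x \<bullet> d (k x) \<noteq> 0" unfolding k_def by (rule LeastI_ex[OF ex[OF z[OF that]]])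
    then show ?thesis by simp
  qed
  ultimately show ?thesis by (simp only: measurable_cong[OF eq])
qed

section \<open>The covariance operator of X(t)\<close>

theorem mainTheorem5:
  fixes M :: "'a measure" and F :: "real \<Rightarrow> 'a measure"
    and W B Y Z X :: "real \<Rightarrow> 'a \<Rightarrow> 'h::{real_inner, banach, second_countable_topology}"
    and Q\<^sub>W Q\<^sub>B \<eta> :: "'h \<Rightarrow>\<^sub>L 'h"
    and D\<^sub>A D\<^sub>C :: "'h set" and A C :: "'h \<Rightarrow> 'h"
    and U S :: "real \<Rightarrow> 'h \<Rightarrow>\<^sub>L 'h"
    and Y\<^sub>0 X\<^sub>0 :: 'h
    and V \<Gamma> :: "real \<Rightarrow> 'a \<Rightarrow> 'h \<Rightarrow>\<^sub>L 'h"
    and t :: real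
  assumes "filtered_prob_space M F"
    and "Wiener_process M F W Q\<^sub>W" and "Wiener_process M F B Q\<^sub>B"
    and "independent_processes M W B"
    and "closure D\<^sub>A = UNIV" and "C0_semigroup U" and "is_generator D\<^sub>A A U"
    and "closure D\<^sub>C = UNIV" and "C0_semigroup S" and "is_generator D\<^sub>C C S"
    and "predictable_process M F Y"
    and "mild_solution M F W Q\<^sub>W U (\<lambda>s w. \<eta>) Y\<^sub>0 Y"
    and "V = (\<lambda>s w. Y s w \<otimes>\<^sub>H Y s w)"
    and "adapted_process F Z" and "predictable_process M F Z"
    and "\<forall>s\<ge>0. \<forall>w\<in>space M. norm (Z s w) = 1"
    and "\<Gamma> = (\<lambda>s w. Z s w \<otimes>\<^sub>H Y s w)"
    and "mild_solution M F B Q\<^sub>B S \<Gamma> X\<^sub>0 X"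
    and "t \<ge> 0"
  shows "has_covariance_operator M (X t) (covariance_operator M (X t))
    \<and> (\<forall>s\<in>{0..t}. Bochner_integrable M (\<lambda>w. (norm (op_sqrt Q\<^sub>B (Z s w)))\<^sup>2 *\<^sub>R V s w))
    \<and> Bochner_integrable (restrict_space lborel {0..t})
        (\<lambda>s. S (t - s)
          o\<^sub>L Bochner_integral M (\<lambda>w. (norm (op_sqrt Q\<^sub>B (Z s w)))\<^sup>2 *\<^sub>R V s w)
          o\<^sub>L blinfun_adjoint (S (t - s)))
    \<and> covariance_operator M (X t) =
        Bochner_integral (restrict_space lborel {0..t})
          (\<lambda>s. S (t - s)
            o\<^sub>L Bochner_integral M (\<lambda>w. (norm (op_sqrt Q\<^sub>B (Z s w)))\<^sup>2 *\<^sub>R V s w)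
            o\<^sub>L blinfun_adjoint (S (t - s)))"
proof -
  interpret B: wiener M F B Q\<^sub>B
    using assms(1,3) by (auto simp: wiener_def wiener_axioms_def filtered_prob_space_def)
  let ?N = "restrict_space lborel {0..t}"
  let ?P = "?N \<Otimes>\<^sub>M M"
  define R where "R = op_sqrt Q\<^sub>B"
  have Rm[measurable]: "blinfun_apply R \<in> borel_measurable borel"
    by (intro borel_measurable_continuous_onI linear_continuous_on blinfun.bounded_linear_right)
  obtain I where I: "has_stochastic_integral M F B Q\<^sub>B t (\<lambda>s w. S (t - s) o\<^sub>L \<Gamma> s w) I"
    and XI: "AE w in M. X t w = S t X\<^sub>0 + I w" and Xm[measurable]: "X t \<in> borel_measurable M"
    using assms(18,19) by (auto simp: mild_solution_def)
  note I2 = B.stochastic_integral_L2(1)[OF I]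
  have Im[measurable]: "I \<in> borel_measurable M" using I2 by (simp add: square_integrable_def)

  define z where "z x = Z (fst x) (snd x)" for x
  define p where "p x = S (t - fst x) (Y (fst x) (snd x))" for x
  define G where "G x = norm (R (z x)) *\<^sub>R p x" for x
  have zm[measurable]: "z \<in> borel_measurable ?P"
    using measurable_compose[OF measurable_predictable_algebra[OF assms(1), of t] assms(15)[unfolded predictable_process_def]]
    by (simp add: z_def[abs_def] case_prod_beta)
  have sp: "x \<in> space ?P \<longleftrightarrow> fst x \<in> {0..t} \<and> snd x \<in> space M" for x
    by (cases x) (auto simp: space_pair_measure space_restrict_space)
  \<comment> \<open>Applied to a vector d, the integrand is <z, d> p, measurable by the definition
    of the stochastic integral. Since |z| = 1, the factor p can be recovered.\<close>
  have pm[measurable]: "p \<in> borel_measurable ?P"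
  proof (rule borel_measurable_tensor_factor[OF zm])
    fix d
    have "(\<lambda>x. x) \<in> measurable ?P (restrict_space (predictable_algebra M F) ({0..t} \<times> space M))"
      by (rule measurable_restrict_space2[OF _ measurable_predictable_algebra[OF assms(1)]])
         (auto simp: space_pair_measure space_restrict_space)
    from measurable_compose[OF this, of "\<lambda>(s, w). (S (t - s) o\<^sub>L \<Gamma> s w) d"] I
    show "(\<lambda>x. (z x \<bullet> d) *\<^sub>R p x) \<in> borel_measurable ?P"
      by (simp add: has_stochastic_integral_def case_prod_beta assms(17) tensor.rep_eq z_def p_def blinfun.scaleR_right)
  next
    fix x assume "x \<in> space ?P"
    then have "norm (z x) = 1" using assms(16) by (simp add: sp z_def)
    then show "z x \<noteq> 0" by auto
  qed
  have Gm[measurable]: "G \<in> borel_measurable ?P" unfolding G_def[abs_def] by measurable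

  have adj: "op_sqrt Q\<^sub>B (blinfun_adjoint (S (t - fst x) o\<^sub>L \<Gamma> (fst x) (snd x)) f) = (p x \<bullet> f) *\<^sub>R R (z x)" for x f
  proof -
    have "blinfun_adjoint (S (t - fst x) o\<^sub>L \<Gamma> (fst x) (snd x)) f \<bullet> y = ((p x \<bullet> f) *\<^sub>R z x) \<bullet> y" for y
      unfolding blinfun_adjoint_inner
      by (simp add: assms(17) tensor.rep_eq p_def z_def blinfun.scaleR_right inner_commute[of f])
    then have "blinfun_adjoint (S (t - fst x) o\<^sub>L \<Gamma> (fst x) (snd x)) f = (p x \<bullet> f) *\<^sub>R z x"
      by (metis vector_eq_rdot)
    then show ?thesis by (simp add: R_def blinfun.scaleR_right)
  qed
  have \<psi>m: "(\<lambda>x. op_sqrt Q\<^sub>B (blinfun_adjoint (S (t - fst x) o\<^sub>L \<Gamma> (fst x) (snd x)) f)) \<in> borel_measurable ?P" for f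
    unfolding adj by measurable
  have GG: "(G x \<bullet> f) * (G x \<bullet> g) = ((p x \<bullet> f) *\<^sub>R R (z x)) \<bullet> ((p x \<bullet> g) *\<^sub>R R (z x))" for x f g
    by (simp add: G_def dot_square_norm power2_eq_square)
  have iso: "B.expectation (\<lambda>w. (I w \<bullet> f) * (I w \<bullet> g)) = (\<integral>x. (G x \<bullet> f) * (G x \<bullet> g) \<partial>?P)" for f g
    using B.stochastic_integral_isometry(2)[OF I \<psi>m] by (simp only: adj GG)
  have Gf: "integrable ?P (\<lambda>x. (G x \<bullet> f)\<^sup>2)" for f
    using integrable_inner[OF B.stochastic_integral_isometry(1)[OF I \<psi>m, of f] B.stochastic_integral_isometry(1)[OF I \<psi>m, of f]]
    by (simp only: adj GG[symmetric] power2_eq_square)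

  \<comment> \<open>The isometry with f = g = e, summed over a basis, identifies the integral of
    |G|^2 with E|I|^2, which is finite because I is an L^2 limit of elementary integrals.\<close>
  have G2: "square_integrable ?P G"
  proof -
    obtain E :: "'h set" where E: "orthonormal_basis E" by (rule B.obtain_basis)
    have "(\<integral>\<^sup>+x. ennreal ((norm (G x))\<^sup>2) \<partial>?P) = (\<integral>\<^sup>+x. \<integral>\<^sup>+e. ennreal ((G x \<bullet> e)\<^sup>2) \<partial>count_space E \<partial>?P)"
      by (simp add: parseval[OF E])
    also have "\<dots> = (\<integral>\<^sup>+e. \<integral>\<^sup>+x. ennreal ((G x \<bullet> e)\<^sup>2) \<partial>?P \<partial>count_space E)"
      by (rule nn_integral_count_space_nn_integral[OF orthonormal_basis_countable[OF E]]) measurable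
    also have "\<dots> = (\<integral>\<^sup>+e. \<integral>\<^sup>+w. ennreal ((I w \<bullet> e)\<^sup>2) \<partial>M \<partial>count_space E)"
    proof (rule nn_integral_cong)
      fix e
      have "integrable M (\<lambda>w. (I w \<bullet> e)\<^sup>2)"
        using square_integrable_inner_const[OF I2, of e] by (simp add: square_integrable_def)
      then show "(\<integral>\<^sup>+x. ennreal ((G x \<bullet> e)\<^sup>2) \<partial>?P) = (\<integral>\<^sup>+w. ennreal ((I w \<bullet> e)\<^sup>2) \<partial>M)"
        using Gf[of e] iso[of e e] by (simp add: nn_integral_eq_integral flip: power2_eq_square)
    qed
    also have "\<dots> = (\<integral>\<^sup>+w. \<integral>\<^sup>+e. ennreal ((I w \<bullet> e)\<^sup>2) \<partial>count_space E \<partial>M)"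
      by (rule nn_integral_count_space_nn_integral[OF orthonormal_basis_countable[OF E], symmetric]) measurable
    also have "\<dots> = (\<integral>\<^sup>+w. ennreal ((norm (I w))\<^sup>2) \<partial>M)" by (simp add: parseval[OF E])
    also have "\<dots> < \<infinity>" using I2 by (simp add: square_integrable_iff)
    finally show ?thesis by (simp add: square_integrable_iff)
  qed

  \<comment> \<open>The scalar weight is absorbed into the vector, so that |R Z|^2 V is the square u
    \<otimes> u and G(s) = S(t - s) u(s).\<close>
  define u where "u s w = norm (R (Z s w)) *\<^sub>R Y s w" for s w
  \<comment> \<open>Square integrability of Y(s) as a mild solution gives this at every time s;
    Fubini applied to \<open>G2\<close> would give information at almost every s only.\<close>
  have u2: "square_integrable M (u s)" if s: "0 \<le> s" for s
  proof (rule square_integrable_bound[OF mild_solution_square_integrable[OF assms(1,2,12) s], of _ "norm R"])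
    have "Z s \<in> borel_measurable (F s)" using assms(14) s by (simp add: adapted_process_def)
    then have "Z s \<in> borel_measurable M" by (rule measurable_from_subalg[OF B.subalgebra_M[OF s]])
    moreover have "Y s \<in> borel_measurable M" using assms(12) s by (simp add: mild_solution_def)
    ultimately show "u s \<in> borel_measurable M" unfolding u_def[abs_def] by measurable
    fix w assume "w \<in> space M"
    then show "norm (u s w) \<le> norm R * norm (Y s w)"
      using norm_blinfun[of R "Z s w"] assms(16) s by (simp add: u_def mult_right_mono)
  qed
  have uV: "(norm (op_sqrt Q\<^sub>B (Z s w)))\<^sup>2 *\<^sub>R V s w = u s w \<otimes>\<^sub>H u s w" for s w
    by (rule blinfun_eqI) (simp add: assms(13) u_def R_def tensor.rep_eq blinfun.scaleR_left power2_eq_square)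
  define c where "c s = Bochner_integral M (\<lambda>w. u s w \<otimes>\<^sub>H u s w)" for s
  define K where "K s = (S (t - s) o\<^sub>L c s o\<^sub>L blinfun_adjoint (S (t - s)))" for s
  have Gs: "G (s, w) = S (t - s) (u s w)" for s w
    by (simp add: G_def p_def z_def u_def blinfun.scaleR_right)
  have finN: "finite_measure ?N" by (rule finite_measure_lborel_interval)
  have K: "K s a \<bullet> b = (\<integral>w. (G (s, w) \<bullet> a) * (G (s, w) \<bullet> b) \<partial>M)" if "s \<in> space ?N" for s a b
  proof -
    have "0 \<le> s" using that by (simp add: space_restrict_space)
    have "K s a \<bullet> b = c s (blinfun_adjoint (S (t - s)) a) \<bullet> blinfun_adjoint (S (t - s)) b"
      by (simp add: K_def inner_blinfun_eq_adjoint[of "S (t - s)"])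
    also have "\<dots> = (\<integral>w. (G (s, w) \<bullet> a) * (G (s, w) \<bullet> b) \<partial>M)"
      unfolding c_def Bochner_tensor_square(2)[OF B.finite_measure_axioms u2[OF \<open>0 \<le> s\<close>]]
      by (simp add: Gs inner_blinfun_eq_adjoint)
    finally show ?thesis .
  qed
  have Gs2: "square_integrable M (\<lambda>w. G (s, w))" if "s \<in> space ?N" for s
    unfolding Gs using that by (intro square_integrable_blinfun u2) (simp add: space_restrict_space)
  have Kint: "Bochner_integrable ?N K"
    by (rule Bochner_second_moment(1)[OF finN B.finite_measure_axioms G2 Gs2 K])
  have KG: "Bochner_integral ?N K a \<bullet> b = (\<integral>x. (G x \<bullet> a) * (G x \<bullet> b) \<partial>?P)" for a b
    by (rule Bochner_second_moment(2)[OF finN B.finite_measure_axioms G2 Gs2 K])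
  define T where "T = Bochner_integral ?N K"

  have "integrable M I" by (rule square_integrable_integrable[OF B.finite_measure_axioms I2])
  moreover have "integral\<^sup>L M I \<bullet> f = 0" for f
    using B.stochastic_integral_L2(2)[OF I, of f] \<open>integrable M I\<close> by simp
  \<comment> \<open>A vector orthogonal to every f is orthogonal to itself. Hence the mean of X(t)
    is S(t) applied to the initial value, and centring leaves exactly I.\<close>
  then have "integral\<^sup>L M I = 0" by (metis inner_eq_zero_iff)
  moreover have "integral\<^sup>L M (X t) = integral\<^sup>L M (\<lambda>w. S t X\<^sub>0 + I w)"
    using XI by (intro integral_cong_AE) auto
  ultimately have EX: "integral\<^sup>L M (X t) = S t X\<^sub>0" by (simp add: B.prob_space)
  have cov: "(\<integral>w. ((X t w - integral\<^sup>L M (X t)) \<bullet> f) * ((X t w - integral\<^sup>L M (X t)) \<bullet> g) \<partial>M) = T f \<bullet> g" for f g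
  proof -
    have "(\<integral>w. ((X t w - integral\<^sup>L M (X t)) \<bullet> f) * ((X t w - integral\<^sup>L M (X t)) \<bullet> g) \<partial>M) =
        (\<integral>w. (I w \<bullet> f) * (I w \<bullet> g) \<partial>M)"
      unfolding EX using XI by (intro integral_cong_AE) auto
    then show ?thesis by (simp only: iso KG T_def)
  qed
  have "square_integrable M (X t)"
    using mild_solution_square_integrable[OF assms(1,3,18,19)] .
  then have has: "has_covariance_operator M (X t) T"
    by (simp add: has_covariance_operator_def square_integrable_def cov)
  \<comment> \<open>The pairings prescribed by the covariance determine the operator, so the
    \<open>THE\<close> in \<open>covariance_operator\<close> denotes T.\<close>
  moreover have "Q = T" if "has_covariance_operator M (X t) Q" for Q
  proof (rule blinfun_eqI)
    fix f
    have "Q f \<bullet> g = T f \<bullet> g" for g using that by (simp add: has_covariance_operator_def cov)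
    then show "Q f = T f" by (metis vector_eq_rdot)
  qed
  ultimately have covT: "covariance_operator M (X t) = T"
    unfolding covariance_operator_def by (rule the_equality)
  have "Bochner_integrable M (\<lambda>w. u s w \<otimes>\<^sub>H u s w)" if "s \<in> {0..t}" for s
    using that by (intro Bochner_tensor_square(1)[OF B.finite_measure_axioms u2]) simp
  then show ?thesis
    using has Kint covT unfolding uV T_def K_def[abs_def] c_def by simp
qed

end
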